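(* Let $\langle G\rightarrow S,\alpha\rightarrow A\rangle$ be an ordinary voltage graph embedding ($S$ orientable or nonorientable), and let $z\in Z(G)$ induce a nonseparating orientation-preserving cycle $G[z]$. Let $W=d_1\cdots d_k$ be an Eulerian walk of $G[z]$ based at $v\in V(G[z])$, and let $w',y'$ be the vertices of the special claw corresponding to the edge of $d_1$ described in the context. Fix $a\in A$ and consider the component $S_v^a$ of $S^\alpha$. Then: (1) Each of the z-regions of $S_v^a$ with respect to $\{z_v^b: b\in aA(v)\}$ contains a vertex in the fiber over $w'$ and a vertex in the fiber over $y'$. (2) If there is more than one z-region of $S_v^a$ with respect to $\{z_v^b: b\in aA(v)\}$, then each z-region is bounded by an even number of cycles of $G[z]^\alpha$.
   Context: Graphs are finite connected multigraphs (loops and multiple edges allowed); a cycle is a connected 2-regular subgraph (a loop is a cycle). $S$ is a compact connected surface without boundary, and $G\rightarrow S$ denotes a cellular embedding. $D(G)$ is the set of darts (directed edges); a dart $d$ has tail $t(d)$, head $h(d)$ and opposite dart $d^{-1}$; each edge has one dart chosen as positive, also denoted $e$. A walk is a sequence of darts $d_1\cdots d_m$ with $h(d_i)=t(d_{i+1})$; it is closed if $h(d_m)=t(d_1)$. An ordinary voltage graph embedding $\langle G\rightarrow S,\alpha\rightarrow A\rangle$ consists of a cellular embedding $G\rightarrow S$, a finite group $A$, and a map $\alpha:D(G)\to A$ with $\alpha(d^{-1})=\alpha(d)^{-1}$. The net voltage of $W=d_1\cdots d_m$ is $\omega(W)=\alpha(d_1)\cdots\alpha(d_m)$. The derived graph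 $G^\alpha$ has vertices $v^a$ and edges $e^a$ ($a\in A$), the directed edge $e^a$ going from $t(e)^a$ to $h(e)^{a\alpha(e)}$; $p$ is the projection $v^a\mapsto v$, $e^a\mapsto e$. The derived embedding $G^\alpha\rightarrow S^\alpha$ is obtained by gluing a 2-cell to each closed walk of $G^\alpha$ that is a lift of a facial boundary: if a face has boundary walk $W_f$ with $\omega(W_f)$ of order $r$, there are $|A|/r$ faces over it, each bounded by a concatenation of $r$ successive lifts of $W_f$. $S^\alpha$ need not be connected; $S_v^a$ is the component containing $v^a$. The map $p$ extends to a (possibly branched) covering $S^\alpha\to S$. $A(v)$ is the group of net voltages of closed walks in $G$ based at $v$. $Z(G)$ is the cycle space of $G$ over $\mathbb{Z}_2$; for a 1-chain $z$, $G[z]$ is the subgraph induced by its edges. A cycle is orientation-preserving if a thin (ribbon) neighborhood of it is an annulus, and orientation-reversing if it is a Möbius band. A cycle $C$ of $G$ is separating if $S\setminus C$ is not connected and nonseparating otherwise. An Eulerian walk of a cycle is a closed walk traversing each of its edges exactly once. $G[z]^\alpha=p^{-1}(G[z])$ is a disjoint union of cycles; $G[z]_v^a$ is the component containing $v^a$, and $z_v^a$ is the 1-chain of $S^\alpha$ inducing it. The 1-chains over $z$ contained in $S_v^a$ are those in $\{z_v^b:b\in aA(v)\}$. Given a set $X$ of 1-chains inducing pairwise vertex-disjoint orientation-preserving cycles, the z-regions with respect to $X$ are the connected sub-2-complexes bounded by these cycles, i.e. those formed by the faces (with their subfaces) in a connected component of the surface minus the union of the cycles. Medial graph and special claw. A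 corner of $G\rightarrow S$ at a vertex $x$ is a component of (small disc neighborhood of $x$) minus the edges at $x$. The subdivision $G'$ of $G$ has a new vertex $v_e$ in the middle of each edge $e$. The medial graph $M$ has vertices $v_e$ ($e\in E(G)$) and, for each corner, one edge drawn across the corner joining the vertices $v_e,v_{e'}$ of the edges $e,e'$ bounding the corner. $M'$ is obtained from $M$ by subdividing each edge, adding one vertex per corner (placed in that corner). The total graph $T(G)$ is $G'\cup M'$. The extended voltage assignment: fix a preferred direction on each edge $e$; in $G'$ the dart from $t(e)$ to $v_e$ gets $\alpha(e)$ and the dart from $v_e$ to $h(e)$ gets $1_A$; in $M'$, for each of the two corners at the tail end of $e$ flanked by $e$, the dart from the subdividing vertex of that corner to $v_e$ gets $\alpha(e)$; inverse darts get inverse voltages, and all remaining darts get $1_A$. The derived graph of $M'$ is embedded in $S^\alpha$ as the subdivided medial graph of the derived embedding of $G'$; the fiber over a vertex $x$ of $M'$ is $\{x^a:a\in A\}$. The special claw corresponding to an edge $e$ at its end at the vertex $v$ is the subgraph of $T(G)$ consisting of the three edges joining $v_e$ to $v$, $w'$, $y'$, where $w',y'$ are the vertices of $M'$ lying in the two corners at $v$ flanking that end of $e$. Here it is taken for the edge of $d_1$ at its end at $v=t(d_1)$. *)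

theory Defs
  imports
    "HOL-Analysis.Analysis"
    "HOL-Library.Z2"
    "HOL-Algebra.Generated_Groups"
    "HOL-Algebra.Multiplicative_Group"
    "Graph_Theory.Graph_Theory"
begin

section \<open>Multigraphs with darts, chains and cycles\<close>

text \<open>
  A multigraph is given by its darts, which are the arcs of an underlying digraph, the reversal of
  darts, and a choice of one positive dart for each edge. Edges are identified with
  their positive darts, and 1-chains over the two-element field with finite sets of edges.
\<close>

record ('v, 'd) mgraph =
  dg :: "('v, 'd) pre_digraph"
  dinv :: "'d \<Rightarrow> 'd"
  pos :: "'d set"

text \<open>Only the values of \<^term>\<open>dinv G\<close> on darts of \<^term>\<open>G\<close> matter, whereas
  \<^const>\<open>bidirected_digraph\<close> wants a permutation of the whole type that is the identity elsewhere.\<close>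

definition multigraph :: "('v, 'd) mgraph \<Rightarrow> bool" where
  "multigraph G \<longleftrightarrow>
     fin_digraph (dg G) \<and>
     bidirected_digraph (dg G) (\<lambda>d. if d \<in> arcs (dg G) then dinv G d else d) \<and>
     pos G \<subseteq> arcs (dg G) \<and>
     (\<forall>d\<in>arcs (dg G). d \<in> pos G \<longleftrightarrow> dinv G d \<notin> pos G)"

definition under_edge :: "('v, 'd) mgraph \<Rightarrow> 'd \<Rightarrow> 'd" where
  "under_edge G d = (if d \<in> pos G then d else dinv G d)"

definition walk :: "('v, 'd) mgraph \<Rightarrow> 'v \<Rightarrow> 'd list \<Rightarrow> 'v \<Rightarrow> bool" where
  "walk G u p v \<longleftrightarrow> pre_digraph.awalk (dg G) u p v"

definition cycle_space :: "('v, 'd) mgraph \<Rightarrow> 'd set set" where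
  "cycle_space G =
     {z. z \<subseteq> pos G \<and>
         (\<forall>x\<in>verts (dg G).
            (\<Sum>e\<in>z. of_bool (tail (dg G) e = x) + of_bool (head (dg G) e = x) :: bit) = 0)}"

definition induced_graph :: "('v, 'd) mgraph \<Rightarrow> 'd set \<Rightarrow> ('v, 'd) mgraph" where
  "induced_graph G z =
     \<lparr>dg = \<lparr>verts = tail (dg G) ` z \<union> head (dg G) ` z,
            arcs = z \<union> dinv G ` z,
            tail = tail (dg G), head = head (dg G)\<rparr>,
      dinv = dinv G, pos = z\<rparr>"

text \<open>A loop contributes two darts to the degree of its vertex.\<close>

definition is_cycle :: "('v, 'd) mgraph \<Rightarrow> bool" where
  "is_cycle G \<longleftrightarrow>
     Digraph_Component.connected (dg G) \<and> (\<forall>x\<in>verts (dg G). card (out_arcs (dg G) x) = 2)"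

definition eulerian_walk :: "('v, 'd) mgraph \<Rightarrow> 'v \<Rightarrow> 'd list \<Rightarrow> bool" where
  "eulerian_walk G v W \<longleftrightarrow>
     walk G v W v \<and> (\<forall>e\<in>pos G. length (filter (\<lambda>d. under_edge G d = e) W) = 1)"


section \<open>Polygonal 2-complexes and cellular embeddings\<close>

text \<open>
  A face is a closed disc whose boundary circle is glued along the closed walk \<^term>\<open>bd K f\<close>.
  (Boundary walks are nonempty; this only excludes the graph without edges in the sphere.)
\<close>

record ('v, 'd, 'f) cell_complex =
  skel :: "('v, 'd) mgraph"
  faces :: "'f set"
  bd :: "'f \<Rightarrow> 'd list"

definition polygonal_complex :: "('v, 'd, 'f) cell_complex \<Rightarrow> bool" where
  "polygonal_complex K \<longleftrightarrow>
     multigraph (skel K) \<and> finite (faces K) \<and>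
     (\<forall>f\<in>faces K. bd K f \<noteq> [] \<and> (\<exists>u. walk (skel K) u (bd K f) u))"

text \<open>
  The points of the geometric realization: vertices, interior points of edges (parametrized by the
  open unit interval from tail to head of the positive dart), and interior points of faces
  (parametrized by the open unit disc).
\<close>

datatype ('v, 'd, 'f) point = VPt 'v | EPt 'd real | FPt 'f complex

definition points :: "('v, 'd, 'f) cell_complex \<Rightarrow> ('v, 'd, 'f) point set" where
  "points K =
     VPt ` verts (dg (skel K)) \<union>
     {EPt e t | e t. e \<in> pos (skel K) \<and> 0 < t \<and> t < 1} \<union>
     {FPt f x | f x. f \<in> faces K \<and> norm x < 1}"

definition edge_point :: "('v, 'd) mgraph \<Rightarrow> 'd \<Rightarrow> real \<Rightarrow> ('v, 'd, 'f) point" where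
  "edge_point G e t =
     (if t = 0 then VPt (tail (dg G) e) else if t = 1 then VPt (head (dg G) e) else EPt e t)"

definition dart_point :: "('v, 'd) mgraph \<Rightarrow> 'd \<Rightarrow> real \<Rightarrow> ('v, 'd, 'f) point" where
  "dart_point G d t = (if d \<in> pos G then edge_point G d t else edge_point G (dinv G d) (1 - t))"

text \<open>
  The characteristic map of a face with boundary walk of length \<open>n\<close>: the arc of the unit circle
  between the angles \<open>2 * pi * i / n\<close> and \<open>2 * pi * (i + 1) / n\<close> runs along the \<open>i\<close>-th dart.
\<close>

definition face_map :: "('v, 'd, 'f) cell_complex \<Rightarrow> 'f \<Rightarrow> complex \<Rightarrow> ('v, 'd, 'f) point" where
  "face_map K f x =
     (if norm x < 1 then FPt f x
      else let s = real (length (bd K f)) * Arg2pi x / (2 * pi)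
           in dart_point (skel K) (bd K f ! nat \<lfloor>s\<rfloor>) (frac s))"

text \<open>The realization carries the weak (quotient) topology of the closed cells.\<close>

definition realization :: "('v, 'd, 'f) cell_complex \<Rightarrow> ('v, 'd, 'f) point topology" where
  "realization K = topology (\<lambda>U.
     U \<subseteq> points K \<and>
     (\<forall>e\<in>pos (skel K).
        openin (top_of_set {0..1}) {t \<in> {0..1}. edge_point (skel K) e t \<in> U}) \<and>
     (\<forall>f\<in>faces K.
        openin (top_of_set (cball 0 1)) {x \<in> cball 0 1. face_map K f x \<in> U}))"

lemma openin_realization:
  "openin (realization K) U \<longleftrightarrow>
     U \<subseteq> points K \<and>
     (\<forall>e\<in>pos (skel K).
        openin (top_of_set {0..1}) {t \<in> {0..1}. edge_point (skel K) e t \<in> U}) \<and>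
     (\<forall>f\<in>faces K.
        openin (top_of_set (cball 0 1)) {x \<in> cball 0 1. face_map K f x \<in> U})"
proof -
  have int: "{x \<in> B. g x \<in> S \<inter> T} = {x \<in> B. g x \<in> S} \<inter> {x \<in> B. g x \<in> T}"
    for B :: "'x set" and g :: "'x \<Rightarrow> ('a, 'b, 'c) point" and S T by auto
  have un: "{x \<in> B. g x \<in> \<Union> \<K>} = (\<Union>T\<in>\<K>. {x \<in> B. g x \<in> T})"
    for B :: "'x set" and g :: "'x \<Rightarrow> ('a, 'b, 'c) point" and \<K> by auto
  have "istopology (\<lambda>U.
     U \<subseteq> points K \<and>
     (\<forall>e\<in>pos (skel K).
        openin (top_of_set {0..1}) {t \<in> {0..1}. edge_point (skel K) e t \<in> U}) \<and>
     (\<forall>f\<in>faces K.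
        openin (top_of_set (cball 0 1)) {x \<in> cball 0 1. face_map K f x \<in> U}))"
    unfolding istopology_def
    apply (intro conjI allI impI)
    subgoal by blast
    subgoal by (simp only: int) (intro ballI openin_Int; blast)
    subgoal by (simp only: int) (intro ballI openin_Int; blast)
    subgoal by blast
    subgoal by (simp only: un) (intro ballI openin_Union; blast)
    subgoal by (simp only: un) (intro ballI openin_Union; blast)
    done
  then show ?thesis
    unfolding realization_def by (simp only: topology_inverse')
qed

definition closed_surface :: "'s topology \<Rightarrow> bool" where
  "closed_surface S \<longleftrightarrow>
     compact_space S \<and> connected_space S \<and> Hausdorff_space S \<and>
     (\<forall>x\<in>topspace S. \<exists>U. openin S U \<and> x \<in> U \<and>
        subtopology S U homeomorphic_space (euclidean :: (real ^ 2) topology))"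

text \<open>
  A cellular embedding of a connected graph in \<open>S\<close> presents \<open>S\<close> as the graph with open discs
  attached along the facial walks; \<open>\<phi>\<close> collects the embedding of the graph and the characteristic
  maps of the faces.
\<close>

definition cellular_embedding ::
    "('v, 'd, 'f) cell_complex \<Rightarrow> 's topology \<Rightarrow> (('v, 'd, 'f) point \<Rightarrow> 's) \<Rightarrow> bool" where
  "cellular_embedding K S \<phi> \<longleftrightarrow>
     polygonal_complex K \<and> Digraph_Component.connected (dg (skel K)) \<and>
     homeomorphic_map (realization K) S \<phi>"

definition chain_points :: "('v, 'd) mgraph \<Rightarrow> 'd set \<Rightarrow> ('v, 'd, 'f) point set" where
  "chain_points G z = (\<Union>e\<in>z. edge_point G e ` {0..1})"

definition separating :: "'s topology \<Rightarrow> 's set \<Rightarrow> bool" where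
  "separating S C \<longleftrightarrow> \<not> connectedin S (topspace S - C)"

text \<open>Some neighborhood of the curve \<open>C\<close> is an open annulus with core \<open>C\<close>.\<close>

definition orientation_preserving :: "'s topology \<Rightarrow> 's set \<Rightarrow> bool" where
  "orientation_preserving S C \<longleftrightarrow>
     (\<exists>N h. openin S N \<and> C \<subseteq> N \<and>
        homeomorphic_map (subtopology S N)
          (top_of_set (sphere (0 :: complex) 1 \<times> {-1 <..< 1 :: real})) h \<and>
        h ` C = sphere 0 1 \<times> {0})"


section \<open>Voltage assignments and derived embeddings\<close>

definition voltage_assignment ::
    "('a, 'm) monoid_scheme \<Rightarrow> ('v, 'd) mgraph \<Rightarrow> ('d \<Rightarrow> 'a) \<Rightarrow> bool" where
  "voltage_assignment A G \<alpha> \<longleftrightarrow>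
     (\<forall>d\<in>arcs (dg G). \<alpha> d \<in> carrier A \<and> \<alpha> (dinv G d) = inv\<^bsub>A\<^esub> (\<alpha> d))"

definition ordinary_voltage_graph_embedding ::
    "('v, 'd, 'f) cell_complex \<Rightarrow> 's topology \<Rightarrow> (('v, 'd, 'f) point \<Rightarrow> 's) \<Rightarrow>
     ('a, 'm) monoid_scheme \<Rightarrow> ('d \<Rightarrow> 'a) \<Rightarrow> bool" where
  "ordinary_voltage_graph_embedding K S \<phi> A \<alpha> \<longleftrightarrow>
     cellular_embedding K S \<phi> \<and> group A \<and> finite (carrier A) \<and>
     voltage_assignment A (skel K) \<alpha>"

definition net_voltage :: "('a, 'm) monoid_scheme \<Rightarrow> ('d \<Rightarrow> 'a) \<Rightarrow> 'd list \<Rightarrow> 'a" where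
  "net_voltage A \<alpha> p = foldr (\<lambda>d x. \<alpha> d \<otimes>\<^bsub>A\<^esub> x) p \<one>\<^bsub>A\<^esub>"

definition local_group ::
    "('a, 'm) monoid_scheme \<Rightarrow> ('d \<Rightarrow> 'a) \<Rightarrow> ('v, 'd) mgraph \<Rightarrow> 'v \<Rightarrow> 'a set" where
  "local_group A \<alpha> G v = {net_voltage A \<alpha> p | p. walk G v p v}"

text \<open>The vertex \<open>x\<^sup>a\<close> is the pair \<open>(x, a)\<close>. For a positive dart \<open>e\<close>, the edge \<open>e\<^sup>a\<close> is
  \<open>(e, a)\<close>; for any dart \<open>d\<close>, \<open>(d, a)\<close> is the dart over \<open>d\<close> that starts at \<open>(tail d, a)\<close>.\<close>

definition derived_graph ::
    "('a, 'm) monoid_scheme \<Rightarrow> ('d \<Rightarrow> 'a) \<Rightarrow> ('v, 'd) mgraph \<Rightarrow> ('v \<times> 'a, 'd \<times> 'a) mgraph" where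
  "derived_graph A \<alpha> G =
     \<lparr>dg = \<lparr>verts = verts (dg G) \<times> carrier A,
            arcs = arcs (dg G) \<times> carrier A,
            tail = (\<lambda>(d, a). (tail (dg G) d, a)),
            head = (\<lambda>(d, a). (head (dg G) d, a \<otimes>\<^bsub>A\<^esub> \<alpha> d))\<rparr>,
      dinv = (\<lambda>(d, a). (dinv G d, a \<otimes>\<^bsub>A\<^esub> \<alpha> d)),
      pos = pos G \<times> carrier A\<rparr>"

fun lift_walk :: "('a, 'm) monoid_scheme \<Rightarrow> ('d \<Rightarrow> 'a) \<Rightarrow> 'a \<Rightarrow> 'd list \<Rightarrow> ('d \<times> 'a) list" where
  "lift_walk A \<alpha> a [] = []"
| "lift_walk A \<alpha> a (d # p) = (d, a) # lift_walk A \<alpha> (a \<otimes>\<^bsub>A\<^esub> \<alpha> d) p"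

text \<open>
  Let \<open>r\<close> be the order of the net voltage \<open>\<omega>\<close> of the boundary walk of \<open>f\<close>. The lifts of that walk
  starting at the elements of one left coset of the subgroup generated by \<open>\<omega>\<close> follow each other
  cyclically and bound one common face, so the faces over \<open>f\<close> are indexed by these cosets.
  The choice of an element of the coset only affects where the boundary walk begins.
\<close>

definition derived_complex ::
    "('a, 'm) monoid_scheme \<Rightarrow> ('d \<Rightarrow> 'a) \<Rightarrow> ('v, 'd, 'f) cell_complex \<Rightarrow>
     ('v \<times> 'a, 'd \<times> 'a, 'f \<times> 'a set) cell_complex" where
  "derived_complex A \<alpha> K =
     \<lparr>skel = derived_graph A \<alpha> (skel K),
      faces = {(f, a <#\<^bsub>A\<^esub> generate A {net_voltage A \<alpha> (bd K f)}) | f a.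
                 f \<in> faces K \<and> a \<in> carrier A},
      bd = (\<lambda>(f, C). lift_walk A \<alpha> (SOME a. a \<in> C)
              (concat (replicate (group.ord A (net_voltage A \<alpha> (bd K f))) (bd K f))))\<rparr>"

text \<open>The 1-chain \<open>z\<^sub>x\<^sup>b\<close> of the component of the preimage of \<open>G[z]\<close> containing \<open>u = x\<^sup>b\<close>.\<close>

definition lifted_chain ::
    "('a, 'm) monoid_scheme \<Rightarrow> ('d \<Rightarrow> 'a) \<Rightarrow> ('v, 'd) mgraph \<Rightarrow> 'd set \<Rightarrow> 'v \<times> 'a \<Rightarrow>
     ('d \<times> 'a) set" where
  "lifted_chain A \<alpha> G z u =
     (let H = derived_graph A \<alpha> (induced_graph G z)
      in {e \<in> pos H. u \<rightarrow>\<^sup>*\<^bsub>dg H\<^esub> tail (dg H) e})"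

definition lifted_cycles ::
    "('a, 'm) monoid_scheme \<Rightarrow> ('d \<Rightarrow> 'a) \<Rightarrow> ('v, 'd) mgraph \<Rightarrow> 'd set \<Rightarrow> ('d \<times> 'a) set set" where
  "lifted_cycles A \<alpha> G z =
     lifted_chain A \<alpha> G z ` verts (dg (derived_graph A \<alpha> (induced_graph G z)))"

text \<open>
  The regions of a part \<open>Y\<close> of the realization of \<open>K\<close> with respect to a set \<open>X\<close> of 1-chains, as
  closed subspaces: each is the union of the closed faces whose interiors lie in one connected
  component of \<open>Y\<close> minus the cycles induced by \<open>X\<close>.
\<close>

definition regions ::
    "('v, 'd, 'f) cell_complex \<Rightarrow> ('v, 'd, 'f) point set \<Rightarrow> 'd set set \<Rightarrow>
     ('v, 'd, 'f) point set set" where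
  "regions K Y X =
     {\<Union>f\<in>{f \<in> faces K. FPt f ` ball 0 1 \<subseteq> Q}. face_map K f ` cball 0 1 | Q.
        Q \<in> connected_components_of
              (subtopology (realization K) (Y - (\<Union>c\<in>X. chain_points (skel K) c)))}"

text \<open>The region \<open>R\<close> is bounded by the cycles induced by the members of \<open>B\<close>.\<close>

definition bounded_by ::
    "('v, 'd, 'f) cell_complex \<Rightarrow> ('v, 'd, 'f) point set \<Rightarrow> 'd set set \<Rightarrow> bool" where
  "bounded_by K R B \<longleftrightarrow> realization K frontier_of R = (\<Union>c\<in>B. chain_points (skel K) c)"


section \<open>The total graph and special claws\<close>

text \<open>
  The corner \<open>(f, i)\<close> lies in the face \<open>f\<close> at the tail of the \<open>i\<close>-th dart of its boundary walk.
  Its two flanking edge ends are recorded by the darts leaving the vertex along them.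
\<close>

definition corners :: "('v, 'd, 'f) cell_complex \<Rightarrow> ('f \<times> nat) set" where
  "corners K = {(f, i). f \<in> faces K \<and> i < length (bd K f)}"

definition corner_vertex :: "('v, 'd, 'f) cell_complex \<Rightarrow> 'f \<times> nat \<Rightarrow> 'v" where
  "corner_vertex K = (\<lambda>(f, i). tail (dg (skel K)) (bd K f ! i))"

definition flank :: "('v, 'd, 'f) cell_complex \<Rightarrow> 'f \<times> nat \<Rightarrow> bool \<Rightarrow> 'd" where
  "flank K = (\<lambda>(f, i) s.
     let n = length (bd K f)
     in if s then bd K f ! i else dinv (skel K) (bd K f ! ((i + n - 1) mod n)))"

text \<open>
  Vertices of the total graph: vertices of the graph, midpoints of edges, and one vertex per corner.
  Half-edges: \<open>ToMid d\<close> leads from the tail of \<open>d\<close> to the midpoint of its edge, \<open>CToMid c s\<close> from the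
  vertex in the corner \<open>c\<close> to the midpoint of the flanking edge on its side \<open>s\<close>;
  \<open>FromMid d\<close> and \<open>CFromMid c s\<close> are their inverses. The half-edges at the corners form the
  subdivided medial graph.
\<close>

datatype ('v, 'd, 'f) tvert = OldV 'v | MidV 'd | CornerV "'f \<times> nat"

datatype ('d, 'f) tdart =
  ToMid 'd | FromMid 'd | CToMid "'f \<times> nat" bool | CFromMid "'f \<times> nat" bool

fun tdart_inv :: "('d, 'f) tdart \<Rightarrow> ('d, 'f) tdart" where
  "tdart_inv (ToMid d) = FromMid d"
| "tdart_inv (FromMid d) = ToMid d"
| "tdart_inv (CToMid c s) = CFromMid c s"
| "tdart_inv (CFromMid c s) = CToMid c s"

fun tdart_tail :: "('v, 'd, 'f) cell_complex \<Rightarrow> ('d, 'f) tdart \<Rightarrow> ('v, 'd, 'f) tvert" where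
  "tdart_tail K (ToMid d) = OldV (tail (dg (skel K)) d)"
| "tdart_tail K (FromMid d) = MidV (under_edge (skel K) d)"
| "tdart_tail K (CToMid c s) = CornerV c"
| "tdart_tail K (CFromMid c s) = MidV (under_edge (skel K) (flank K c s))"

definition total_graph ::
    "('v, 'd, 'f) cell_complex \<Rightarrow> (('v, 'd, 'f) tvert, ('d, 'f) tdart) mgraph" where
  "total_graph K =
     (let P = ToMid ` arcs (dg (skel K)) \<union> {CToMid c s | c s. c \<in> corners K}
      in \<lparr>dg = \<lparr>verts = OldV ` verts (dg (skel K)) \<union> MidV ` pos (skel K) \<union> CornerV ` corners K,
                arcs = P \<union> tdart_inv ` P,
                tail = tdart_tail K, head = (\<lambda>d. tdart_tail K (tdart_inv d))\<rparr>,
          dinv = tdart_inv, pos = P\<rparr>)"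

text \<open>Positive darts serve as the preferred directions of the edges.\<close>

fun extended_voltage ::
    "('a, 'm) monoid_scheme \<Rightarrow> ('d \<Rightarrow> 'a) \<Rightarrow> ('v, 'd, 'f) cell_complex \<Rightarrow> ('d, 'f) tdart \<Rightarrow> 'a" where
  "extended_voltage A \<alpha> K (ToMid d) = (if d \<in> pos (skel K) then \<alpha> d else \<one>\<^bsub>A\<^esub>)"
| "extended_voltage A \<alpha> K (FromMid d) = (if d \<in> pos (skel K) then inv\<^bsub>A\<^esub> (\<alpha> d) else \<one>\<^bsub>A\<^esub>)"
| "extended_voltage A \<alpha> K (CToMid c s) =
     (if flank K c s \<in> pos (skel K) then \<alpha> (flank K c s) else \<one>\<^bsub>A\<^esub>)"
| "extended_voltage A \<alpha> K (CFromMid c s) =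
     (if flank K c s \<in> pos (skel K) then inv\<^bsub>A\<^esub> (\<alpha> (flank K c s)) else \<one>\<^bsub>A\<^esub>)"

definition special_claw ::
    "('v, 'd, 'f) cell_complex \<Rightarrow> 'd \<Rightarrow> (('v, 'd, 'f) tvert, ('d, 'f) tdart) mgraph" where
  "special_claw K d =
     induced_graph (total_graph K) (insert (ToMid d) {CToMid c s | c s. c \<in> corners K \<and> flank K c s = d})"

text \<open>
  The position in the derived surface of the vertices of the derived graph of the total graph.
  The midpoint of \<open>e\<close> has voltage \<open>\<alpha> e\<close> from the tail of \<open>e\<close>, so its lift with index \<open>b\<close> lies on
  the edge over \<open>e\<close> starting at \<open>b (\<alpha> e)\<^sup>-\<^sup>1\<close>; the lift of the vertex in the corner \<open>c\<close> at \<open>x\<close> with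
  index \<open>b\<close> lies in the unique corner over \<open>c\<close> at \<open>x\<^sup>b\<close>.
\<close>

definition corner_over ::
    "('a, 'm) monoid_scheme \<Rightarrow> ('d \<Rightarrow> 'a) \<Rightarrow> ('v, 'd, 'f) cell_complex \<Rightarrow> 'f \<times> nat \<Rightarrow> 'a \<Rightarrow>
     ('f \<times> 'a set) \<times> nat" where
  "corner_over A \<alpha> K c b =
     (THE k. k \<in> corners (derived_complex A \<alpha> K) \<and>
             corner_vertex (derived_complex A \<alpha> K) k = (corner_vertex K c, b) \<and>
             fst (fst k) = fst c \<and> snd k mod length (bd K (fst c)) = snd c)"

context group begin

lemma net_voltage_closed: "\<forall>d\<in>set p. \<alpha> d \<in> carrier G \<Longrightarrow> net_voltage G \<alpha> p \<in> carrier G"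
  unfolding net_voltage_def by (induction p) auto

lemma net_voltage_append: "\<forall>d\<in>set p \<union> set q. \<alpha> d \<in> carrier G \<Longrightarrow>
    net_voltage G \<alpha> (p @ q) = net_voltage G \<alpha> p \<otimes> net_voltage G \<alpha> q"
proof (induction p)
  case Nil then show ?case using net_voltage_closed[of q \<alpha>] by (simp add: net_voltage_def)
next
  case (Cons d p)
  then show ?case using net_voltage_closed[of q \<alpha>] net_voltage_closed[of p \<alpha>]
    by (simp add: net_voltage_def m_assoc)
qed

lemma net_voltage_concat_replicate: "\<forall>d\<in>set p. \<alpha> d \<in> carrier G \<Longrightarrow>
    net_voltage G \<alpha> (concat (replicate k p)) = net_voltage G \<alpha> p [^] k"
proof (induction k)
  case 0 then show ?case by (simp add: net_voltage_def)
next
  case (Suc k)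
  have "net_voltage G \<alpha> (p @ concat (replicate k p)) = net_voltage G \<alpha> p \<otimes> net_voltage G \<alpha> p [^] k"
    using Suc by (subst net_voltage_append) (auto split: if_splits)
  then show ?case using nat_pow_Suc2[OF net_voltage_closed[OF Suc.prems]] by simp
qed

lemma length_lift_walk [simp]: "length (lift_walk G \<alpha> a p) = length p"
  by (induction p arbitrary: a) auto

lemma nth_lift_walk: "\<forall>d\<in>set p. \<alpha> d \<in> carrier G \<Longrightarrow> a \<in> carrier G \<Longrightarrow> i < length p \<Longrightarrow>
    lift_walk G \<alpha> a p ! i = (p ! i, a \<otimes> net_voltage G \<alpha> (take i p))"
proof (induction p arbitrary: a i)
  case (Cons d p)
  show ?case
  proof (cases i)
    case 0 then show ?thesis using Cons by (simp add: net_voltage_def)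
  next
    case (Suc j)
    have "net_voltage G \<alpha> (take j p) \<in> carrier G"
      using Cons.prems by (intro net_voltage_closed) (auto dest: in_set_takeD)
    then show ?thesis using Cons Suc by (simp add: net_voltage_def m_assoc)
  qed
qed auto

lemma nth_concat_replicate: "j < k * length p \<Longrightarrow> concat (replicate k p) ! j = p ! (j mod length p)"
proof (induction k arbitrary: j)
  case (Suc k)
  show ?case
  proof (cases "j < length p")
    case False
    then show ?thesis using Suc.IH[of "j - length p"] Suc.prems
      by (simp add: nth_append le_mod_geq)
  qed (simp add: nth_append)
qed simp

lemma take_concat_replicate: "j < k * length p \<Longrightarrow>
  take j (concat (replicate k p)) = concat (replicate (j div length p) p) @ take (j mod length p) p"
proof (induction k arbitrary: j)
  case (Suc k)
  show ?case
  proof (cases "j < length p")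
    case False
    show ?thesis
    proof (cases "p = []")
      case False
      with \<open>\<not> j < length p\<close> show ?thesis using Suc.IH[of "j - length p"] Suc.prems
        by (simp add: le_mod_geq le_div_geq)
    qed (use Suc.prems in simp)
  qed simp
qed simp

lemma in_own_l_coset: "x \<in> carrier G \<Longrightarrow> subgroup H G \<Longrightarrow> x \<in> x <# H"
  unfolding l_coset_def using subgroup.one_closed by force

lemma length_concat_replicate [simp]: "length (concat (replicate k p)) = k * length p"
  by (induction k) auto

end

lemma corner_over_unique:
  assumes A: "group A" "finite (carrier A)" and K: "polygonal_complex K"
    and va: "voltage_assignment A (skel K) \<alpha>"
    and c: "c \<in> corners K" and b: "b \<in> carrier A"
  shows "\<exists>!k. k \<in> corners (derived_complex A \<alpha> K) \<and>
             corner_vertex (derived_complex A \<alpha> K) k = (corner_vertex K c, b) \<and>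
             fst (fst k) = fst c \<and> snd k mod length (bd K (fst c)) = snd c"
proof -
  interpret group A by fact
  obtain f i where ci: "c = (f, i)" and f: "f \<in> faces K" and i: "i < length (bd K f)"
    using c unfolding corners_def by auto
  define p where "p = bd K f"
  define w where "w = net_voltage A \<alpha> p"
  define H where "H = generate A {w}"
  define r where "r = ord w"
  define D where "D = derived_complex A \<alpha> K"
  define t where "t = net_voltage A \<alpha> (take i p)"
  have pv: "\<forall>d\<in>set p. \<alpha> d \<in> carrier A"
    using K va f unfolding polygonal_complex_def voltage_assignment_def walk_def pre_digraph.awalk_def p_def
    by blast
  have w: "w \<in> carrier A" using net_voltage_closed[OF pv] w_def by simp
  have t: "t \<in> carrier A" unfolding t_def using pv by (intro net_voltage_closed) (auto dest: in_set_takeD)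
  have H: "subgroup H A" unfolding H_def using w by (intro generate_is_subgroup) auto
  have r: "r \<ge> 1" unfolding r_def using ord_ge_1[OF A(2) w] .
  have Hel: "H = (\<lambda>q. w [^]\<^bsub>A\<^esub> q) ` {0..r-1}"
    unfolding H_def generate_pow_on_finite_carrier[OF A(2) w] ord_elems[OF A(2) w] r_def by auto
  have inj: "inj_on (\<lambda>q. w [^]\<^bsub>A\<^esub> q) {0..r-1}"
    unfolding r_def by (rule ord_inj[OF w])
  have Hc: "H \<subseteq> carrier A" using subgroup.subset[OF H] .
  have n: "length p > 0" using i p_def by auto
  have fD: "(f, C) \<in> faces D \<longleftrightarrow> (\<exists>a\<in>carrier A. C = a <#\<^bsub>A\<^esub> H)" for C
    unfolding D_def derived_complex_def H_def w_def p_def using f by auto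
  have cv: "((f, C), j) \<in> corners D \<and> corner_vertex D ((f, C), j) = (corner_vertex K c, b) \<and>
       fst (fst ((f, C), j)) = fst c \<and> snd ((f, C), j) mod length (bd K (fst c)) = snd c
     \<longleftrightarrow> (\<exists>a\<in>carrier A. C = a <#\<^bsub>A\<^esub> H) \<and> j < r * length p \<and> j mod length p = i \<and>
       (SOME a. a \<in> C) \<otimes>\<^bsub>A\<^esub> (w [^]\<^bsub>A\<^esub> (j div length p) \<otimes>\<^bsub>A\<^esub> t) = b" (is "?L \<longleftrightarrow> ?R") for C j
  proof (cases "(\<exists>a\<in>carrier A. C = a <#\<^bsub>A\<^esub> H) \<and> j < r * length p \<and> j mod length p = i")
    case True
    define a where "a = (SOME a. a \<in> C)"
    obtain a0 where a0: "a0 \<in> carrier A" "C = a0 <#\<^bsub>A\<^esub> H" using True by auto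
    have "a0 \<in> C" using in_own_l_coset[OF a0(1) H] a0(2) by simp
    then have "a \<in> C" unfolding a_def by (rule someI)
    then have a: "a \<in> carrier A" using a0 Hc unfolding l_coset_def by auto
    have bdD: "bd D (f, C) = lift_walk A \<alpha> a (concat (replicate r p))"
      unfolding D_def derived_complex_def a_def r_def w_def p_def by simp
    have pv': "\<forall>d\<in>set (concat (replicate r p)). \<alpha> d \<in> carrier A" using pv by auto
    have "bd D (f, C) ! j = (p ! i, a \<otimes>\<^bsub>A\<^esub> net_voltage A \<alpha> (take j (concat (replicate r p))))"
      unfolding bdD using nth_lift_walk[OF pv' a, of j] True nth_concat_replicate[of j r p] by simp
    also have "net_voltage A \<alpha> (take j (concat (replicate r p))) = w [^]\<^bsub>A\<^esub> (j div length p) \<otimes>\<^bsub>A\<^esub> t"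
    proof -
      have "\<forall>d\<in>set (concat (replicate (j div length p) p)) \<union> set (take i p). \<alpha> d \<in> carrier A"
        using pv by (auto dest: in_set_takeD)
      from net_voltage_append[OF this] show ?thesis
        using True take_concat_replicate[of j r p] net_voltage_concat_replicate[OF pv] unfolding t_def w_def by simp
    qed
    finally have e: "bd D (f, C) ! j = (p ! i, a \<otimes>\<^bsub>A\<^esub> (w [^]\<^bsub>A\<^esub> (j div length p) \<otimes>\<^bsub>A\<^esub> t))" .
    have "skel D = derived_graph A \<alpha> (skel K)" unfolding D_def derived_complex_def by simp
    then have "corner_vertex D ((f, C), j) =
       (corner_vertex K c, a \<otimes>\<^bsub>A\<^esub> (w [^]\<^bsub>A\<^esub> (j div length p) \<otimes>\<^bsub>A\<^esub> t))"
      unfolding corner_vertex_def ci using e by (simp add: derived_graph_def p_def)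
    moreover have "((f, C), j) \<in> corners D" unfolding corners_def using True fD bdD by auto
    ultimately show ?thesis using True unfolding ci a_def p_def by auto
  next
    case False
    have "?L \<Longrightarrow> (\<exists>a\<in>carrier A. C = a <#\<^bsub>A\<^esub> H) \<and> j < r * length p \<and> j mod length p = i"
      using fD unfolding ci corners_def
      by (auto simp: D_def derived_complex_def r_def w_def p_def)
    with False show ?thesis by blast
  qed
  define a1 where "a1 = b \<otimes>\<^bsub>A\<^esub> inv\<^bsub>A\<^esub> t"
  have a1: "a1 \<in> carrier A" using a1_def b t by simp
  define C1 where "C1 = a1 <#\<^bsub>A\<^esub> H"
  define a where "a = (SOME a. a \<in> C1)"
  have "a1 \<in> C1" using in_own_l_coset[OF a1 H] C1_def by simp
  then have aC: "a \<in> C1" unfolding a_def by (rule someI)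
  then have a: "a \<in> carrier A" using a1 Hc unfolding C1_def l_coset_def by auto
  have CC: "C1 = a <#\<^bsub>A\<^esub> H" using l_repr_independence[OF aC[unfolded C1_def] a1 H] C1_def by simp
  have "a1 \<in> a <#\<^bsub>A\<^esub> H" using \<open>a1 \<in> C1\<close> CC by simp
  then obtain q where q: "q \<in> {0..r-1}" "a1 = a \<otimes>\<^bsub>A\<^esub> w [^]\<^bsub>A\<^esub> q"
    unfolding l_coset_def Hel by auto
  have bq: "a \<otimes>\<^bsub>A\<^esub> (w [^]\<^bsub>A\<^esub> q \<otimes>\<^bsub>A\<^esub> t) = b"
    using q(2) a w t b unfolding a1_def
    by (metis inv_solve_right' m_assoc m_closed nat_pow_closed)
  define j where "j = q * length p + i"
  have ip: "i < length p" using i p_def by simp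
  have jd: "j div length p = q" "j mod length p = i" unfolding j_def using ip n by (simp_all add: div_add1_eq[of "q * length p"])
  have "j < (q + 1) * length p" unfolding j_def using ip by simp
  also have "\<dots> \<le> r * length p" using q r by (intro mult_right_mono) auto
  finally have jr: "j < r * length p" .
  show ?thesis unfolding D_def[symmetric]
  proof (rule ex1I[of _ "((f, C1), j)"])
    show "((f, C1), j) \<in> corners D \<and> corner_vertex D ((f, C1), j) = (corner_vertex K c, b) \<and>
       fst (fst ((f, C1), j)) = fst c \<and> snd ((f, C1), j) mod length (bd K (fst c)) = snd c"
      unfolding cv using a1 C1_def jr jd bq a_def by auto
  next
    fix k assume k: "k \<in> corners D \<and> corner_vertex D k = (corner_vertex K c, b) \<and>
       fst (fst k) = fst c \<and> snd k mod length (bd K (fst c)) = snd c"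
    obtain f' C j' where "k = ((f', C), j')" by (metis prod.collapse)
    with k have kk: "k = ((f, C), j')" unfolding ci by simp
    obtain a0 where R: "a0 \<in> carrier A" "C = a0 <#\<^bsub>A\<^esub> H" "j' < r * length p" "j' mod length p = i"
       "(SOME a. a \<in> C) \<otimes>\<^bsub>A\<^esub> (w [^]\<^bsub>A\<^esub> (j' div length p) \<otimes>\<^bsub>A\<^esub> t) = b"
      using k[unfolded kk cv] by auto
    define a' where "a' = (SOME a. a \<in> C)"
    define q' where "q' = j' div length p"
    have "a0 \<in> C" using in_own_l_coset[OF R(1) H] R(2) by simp
    then have aC': "a' \<in> C" unfolding a'_def by (rule someI)
    then have a': "a' \<in> carrier A" using R Hc unfolding l_coset_def by auto
    have CC': "C = a' <#\<^bsub>A\<^esub> H" using l_repr_independence[OF aC'[unfolded R(2)] R(1) H] R(2) by simp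
    have q'r: "q' \<in> {0..r-1}" unfolding q'_def using R(3)
      using less_mult_imp_div_less[of j' r "length p"] by auto
    have e1: "a1 = a' \<otimes>\<^bsub>A\<^esub> w [^]\<^bsub>A\<^esub> q'"
      using R(5) a' w t b unfolding a1_def a'_def[symmetric] q'_def[symmetric]
      by (metis inv_solve_right m_assoc m_closed nat_pow_closed)
    have "a1 \<in> C" unfolding CC' l_coset_def e1 Hel using q'r by auto
    then have C: "C = C1" using l_repr_independence[of a1 a' H] a' H CC' C1_def by simp
    then have "a' = a" unfolding a'_def a_def by simp
    then have "w [^]\<^bsub>A\<^esub> q' = w [^]\<^bsub>A\<^esub> q" using e1 q(2) a w by simp
    then have "q' = q" using inj q(1) q'r by (meson inj_onD)
    then have "j' = j" unfolding j_def q'_def using R(4) by (metis div_mult_mod_eq)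
    then show "k = ((f, C1), j)" using kk C by simp
  qed
qed

definition corner_point :: "('v, 'd, 'f) cell_complex \<Rightarrow> 'f \<times> nat \<Rightarrow> ('v, 'd, 'f) point" where
  "corner_point K = (\<lambda>(f, i). FPt f (cis (2 * pi * real i / real (length (bd K f))) / 2))"

fun total_position ::
    "('a, 'm) monoid_scheme \<Rightarrow> ('d \<Rightarrow> 'a) \<Rightarrow> ('v, 'd, 'f) cell_complex \<Rightarrow> ('v, 'd, 'f) tvert \<times> 'a \<Rightarrow>
     ('v \<times> 'a, 'd \<times> 'a, 'f \<times> 'a set) point" where
  "total_position A \<alpha> K (OldV x, b) = VPt (x, b)"
| "total_position A \<alpha> K (MidV e, b) = EPt (e, b \<otimes>\<^bsub>A\<^esub> inv\<^bsub>A\<^esub> (\<alpha> e)) (1 / 2)"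
| "total_position A \<alpha> K (CornerV c, b) =
     corner_point (derived_complex A \<alpha> K) (corner_over A \<alpha> K c b)"

definition total_fiber ::
    "('a, 'm) monoid_scheme \<Rightarrow> ('d \<Rightarrow> 'a) \<Rightarrow> ('v, 'd, 'f) cell_complex \<Rightarrow> ('v, 'd, 'f) tvert \<Rightarrow>
     (('v, 'd, 'f) tvert \<times> 'a) set" where
  "total_fiber A \<alpha> K x =
     {u \<in> verts (dg (derived_graph A (extended_voltage A \<alpha> K) (total_graph K))). fst u = x}"

end

theory Submission
  imports Defs
begin

text \<open>
  Let \<open>C\<close> be the cycle induced by \<open>z\<close>, and let \<open>Q\<close> be a component of the part \<open>Sva\<close> of the derived surface
  minus the curves in \<open>X\<close>. Cutting the surface along the nonseparating curve \<open>C\<close> leaves it connected, and the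
  part of \<open>Q\<close> off the lifts of \<open>C\<close> covers what is left, possibly with branch points inside faces. The theorem
  compares the numbers of sheets of this covering on the two sides of \<open>C\<close>.

  Instead of coverings, the proof counts corners. Let \<open>FQ\<close> be the set of faces of the derived complex that
  lie in \<open>Q\<close>. It is nonempty, and it contains every face that shares a point off the curves in \<open>X\<close> with one
  of its members (\<open>component_faces\<close>). The corners over a corner \<open>c\<close> of \<open>K\<close> are indexed by the group elements
  \<open>b\<close>; let \<open>inQ c b\<close> say that the one with index \<open>b\<close> is in \<open>FQ\<close>. If two faces of \<open>K\<close> share a point off \<open>C\<close>,
  suitable corners of them satisfy \<open>inQ\<close> for the same \<open>b\<close>, because their lifts with index \<open>b\<close> share a point
  off the lifts of \<open>C\<close> (\<open>shared_point_corners\<close>). Since the complement of \<open>C\<close> is connected, any two faces are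
  linked by such steps (\<open>faces_connected_off_curve\<close>). Hence every face of \<open>K\<close> has a face of \<open>FQ\<close> above it, which
  proves the first claim (\<open>every_face_lifts\<close>, \<open>corner_in_region\<close>), and every corner of \<open>K\<close> has the same number
  of lifts in \<open>FQ\<close> (\<open>card_inQ_constant\<close>).

  For the second claim, let \<open>P\<close> and \<open>M\<close> be the two halves of an annulus around \<open>C\<close>. Each face that touches \<open>C\<close>
  lies in one of them near the point of contact. A face keeps its side along an edge of \<open>C\<close>
  (\<open>side_constant\<close>), both sides occur along each edge of \<open>C\<close> (\<open>edge_both_sides\<close>), and at a vertex of \<open>C\<close> the
  corners on one side are linked by common edges off \<open>C\<close> (\<open>corners_on_one_side\<close>). These statements lift to the
  derived complex. So for each lift of \<open>C\<close>, either all or none of the faces on its \<open>P\<close>-side are in \<open>FQ\<close>, and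
  the same holds for its \<open>M\<close>-side (\<open>inside_iff\<close>, \<open>reach_inside\<close>). Fix a vertex \<open>v\<close> of \<open>C\<close>. Comparing a corner
  at \<open>v\<close> on side \<open>P\<close> with one on side \<open>M\<close>, the constancy of the number of sheets says that the \<open>P\<close>-side and the
  \<open>M\<close>-side at \<open>v\<^sup>b\<close> are in \<open>FQ\<close> for equally many \<open>b\<close> (\<open>card_inside\<close>). The group permutes the lifts by left
  translation, hence each of them contains the same number of vertices over \<open>v\<close> (\<open>card_lifts\<close>). Therefore as
  many lifts have their \<open>P\<close>-side in \<open>FQ\<close> as have their \<open>M\<close>-side in \<open>FQ\<close>. The frontier of the region consists of
  the lifts with exactly one side in \<open>FQ\<close> (\<open>frontier_lifts_meet\<close>), and their number is even because it is the
  size of the symmetric difference of two sets of equal size (\<open>frontier_lifts_even\<close>).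
\<close>

section \<open>Polygonal complexes\<close>

abbreviation src :: "('v, 'd, 'f) cell_complex \<Rightarrow> 'd \<Rightarrow> 'v" where
  "src K \<equiv> tail (dg (skel K))"

abbreviation tgt :: "('v, 'd, 'f) cell_complex \<Rightarrow> 'd \<Rightarrow> 'v" where
  "tgt K \<equiv> head (dg (skel K))"

abbreviation nodes :: "('v, 'd, 'f) cell_complex \<Rightarrow> 'v set" where
  "nodes K \<equiv> verts (dg (skel K))"

abbreviation darts :: "('v, 'd, 'f) cell_complex \<Rightarrow> 'd set" where
  "darts K \<equiv> arcs (dg (skel K))"

abbreviation edges :: "('v, 'd, 'f) cell_complex \<Rightarrow> 'd set" where
  "edges K \<equiv> pos (skel K)"

abbreviation flip :: "('v, 'd, 'f) cell_complex \<Rightarrow> 'd \<Rightarrow> 'd" where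
  "flip K \<equiv> dinv (skel K)"

abbreviation edge_under :: "('v, 'd, 'f) cell_complex \<Rightarrow> 'd \<Rightarrow> 'd" where
  "edge_under K \<equiv> under_edge (skel K)"

abbreviation gonality :: "('v, 'd, 'f) cell_complex \<Rightarrow> 'f \<Rightarrow> nat" where
  "gonality K f \<equiv> length (bd K f)"

text \<open>
  On the boundary circle of an \<open>n\<close>-gon, the corner \<open>i\<close> sits at the parameter \<open>i\<close> and the \<open>i\<close>-th dart
  occupies the parameters from \<open>i\<close> to \<open>i + 1\<close>. Allowing all real parameters avoids the jump of the
  argument at the corner \<open>0\<close>.
\<close>

definition rim :: "nat \<Rightarrow> real \<Rightarrow> complex" where
  "rim n s = cis (2 * pi * s / real n)"

lemma norm_rim [simp]: "norm (rim n s) = 1"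
  by (simp add: rim_def)

lemma continuous_on_rim [continuous_intros]:
  "continuous_on T g \<Longrightarrow> continuous_on T (\<lambda>t. rim n (g t))"
  unfolding rim_def cis_conv_exp divide_inverse
  by (intro continuous_intros)

lemma rim_add_period: "n > 0 \<Longrightarrow> rim n (s + real n) = rim n s"
  by (simp add: rim_def add_divide_distrib distrib_left cis_mult[symmetric])

lemma Arg2pi_rim:
  assumes "n > 0" "0 \<le> s" "s < real n"
  shows "Arg2pi (rim n s) = 2 * pi * s / real n"
proof -
  have "2 * pi * s / real n < 2 * pi" using assms by (simp add: field_simps)
  moreover have "0 \<le> 2 * pi * s / real n" using assms by simp
  ultimately show ?thesis
    by (intro Arg2pi_unique[of 1]) (simp_all add: rim_def cis_conv_exp mult.commute)
qed

lemma rim_surj: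
  assumes "n > 0" "norm y = 1"
  obtains i t where "i < n" "0 \<le> t" "t < 1" "y = rim n (real i + t)"
proof -
  define s where "s = real n * Arg2pi y / (2 * pi)"
  have s: "0 \<le> s"
    using Arg2pi_ge_0[of y] by (simp add: s_def)
  have "real n * Arg2pi y < real n * (2 * pi)"
    using Arg2pi_lt_2pi[of y] assms(1) by (intro mult_strict_left_mono) auto
  then have s': "s < real n" by (simp add: s_def divide_less_eq)
  have "2 * pi * s / real n = Arg2pi y" using assms(1) by (simp add: s_def)
  then have "rim n s = exp (\<i> * of_real (Arg2pi y))"
    by (simp only: rim_def cis_conv_exp)
  also have "\<dots> = y" using Arg2pi_eq[of y] assms(2) by (metis mult_1 of_real_1)
  finally have "rim n s = y" .
  moreover have "nat \<lfloor>s\<rfloor> < n" "real (nat \<lfloor>s\<rfloor>) = real_of_int \<lfloor>s\<rfloor>" using s s' by linarith+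
  ultimately show ?thesis
    using that[of "nat \<lfloor>s\<rfloor>" "frac s"] by (simp add: frac_lt_1) (simp add: frac_def)
qed

definition closed_face :: "('v, 'd, 'f) cell_complex \<Rightarrow> 'f \<Rightarrow> ('v, 'd, 'f) point set" where
  "closed_face K f = face_map K f ` cball 0 1"

definition has_side :: "('v, 'd, 'f) cell_complex \<Rightarrow> 'f \<Rightarrow> 'd \<Rightarrow> bool" where
  "has_side K f e \<longleftrightarrow> (\<exists>i<gonality K f. edge_under K (bd K f ! i) = e)"

definition has_corner :: "('v, 'd, 'f) cell_complex \<Rightarrow> 'f \<Rightarrow> 'v \<Rightarrow> bool" where
  "has_corner K f x \<longleftrightarrow> (\<exists>i<gonality K f. src K (bd K f ! i) = x)"

lemma edge_point_inner: "0 < t \<Longrightarrow> t < 1 \<Longrightarrow> edge_point H e t = EPt e t"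
  by (simp add: edge_point_def)

lemma edge_point_0 [simp]: "edge_point H e 0 = VPt (tail (dg H) e)"
  and edge_point_1 [simp]: "edge_point H e 1 = VPt (head (dg H) e)"
  by (simp_all add: edge_point_def)

lemma unit_interval_cases:
  fixes t :: real
  assumes "t \<in> {0..1}" obtains "t = 0" | "t = 1" | "0 < t" "t < 1"
  using assms by fastforce

text \<open>
  Read off consecutive darts: this turns the recursive condition on boundary walks into a condition on
  each pair of neighboring indices.
\<close>

lemma cas_nth:
  assumes "pre_digraph.cas H u p w" "i < length p"
  shows "head H (p ! i) = (if Suc i < length p then tail H (p ! Suc i) else w)"
  using assms
proof (induction p arbitrary: u i)
  case (Cons e es)
  interpret pre_digraph H .
  show ?case
  proof (cases i)
    case 0
    then show ?thesis using Cons.prems by (cases es) auto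
  next
    case (Suc j)
    then show ?thesis using Cons.IH[of "head H e" j] Cons.prems by auto
  qed
qed auto

locale polygonal =
  fixes K :: "('v, 'd, 'f) cell_complex"
  assumes polygonal: "polygonal_complex K"
begin

lemma fin_digraph: "fin_digraph (dg (skel K))"
  using polygonal by (simp add: polygonal_complex_def multigraph_def)

lemma finite_faces: "finite (faces K)"
  using polygonal by (simp add: polygonal_complex_def)

lemma edges_darts: "e \<in> edges K \<Longrightarrow> e \<in> darts K"
  using polygonal by (auto simp: polygonal_complex_def multigraph_def)

lemma bidir: "bidirected_digraph (dg (skel K)) (\<lambda>d. if d \<in> darts K then flip K d else d)"
  using polygonal by (simp add: polygonal_complex_def multigraph_def)

lemma src_node [simp]: "d \<in> darts K \<Longrightarrow> src K d \<in> nodes K"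
  and tgt_node [simp]: "d \<in> darts K \<Longrightarrow> tgt K d \<in> nodes K"
  using fin_digraph by (auto simp: fin_digraph_def wf_digraph_def)

lemma flip_dart [simp]: "d \<in> darts K \<Longrightarrow> flip K d \<in> darts K"
  using bidirected_digraph.arev_in_arcs[OF bidir, of d] by simp

lemma src_flip [simp]: "d \<in> darts K \<Longrightarrow> src K (flip K d) = tgt K d"
  using bidirected_digraph.tail_arev[OF bidir, of d] by simp

lemma flip_flip [simp]: "d \<in> darts K \<Longrightarrow> flip K (flip K d) = d"
  using bidirected_digraph.arev_arev_raw[OF bidir, of d] by simp

lemma tgt_flip [simp]: "d \<in> darts K \<Longrightarrow> tgt K (flip K d) = src K d"
  using src_flip[of "flip K d"] by simp

lemma flip_edge: "d \<in> darts K \<Longrightarrow> flip K d \<in> edges K \<longleftrightarrow> d \<notin> edges K"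
  using polygonal unfolding polygonal_complex_def multigraph_def by blast

lemma edge_under_edge [simp]: "d \<in> darts K \<Longrightarrow> edge_under K d \<in> edges K"
  by (simp add: under_edge_def flip_edge)

lemma edge_under_flip [simp]: "d \<in> darts K \<Longrightarrow> edge_under K (flip K d) = edge_under K d"
  by (simp add: under_edge_def flip_edge)

lemma edge_under_id [simp]: "e \<in> edges K \<Longrightarrow> edge_under K e = e"
  by (simp add: under_edge_def)

lemma edge_under_cases: "d \<in> darts K \<Longrightarrow> edge_under K d = e \<Longrightarrow> d = e \<or> d = flip K e"
  by (auto simp: under_edge_def)

lemma gonality_pos: "f \<in> faces K \<Longrightarrow> 0 < gonality K f"
  using polygonal by (auto simp: polygonal_complex_def)

lemma bd_dart [simp]:
  assumes "f \<in> faces K" "i < gonality K f" shows "bd K f ! i \<in> darts K"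
  using polygonal assms nth_mem
  by (fastforce simp: polygonal_complex_def walk_def pre_digraph.awalk_def)

lemma bd_consecutive:
  assumes "f \<in> faces K" "i < gonality K f"
  shows "tgt K (bd K f ! i) = src K (bd K f ! (Suc i mod gonality K f))"
proof -
  obtain u where "pre_digraph.cas (dg (skel K)) u (bd K f) u" "bd K f \<noteq> []"
    using polygonal assms by (auto simp: polygonal_complex_def walk_def pre_digraph.awalk_def)
  then have "tgt K (bd K f ! i) =
      (if Suc i < gonality K f then src K (bd K f ! Suc i) else src K (bd K f ! 0))"
    using cas_nth[of "dg (skel K)" u "bd K f" u i] assms(2)
    by (cases "bd K f") (auto simp: pre_digraph.cas.simps)
  moreover have "Suc i mod gonality K f = (if Suc i < gonality K f then Suc i else 0)"
    using assms(2) Suc_lessI by fastforce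
  ultimately show ?thesis by auto
qed

lemma dart_point_edge:
  assumes "d \<in> darts K"
  shows "dart_point (skel K) d t = edge_point (skel K) (edge_under K d) (if d \<in> edges K then t else 1 - t)"
  by (simp add: dart_point_def under_edge_def)

lemma dart_point_0 [simp]: "d \<in> darts K \<Longrightarrow> dart_point (skel K) d 0 = VPt (src K d)"
  by (simp add: dart_point_def)

lemma dart_point_1 [simp]: "d \<in> darts K \<Longrightarrow> dart_point (skel K) d 1 = VPt (tgt K d)"
  by (simp add: dart_point_def)

lemma dart_point_inner:
  "d \<in> darts K \<Longrightarrow> 0 < t \<Longrightarrow> t < 1 \<Longrightarrow>
     dart_point (skel K) d t = EPt (edge_under K d) (if d \<in> edges K then t else 1 - t)"
  by (simp add: dart_point_edge edge_point_inner)

lemma edge_point_in_points: "e \<in> edges K \<Longrightarrow> t \<in> {0..1} \<Longrightarrow> edge_point (skel K) e t \<in> points K"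
  using edges_darts by (auto simp: edge_point_def points_def)

lemma dart_point_in_points: "d \<in> darts K \<Longrightarrow> t \<in> {0..1} \<Longrightarrow> dart_point (skel K) d t \<in> points K"
  by (simp add: dart_point_edge edge_point_in_points)

lemma face_map_inner: "norm y < 1 \<Longrightarrow> face_map K f y = FPt f y"
  by (simp add: face_map_def)

text \<open>
  Both ends of the parameter interval are included, which is consistent because consecutive darts
  share a vertex. All later arguments about boundary circles use the characteristic map only in this
  form.
\<close>

lemma face_map_rim:
  assumes "f \<in> faces K" "i < gonality K f" "t \<in> {0..1}"
  shows "face_map K f (rim (gonality K f) (real i + t)) = dart_point (skel K) (bd K f ! i) t"
proof -
  let ?n = "gonality K f"
  have inner: "face_map K f (rim ?n (real j + u)) = dart_point (skel K) (bd K f ! j) u"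
    if "j < ?n" "0 \<le> u" "u < 1" for j u
  proof -
    have "real j + u < real ?n" using that by linarith
    then have "real ?n * Arg2pi (rim ?n (real j + u)) / (2 * pi) = real j + u"
      using that by (subst Arg2pi_rim) auto
    moreover have "\<lfloor>real j + u\<rfloor> = int j" using that by linarith
    moreover have "frac (real j + u) = u" using that by (simp add: frac_def calculation(2))
    ultimately show ?thesis by (simp add: face_map_def Let_def)
  qed
  show ?thesis
  proof (cases "t < 1")
    case True then show ?thesis using inner assms by simp
  next
    case False
    then have t: "t = 1" using assms by simp
    let ?j = "Suc i mod ?n"
    have j: "?j < ?n" using gonality_pos[OF assms(1)] by simp
    have "rim ?n (real i + 1) = rim ?n (real ?j + 0)"
    proof (cases "Suc i < ?n")
      case True then show ?thesis by (simp add: add.commute)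
    next
      case False
      then have "Suc i = ?n" using assms(2) by simp
      then have "real i + 1 = 0 + real ?n" "real ?j + 0 = 0" by auto
      then show ?thesis using rim_add_period[of ?n 0] gonality_pos[OF assms(1)] by simp
    qed
    then show ?thesis unfolding t
      using inner[OF j, of 0] bd_consecutive[OF assms(1,2)] assms j by simp
  qed
qed

lemma rim_pointE:
  assumes "f \<in> faces K" "norm y = 1"
  obtains i t where "i < gonality K f" "0 \<le> t" "t < 1" "y = rim (gonality K f) (real i + t)"
    "face_map K f y = dart_point (skel K) (bd K f ! i) t"
  using rim_surj[OF gonality_pos[OF assms(1)] assms(2)] face_map_rim[OF assms(1)]
  by (metis atLeastAtMost_iff less_eq_real_def)

lemma face_map_in_points:
  assumes "f \<in> faces K" "y \<in> cball 0 1" shows "face_map K f y \<in> points K"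
proof (cases "norm y < 1")
  case True then show ?thesis using assms by (auto simp: face_map_inner points_def)
next
  case False
  then have "norm y = 1" using assms by simp
  with assms(1) show ?thesis
    by (rule rim_pointE) (auto simp: dart_point_in_points assms)
qed

lemma FPt_closed_face: "FPt g y \<in> closed_face K f \<longleftrightarrow> g = f \<and> norm y < 1" if "f \<in> faces K"
proof -
  have "norm y < 1 \<and> g = f" if "FPt g y = face_map K f x" "x \<in> cball 0 1" for x
  proof (cases "norm x < 1")
    case True then show ?thesis using that by (simp add: face_map_inner)
  next
    case False
    then have "norm x = 1" using that by simp
    with \<open>f \<in> faces K\<close> show ?thesis
      by (rule rim_pointE) (use that \<open>f \<in> faces K\<close> in \<open>auto simp: dart_point_edge edge_point_def split: if_splits\<close>)
  qed
  moreover have "FPt f y \<in> closed_face K f" if "norm y < 1"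
    unfolding closed_face_def using that by (intro image_eqI[of _ _ y]) (auto simp: face_map_inner)
  ultimately show ?thesis by (auto simp: closed_face_def)
qed

lemma EPt_closed_face: "EPt e t \<in> closed_face K f \<longleftrightarrow> has_side K f e \<and> 0 < t \<and> t < 1" if "f \<in> faces K"
proof -
  have "has_side K f e \<and> 0 < t \<and> t < 1" if "EPt e t = face_map K f x" "x \<in> cball 0 1" for x
  proof (cases "norm x < 1")
    case True then show ?thesis using that by (simp add: face_map_inner)
  next
    case False
    then have "norm x = 1" using that by simp
    with \<open>f \<in> faces K\<close> show ?thesis
      by (rule rim_pointE)
        (use that \<open>f \<in> faces K\<close> in \<open>auto simp: dart_point_edge edge_point_def has_side_def split: if_splits\<close>)
  qed
  moreover have "EPt e t \<in> closed_face K f" if ht: "has_side K f e" "0 < t" "t < 1"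
  proof -
    obtain i where i: "i < gonality K f" "edge_under K (bd K f ! i) = e"
      using ht by (auto simp: has_side_def)
    define u where "u = (if bd K f ! i \<in> edges K then t else 1 - t)"
    have u: "0 < u" "u < 1" using ht by (auto simp: u_def)
    have "face_map K f (rim (gonality K f) (real i + u)) = EPt e t"
      using face_map_rim[OF \<open>f \<in> faces K\<close> i(1), of u] u i \<open>f \<in> faces K\<close>
      by (simp add: dart_point_inner) (simp add: u_def)
    then show ?thesis unfolding closed_face_def
      by (metis image_eqI mem_cball_0 norm_rim order_refl)
  qed
  ultimately show ?thesis by (auto simp: closed_face_def)
qed

lemma VPt_closed_face: "VPt x \<in> closed_face K f \<longleftrightarrow> has_corner K f x" if f: "f \<in> faces K"
proof -
  have "has_corner K f x" if "VPt x = face_map K f y" "y \<in> cball 0 1" for y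
  proof (cases "norm y < 1")
    case True then show ?thesis using that by (simp add: face_map_inner)
  next
    case False
    then have "norm y = 1" using that by simp
    with f show ?thesis
    proof (rule rim_pointE)
      fix i t assume i: "i < gonality K f" "0 \<le> t" "t < 1" 
        and e: "face_map K f y = dart_point (skel K) (bd K f ! i) t"
      have "t = 0"
      proof (rule ccontr)
        assume "t \<noteq> 0"
        then have "0 < t" using i by simp
        then show False using dart_point_inner[OF bd_dart[OF f i(1)] _ i(3)] e that(1) by (metis point.distinct(1))
      qed
      then show ?thesis using i e that f by (auto simp: has_corner_def)
    qed
  qed
  moreover have "VPt x \<in> closed_face K f" if hc: "has_corner K f x"
  proof -
    obtain i where i: "i < gonality K f" "src K (bd K f ! i) = x"
      using hc unfolding has_corner_def by blast
    have "face_map K f (rim (gonality K f) (real i + 0)) = VPt x"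
      using face_map_rim[OF f i(1), of 0] i f by simp
    then show ?thesis unfolding closed_face_def
      by (metis image_eqI mem_cball_0 norm_rim order_refl)
  qed
  ultimately show ?thesis by (auto simp: closed_face_def)
qed

text \<open>
  One end of the edge is the tail of the dart that runs along it, the other end is the tail of the
  next dart.
\<close>

lemma has_corner_endpoint:
  assumes "f \<in> faces K" "has_side K f e" "e \<in> edges K" "x = src K e \<or> x = tgt K e"
  shows "has_corner K f x"
proof -
  obtain i where i: "i < gonality K f" "edge_under K (bd K f ! i) = e"
    using assms by (auto simp: has_side_def)
  let ?d = "bd K f ! i"
  have d: "?d \<in> darts K" using assms i by simp
  have "x = src K ?d \<or> x = tgt K ?d"
    using assms(4) edge_under_cases[OF d i(2)] edges_darts[OF assms(3)] by auto
  moreover have "tgt K ?d = src K (bd K f ! (Suc i mod gonality K f))"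
    using bd_consecutive assms i by simp
  moreover have "Suc i mod gonality K f < gonality K f" using gonality_pos[OF assms(1)] by simp
  ultimately show ?thesis using i(1) unfolding has_corner_def by metis
qed

section \<open>The topology of the realization\<close>

lemma topspace_realization [simp]: "topspace (realization K) = points K"
proof -
  have "{t \<in> {0..1}. edge_point (skel K) e t \<in> points K} = {0..1}" if "e \<in> edges K" for e
    using that edge_point_in_points by blast
  moreover have "{x \<in> cball 0 1. face_map K f x \<in> points K} = cball 0 1" if "f \<in> faces K" for f
    using that face_map_in_points by blast
  ultimately have "openin (realization K) (points K)"
    by (simp add: openin_realization)
  then show ?thesis
    by (meson openin_realization openin_subset openin_topspace subset_antisym)
qed

lemma continuous_map_face_map:
  "f \<in> faces K \<Longrightarrow> continuous_map (top_of_set (cball 0 1)) (realization K) (face_map K f)"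
  using face_map_in_points by (auto simp: continuous_map_def openin_realization)

text \<open>
  The part of the boundary circle that misses \<open>U\<close> is a finite union of arcs, each parametrized by a
  compact set of parameters along one dart. Hence it is closed, without any case distinction at the
  corners.
\<close>

lemma openin_sphere_preimage:
  assumes f: "f \<in> faces K"
    and e: "\<And>e. e \<in> edges K \<Longrightarrow> openin (top_of_set {0..1}) {t \<in> {0..1}. edge_point (skel K) e t \<in> U}"
  shows "openin (top_of_set (sphere 0 1)) {y \<in> sphere 0 1. face_map K f y \<in> U}"
proof -
  let ?n = "gonality K f"
  define B where "B i = {t \<in> {0..1}. dart_point (skel K) (bd K f ! i) t \<notin> U}" for i
  have comp: "compact (B i)" if i: "i < ?n" for i
  proof -
    let ?d = "bd K f ! i"
    define C where "C = {t \<in> {0..1}. edge_point (skel K) (edge_under K ?d) t \<notin> U}"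
    have "openin (top_of_set {0..1}) {t \<in> {0..1}. edge_point (skel K) (edge_under K ?d) t \<in> U}"
      using e f i by simp
    moreover have "C = {0..1} - {t \<in> {0..1}. edge_point (skel K) (edge_under K ?d) t \<in> U}"
      by (auto simp: C_def)
    ultimately have "closedin (top_of_set {0..1}) C"
      by (metis closedin_diff closedin_topspace topspace_euclidean_subtopology)
    then have C: "compact C"
      using closedin_compact compact_Icc by blast
    have "B i = (if ?d \<in> edges K then C else (\<lambda>t. 1 - t) ` C)"
    proof -
      have "t \<in> (\<lambda>t. 1 - t) ` C \<longleftrightarrow> 1 - t \<in> C" for t :: real
        by (auto intro: image_eqI[of _ _ "1 - t"])
      then show ?thesis using f i by (auto simp: B_def C_def dart_point_edge)
    qed
    moreover have "compact ((\<lambda>t. 1 - t) ` C)"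
      using C by (intro compact_continuous_image continuous_intros)
    ultimately show ?thesis using C by simp
  qed
  have "sphere 0 1 - {y \<in> sphere 0 1. face_map K f y \<in> U} =
      (\<Union>i<?n. (\<lambda>t. rim ?n (real i + t)) ` B i)" (is "?L = ?R")
  proof
    show "?L \<subseteq> ?R"
    proof
      fix y assume y: "y \<in> ?L"
      then have "norm y = 1" "face_map K f y \<notin> U" by auto
      obtain i t where it: "i < ?n" "0 \<le> t" "t < 1" "y = rim ?n (real i + t)"
          "face_map K f y = dart_point (skel K) (bd K f ! i) t"
        using rim_pointE[OF f \<open>norm y = 1\<close>] by blast
      then have "t \<in> B i" using \<open>face_map K f y \<notin> U\<close> by (simp add: B_def)
      then show "y \<in> ?R" using it(1,4) by (intro UN_I[of i] image_eqI[of _ _ t]) auto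
    qed
    show "?R \<subseteq> ?L"
    proof
      fix y assume "y \<in> ?R"
      then obtain i t where it: "i < ?n" "t \<in> B i" "y = rim ?n (real i + t)"
        by (elim UN_E imageE) (simp only: lessThan_iff)
      have "norm y = 1" unfolding it(3) by (rule norm_rim)
      moreover have "t \<in> {0..1}" "dart_point (skel K) (bd K f ! i) t \<notin> U"
        using it(2) unfolding B_def by blast+
      then have "face_map K f y \<notin> U"
        unfolding it(3) using face_map_rim[OF f it(1)] by metis
      ultimately show "y \<in> ?L" by simp
    qed
  qed
  moreover have "compact ?R"
  proof (rule compact_UN)
    fix i assume "i \<in> {..<?n}"
    moreover have "continuous_on (B i) (\<lambda>t. rim ?n (real i + t))"
      by (intro continuous_on_rim continuous_on_add continuous_on_const continuous_on_id)
    ultimately show "compact ((\<lambda>t. rim ?n (real i + t)) ` B i)"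
      using comp compact_continuous_image by blast
  qed simp
  ultimately have "closed (sphere 0 1 - {y \<in> sphere 0 1. face_map K f y \<in> U})"
    using compact_imp_closed by metis
  then have "closedin (top_of_set (sphere 0 1)) (sphere 0 1 - {y \<in> sphere 0 1. face_map K f y \<in> U})"
    by (rule closed_subset[rotated]) blast
  then show ?thesis
    unfolding openin_closedin_eq topspace_euclidean_subtopology by blast
qed

text \<open>
  Openness can be tested separately on edges, on open discs, and near boundary points from inside the
  disc; what happens along the boundary circle is decided by the edges.
\<close>

lemma openin_realizationI:
  assumes "U \<subseteq> points K"
    and e: "\<And>e. e \<in> edges K \<Longrightarrow> openin (top_of_set {0..1}) {t \<in> {0..1}. edge_point (skel K) e t \<in> U}"
    and f: "\<And>f. f \<in> faces K \<Longrightarrow> open {y \<in> ball 0 1. FPt f y \<in> U}"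
    and near: "\<And>f y. f \<in> faces K \<Longrightarrow> norm y = 1 \<Longrightarrow> face_map K f y \<in> U \<Longrightarrow>
        \<exists>\<epsilon>>0. \<forall>w\<in>ball y \<epsilon> \<inter> ball 0 1. FPt f w \<in> U"
  shows "openin (realization K) U"
  unfolding openin_realization
proof (intro conjI ballI)
  fix g assume g: "g \<in> faces K"
  show "openin (top_of_set (cball 0 1)) {x \<in> cball 0 1. face_map K g x \<in> U}"
    unfolding openin_euclidean_subtopology_iff
  proof (intro conjI ballI)
    fix y assume y: "y \<in> {x \<in> cball 0 1. face_map K g x \<in> U}"
    show "\<exists>e>0. \<forall>x'\<in>cball 0 1. dist x' y < e \<longrightarrow> x' \<in> {x \<in> cball 0 1. face_map K g x \<in> U}"
    proof (cases "norm y < 1")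
      case True
      then have "y \<in> {y \<in> ball 0 1. FPt g y \<in> U}" using y by (auto simp: face_map_inner)
      then obtain r where "r > 0" "ball y r \<subseteq> {y \<in> ball 0 1. FPt g y \<in> U}"
        using f[OF g] openE by blast
      then show ?thesis by (intro exI[of _ r]) (auto simp: face_map_inner dist_commute subset_iff)
    next
      case False
      then have ny: "norm y = 1" using y by auto
      obtain r1 where r1: "r1 > 0" "\<forall>w\<in>ball y r1 \<inter> ball 0 1. FPt g w \<in> U"
        using near[OF g ny] y by auto
      have "\<exists>r>0. \<forall>x'\<in>sphere 0 1. dist x' y < r \<longrightarrow> x' \<in> {y \<in> sphere 0 1. face_map K g y \<in> U}"
        using openin_sphere_preimage[OF g e] y ny
        unfolding openin_euclidean_subtopology_iff by auto
      then obtain r2 where r2: "r2 > 0" 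
         "\<forall>x'\<in>sphere 0 1. dist x' y < r2 \<longrightarrow> face_map K g x' \<in> U" by auto
      show ?thesis
      proof (intro exI[of _ "min r1 r2"] conjI ballI impI)
        fix x assume x: "x \<in> cball 0 1" "dist x y < min r1 r2"
        show "x \<in> {x \<in> cball 0 1. face_map K g x \<in> U}"
        proof (cases "norm x < 1")
          case True then show ?thesis using x r1 by (auto simp: face_map_inner dist_commute)
        next
          case False then show ?thesis using x r2 by auto
        qed
      qed (use r1 r2 in auto)
    qed
  qed auto
qed (use assms in auto)

text \<open>
  This is the form used for unions of open cells: such a set contains an open face as soon as it meets
  the closed face, so that there is nothing to check inside the discs.
\<close>

lemma openin_realization_cellular:
  assumes "U \<subseteq> points K"
    and e: "\<And>e. e \<in> edges K \<Longrightarrow> openin (top_of_set {0..1}) {t \<in> {0..1}. edge_point (skel K) e t \<in> U}"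
    and f: "\<And>f. f \<in> faces K \<Longrightarrow> U \<inter> closed_face K f \<noteq> {} \<Longrightarrow> FPt f ` ball 0 1 \<subseteq> U"
  shows "openin (realization K) U"
proof (rule openin_realizationI)
  fix g assume g: "g \<in> faces K"
  show "open {y \<in> ball 0 1. FPt g y \<in> U}"
  proof (cases "U \<inter> closed_face K g = {}")
    case True
    then have "{y \<in> ball 0 1. FPt g y \<in> U} = {}"
      using FPt_closed_face[OF g] by fastforce
    then show ?thesis by (metis open_empty)
  next
    case False
    then have "{y \<in> ball 0 1. FPt g y \<in> U} = ball 0 1" using f[OF g] by auto
    then show ?thesis by (metis open_ball)
  qed
next
  fix g y assume g: "g \<in> faces K" "norm y = 1" "face_map K g y \<in> U"
  then have "U \<inter> closed_face K g \<noteq> {}" by (auto simp: closed_face_def)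
  then show "\<exists>\<epsilon>>0. \<forall>w\<in>ball y \<epsilon> \<inter> ball 0 1. FPt g w \<in> U"
    using f[OF g(1)] by (intro exI[of _ 1]) auto
qed (use assms in auto)

lemma openin_unit_interval_minus_ends:
  assumes "T \<subseteq> {0..1::real}" "{0<..<1} \<subseteq> T \<or> T = {}"
  shows "openin (top_of_set {0..1}) T"
proof (cases "T = {}")
  case False
  then have "{0<..<1} \<subseteq> T" using assms by simp
  then have "{0..1} - {0,1} \<subseteq> T" by (auto simp: less_le)
  then have T: "T = {0..1} - ({0,1} - T)" using assms(1) by blast
  have "closedin (top_of_set {0..1}) ({0,1} - T :: real set)"
    by (intro closed_subset finite_imp_closed) auto
  then have "openin (top_of_set {0..1}) ({0..1} - ({0,1} - T))"
    by (intro openin_diff) auto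
  then show ?thesis using T by simp
qed auto

definition region_of :: "'f set \<Rightarrow> ('v, 'd, 'f) point set" where
  "region_of F = (\<Union>f\<in>F. closed_face K f)"

lemma closed_face_subset: "f \<in> faces K \<Longrightarrow> closed_face K f \<subseteq> points K"
  using face_map_in_points by (auto simp: closed_face_def)

lemma edge_in_closed_face:
  assumes "f \<in> faces K" "has_side K f e" "e \<in> edges K" "t \<in> {0..1}"
  shows "edge_point (skel K) e t \<in> closed_face K f"
  using assms(4)
proof (cases t rule: unit_interval_cases)
  case 3 then show ?thesis using assms by (simp add: EPt_closed_face edge_point_inner)
qed (use assms in \<open>auto simp: VPt_closed_face intro: has_corner_endpoint\<close>)

text \<open>
  An edge misses the region, except possibly at its ends, unless one of its sides is on a face of the
  region; and a face outside the region has its whole interior outside.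
\<close>

lemma openin_compl_region:
  assumes F: "F \<subseteq> faces K"
  shows "openin (realization K) (points K - region_of F)"
proof (rule openin_realization_cellular)
  fix e assume e: "e \<in> edges K"
  let ?T = "{t \<in> {0..1}. edge_point (skel K) e t \<in> points K - region_of F}"
  show "openin (top_of_set {0..1}) ?T"
  proof (rule openin_unit_interval_minus_ends)
    show "{0<..<1} \<subseteq> ?T \<or> ?T = {}"
    proof (cases "\<exists>f\<in>F. has_side K f e")
      case True
      then obtain f where f: "f \<in> F" "f \<in> faces K" "has_side K f e" using F by auto
      have "edge_point (skel K) e t \<in> closed_face K f" if "t \<in> {0..1}" for t
        using edge_in_closed_face[OF f(2,3) e that] .
      then have "?T = {}" using f by (auto simp: region_of_def)
      then show ?thesis by simp
    next
      case False
      have "t \<in> ?T" if t: "0 < t" "t < 1" for t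
        using F False t e edge_point_in_points[OF e, of t]
        by (auto simp: region_of_def edge_point_inner EPt_closed_face subset_iff)
      then show ?thesis by auto
    qed
  qed auto
next
  fix f assume f: "f \<in> faces K" "(points K - region_of F) \<inter> closed_face K f \<noteq> {}"
  then have "f \<notin> F" by (auto simp: region_of_def)
  then show "FPt f ` ball 0 1 \<subseteq> points K - region_of F"
    using f F by (auto simp: region_of_def points_def FPt_closed_face subset_iff)
qed auto

lemma open_preimage_near:
  assumes f: "f \<in> faces K" and U: "openin (realization K) U" "face_map K f y \<in> U" "y \<in> cball 0 1"
  shows "\<exists>e>0. \<forall>w\<in>cball 0 1. dist y w < e \<longrightarrow> face_map K f w \<in> U"
proof -
  have "openin (top_of_set (cball 0 1)) {x \<in> cball 0 1. face_map K f x \<in> U}"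
    using U(1) f by (simp add: openin_realization)
  then have "\<forall>y\<in>{x \<in> cball 0 1. face_map K f x \<in> U}.
      \<exists>r>0. \<forall>x\<in>cball 0 1. dist x y < r \<longrightarrow> x \<in> {x \<in> cball 0 1. face_map K f x \<in> U}"
    unfolding openin_euclidean_subtopology_iff by (rule conjunct2)
  moreover have "y \<in> {x \<in> cball 0 1. face_map K f x \<in> U}" using U by simp
  ultimately have "\<exists>r>0. \<forall>x\<in>cball 0 1. dist x y < r \<longrightarrow> x \<in> {x \<in> cball 0 1. face_map K f x \<in> U}"
    by (rule bspec)
  then show ?thesis by (simp add: dist_commute)
qed

text \<open>The open disc is dense in the closed disc, and the characteristic map is continuous.\<close>

lemma open_face_accumulates:
  assumes f: "f \<in> faces K" and U: "openin (realization K) U" "face_map K f y \<in> U" "y \<in> cball 0 1"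
  shows "\<exists>w\<in>ball 0 1. FPt f w \<in> U"
proof -
  obtain r where r: "r > 0" "\<forall>w\<in>cball 0 1. dist y w < r \<longrightarrow> face_map K f w \<in> U"
    using open_preimage_near[OF f U] by blast
  have "y \<in> closure (ball 0 1)" using U(3) by simp
  then obtain w where w: "w \<in> ball 0 1" "dist w y < r"
    using r(1) by (auto simp: closure_approachable simp del: closure_ball)
  have "w \<in> cball 0 1" using w(1) by simp
  then have "face_map K f w \<in> U" using r(2) w(2) by (simp add: dist_commute)
  then show ?thesis using w(1) face_map_inner[of w f] by force
qed

text \<open>
  Both regions are closed and they cover the surface, so a point in only one of them is an inner point
  of that one. A point in both is a limit of open faces of each.
\<close>

lemma frontier_region:
  assumes F: "F \<subseteq> faces K" and cover: "points K \<subseteq> region_of (faces K)"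
  shows "realization K frontier_of region_of F = region_of F \<inter> region_of (faces K - F)"
proof -
  let ?X = "realization K" and ?R = "region_of F" and ?R' = "region_of (faces K - F)"
  have sub: "?R \<subseteq> points K" using F closed_face_subset by (auto simp: region_of_def)
  have "closedin ?X ?R"
    using openin_compl_region[OF F] sub by (simp add: closedin_def)
  then have cl: "?X closure_of ?R = ?R" by (simp add: closure_of_eq)
  have un: "?R \<union> ?R' = region_of (faces K)" using F by (auto simp: region_of_def)
  have "points K - ?R' \<subseteq> ?X interior_of ?R"
    using openin_compl_region[of "faces K - F"] cover un
    by (intro interior_of_maximal) auto
  then have 1: "?R - ?X interior_of ?R \<subseteq> ?R'" using sub by auto
  have 2: False if p: "p \<in> ?X interior_of ?R" "p \<in> ?R'" for p
  proof -
    obtain g y where g: "g \<in> faces K" "g \<notin> F" "p = face_map K g y" "y \<in> cball 0 1"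
      using p(2) by (auto simp: region_of_def closed_face_def)
    have "\<exists>w\<in>ball 0 1. FPt g w \<in> ?X interior_of ?R"
      using p(1) g(3,4) by (intro open_face_accumulates[where y = y, OF g(1) openin_interior_of]) auto
    then obtain w where "FPt g w \<in> ?R" using interior_of_subset[of ?X ?R] by blast
    then obtain f where f: "f \<in> F" "FPt g w \<in> closed_face K f" by (auto simp: region_of_def)
    then have "f \<in> faces K" using F by blast
    then have "g = f" using f(2) FPt_closed_face by simp
    then show False using f(1) g(2) by simp
  qed
  show ?thesis unfolding frontier_of_def cl using 1 2 by auto
qed

text \<open>
  An open disc stays connected when a boundary point is added. By means of these sets, a component
  absorbs every face that it touches.
\<close>

lemma connectedin_face_point:
  assumes f: "f \<in> faces K" and y: "y \<in> cball 0 1"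
  shows "connectedin (realization K) (insert (face_map K f y) (FPt f ` ball 0 1))"
proof -
  have "Topological_Spaces.connected (insert y (ball 0 1))"
  proof (rule connected_intermediate_closure)
    show "Topological_Spaces.connected (ball 0 (1::real) :: complex set)" by (rule connected_ball)
    show "insert y (ball 0 1) \<subseteq> closure (ball 0 1)" using y by auto
  qed blast
  then have "connectedin (top_of_set (cball 0 1)) (insert y (ball 0 1))"
    using y unfolding connectedin_subtopology by (simp add: ball_subset_cball)
  then have "connectedin (realization K) (face_map K f ` insert y (ball 0 1))"
    by (rule connectedin_continuous_map_image[OF continuous_map_face_map[OF f]])
  moreover have "face_map K f ` insert y (ball 0 1) = insert (face_map K f y) (FPt f ` ball 0 1)"
  proof -
    have "face_map K f ` ball 0 1 = FPt f ` ball 0 1"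
      by (rule image_cong) (simp_all add: face_map_inner)
    then show ?thesis by simp
  qed
  ultimately show ?thesis by simp
qed

lemma chain_points_EPt:
  "0 < t \<Longrightarrow> t < 1 \<Longrightarrow> EPt e t \<in> chain_points H c \<longleftrightarrow> e \<in> c"
  by (auto simp: chain_points_def edge_point_def image_iff intro: bexI[of _ t])

lemma chain_points_VPt:
  "VPt x \<in> chain_points H c \<longleftrightarrow> (\<exists>e\<in>c. x = tail (dg H) e \<or> x = head (dg H) e)"
  by (force simp: chain_points_def edge_point_def image_iff)

lemma chain_points_FPt: "FPt f y \<notin> chain_points H c"
  by (auto simp: chain_points_def edge_point_def)

end

section \<open>Two-sided curves and punctured neighborhoods\<close>

text \<open>
  The sets \<open>P\<close> and \<open>M\<close> are the halves of an annulus around \<open>C\<close>. The last clause says that each half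
  accumulates at every point of \<open>C\<close> and is connected locally there: arbitrarily near \<open>p\<close> there is a
  connected set \<open>H\<close> that contains the trace of the half on some neighborhood \<open>V\<close> of \<open>p\<close>.
\<close>

definition two_sided :: "'p topology \<Rightarrow> 'p set \<Rightarrow> 'p set \<Rightarrow> 'p set \<Rightarrow> bool" where
  "two_sided X C P M \<longleftrightarrow>
     openin X P \<and> openin X M \<and> P \<inter> M = {} \<and> C \<inter> (P \<union> M) = {} \<and> openin X (C \<union> P \<union> M) \<and>
     (\<forall>Z\<in>{P, M}. \<forall>p\<in>C. \<forall>U. openin X U \<and> p \<in> U \<longrightarrow>
        (\<exists>H V. connectedin X H \<and> H \<noteq> {} \<and> H \<subseteq> U \<inter> Z \<and> openin X V \<and> p \<in> V \<and> V \<inter> Z \<subseteq> H))"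

lemma connectedin_in_one_part:
  assumes "connectedin X H" "openin X U" "openin X V" "U \<inter> V = {}" "H \<subseteq> U \<union> V"
  shows "H \<subseteq> U \<or> H \<subseteq> V"
proof (rule ccontr)
  assume "\<not> ?thesis"
  then have "U \<inter> H \<noteq> {}" "V \<inter> H \<noteq> {}" using assms(5) by blast+
  moreover have "U \<inter> V \<inter> H = {}" using assms(4) by blast
  ultimately show False using assms(1,2,3,5) unfolding connectedin by blast
qed

text \<open>
  Radial projection of small discs gives connected neighborhoods in the circle without any choice of
  angles.
\<close>

lemma connected_radial_ball:
  fixes \<sigma> :: complex
  assumes "norm \<sigma> = 1" "\<delta> < 1"
  shows "Topological_Spaces.connected ((\<lambda>y. y / of_real (norm y)) ` ball \<sigma> \<delta>)"
proof (rule connected_continuous_image)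
  have "y \<noteq> 0" if "y \<in> ball \<sigma> \<delta>" for y
    using that assms by auto
  then show "continuous_on (ball \<sigma> \<delta>) (\<lambda>y. y / complex_of_real (norm y))"
    by (intro continuous_intros) auto
  show "Topological_Spaces.connected (ball \<sigma> \<delta>)" by (rule connected_ball)
qed

lemma radial_ball_near:
  fixes \<sigma> y :: complex
  assumes "norm \<sigma> = 1" "dist \<sigma> y < \<delta>" "\<delta> < 1"
  shows "norm (y / of_real (norm y)) = 1" "dist (y / of_real (norm y)) \<sigma> < 2 * \<delta>"
proof -
  have "norm \<sigma> \<le> norm y + norm (\<sigma> - y)" by (metis add.commute diff_add_cancel norm_triangle_ineq)
  then have y: "norm y > 0" using assms by (auto simp: dist_norm)
  then show "norm (y / of_real (norm y)) = 1" by (simp add: norm_divide)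
  have "y / of_real (norm y) - y = y * of_real ((1 - norm y) / norm y)"
    using y by (simp add: field_simps)
  then have "norm (y / of_real (norm y) - y) = \<bar>1 - norm y\<bar>"
    using y by (simp add: norm_mult abs_mult del: of_real_divide)
  also have "\<dots> \<le> dist \<sigma> y"
    using norm_triangle_ineq3[of \<sigma> y] assms(1) by (simp add: dist_norm)
  finally have "dist (y / of_real (norm y)) y < \<delta>" using assms(2) by (simp add: dist_norm)
  then show "dist (y / of_real (norm y)) \<sigma> < 2 * \<delta>"
    using dist_triangle[of "y / of_real (norm y)" \<sigma> y] assms(2) by (simp add: dist_commute)
qed

text \<open>
  In the annulus, with coordinates \<open>(\<sigma>, t)\<close> on the product of the circle and an interval, the curve is
  \<open>t = 0\<close> and the halves are given by the sign of \<open>t\<close>. The connected sets \<open>H\<close> are products of an arc and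
  an interval on one side of \<open>0\<close>.
\<close>

lemma orientation_preserving_two_sided:
  assumes "orientation_preserving X C"
  shows "\<exists>P M. two_sided X C P M"
proof -
  define Ann where "Ann = sphere (0::complex) 1 \<times> {-1<..<1::real}"
  obtain N h where N: "openin X N" "C \<subseteq> N"
    and h: "homeomorphic_map (subtopology X N) (top_of_set Ann) h"
    and hC: "h ` C = sphere 0 1 \<times> {0}"
    using assms unfolding orientation_preserving_def Ann_def by blast
  have topN: "topspace (subtopology X N) = N"
    using N(1) openin_subset by (metis inf.absorb_iff2 topspace_subtopology)
  obtain g where hg: "homeomorphic_maps (subtopology X N) (top_of_set Ann) h g"
    using h homeomorphic_map_maps by blast
  then have ch: "continuous_map (subtopology X N) (top_of_set Ann) h"
    and cg: "continuous_map (top_of_set Ann) (subtopology X N) g"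
    and gh: "\<And>p. p \<in> N \<Longrightarrow> g (h p) = p" and hgi: "\<And>q. q \<in> Ann \<Longrightarrow> h (g q) = q"
    unfolding homeomorphic_maps_def topN by auto
  have hN: "h p \<in> Ann" if "p \<in> N" for p
    using ch that unfolding continuous_map_def topN by auto
  have gN: "g q \<in> N" if "q \<in> Ann" for q
    using cg that unfolding continuous_map_def topN by auto
  have openN: "openin X T" if "openin (subtopology X N) T" for T
    using that N(1) by (metis openin_open_subtopology)
  have hg': "homeomorphic_map (top_of_set Ann) (subtopology X N) g"
    using hg homeomorphic_maps_map homeomorphic_maps_sym by blast
  have gopen: "openin X (g ` T)" if "openin (top_of_set Ann) T" for T
    using homeomorphic_imp_open_map[OF hg'] that openN unfolding open_map_def by blast
  define Z where "Z s = {p \<in> N. 0 < s * snd (h p)}" for s :: real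
  have Z: "openin X (Z s)" for s
  proof (rule openN)
    have "openin (top_of_set Ann) (Ann \<inter> {q. 0 < s * snd q})"
      by (intro openin_open_Int open_Collect_less continuous_intros)
    from openin_continuous_map_preimage[OF ch this]
    have "openin (subtopology X N) {x \<in> N. h x \<in> Ann \<inter> {q. 0 < s * snd q}}"
      unfolding topN .
    moreover have "{x \<in> N. h x \<in> Ann \<inter> {q. 0 < s * snd q}} = Z s"
      unfolding Z_def using hN by blast
    ultimately show "openin (subtopology X N) (Z s)" by simp
  qed
  have C: "p \<in> C \<longleftrightarrow> p \<in> N \<and> snd (h p) = 0" for p
  proof
    assume p: "p \<in> C"
    then have "h p \<in> sphere 0 1 \<times> {0}" using hC by blast
    then show "p \<in> N \<and> snd (h p) = 0" using N(2) p by (auto simp: mem_Times_iff)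
  next
    assume p: "p \<in> N \<and> snd (h p) = 0"
    then have "h p \<in> h ` C" unfolding hC using hN[of p] by (auto simp: Ann_def mem_Times_iff)
    then obtain c where "c \<in> C" "h p = h c" by blast
    then show "p \<in> C" using gh p N(2) by (metis subsetD)
  qed
  have loc: "\<exists>H V. connectedin X H \<and> H \<noteq> {} \<and> H \<subseteq> U \<inter> Z s \<and> openin X V \<and> p \<in> V \<and> V \<inter> Z s \<subseteq> H"
    if s: "s = 1 \<or> s = -1" and p: "p \<in> C" and U: "openin X U" "p \<in> U" for s p U
  proof -
    define \<sigma> where "\<sigma> = fst (h p)"
    have pN: "p \<in> N" and hp: "h p = (\<sigma>, 0)" using p C by (auto simp: \<sigma>_def prod_eq_iff)
    have \<sigma>: "norm \<sigma> = 1" using hN[OF pN] by (simp add: hp Ann_def)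
    have oU: "openin (subtopology X N) (U \<inter> N)" using U by (simp add: openin_subtopology_Int)
    have "openin (top_of_set Ann) (h ` (U \<inter> N))"
      using homeomorphic_imp_open_map[OF h] oU unfolding open_map_def by blast
    then obtain e where e: "e > 0" "\<And>q. q \<in> Ann \<Longrightarrow> dist q (\<sigma>, 0) < e \<Longrightarrow> q \<in> h ` (U \<inter> N)"
      unfolding openin_euclidean_subtopology_iff using pN U(2) hp by (metis IntI image_eqI)
    \<comment> \<open>Radial projection at most doubles the distance to \<open>\<sigma>\<close>, so a point of \<open>A \<times> I\<close> is within \<open>3 * \<delta>\<close> of \<open>(\<sigma>, 0)\<close>.\<close>
    define \<delta> where "\<delta> = min (e / 4) (1 / 2)"
    have \<delta>: "\<delta> > 0" "\<delta> < 1" "4 * \<delta> \<le> e" using e(1) by (auto simp: \<delta>_def)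
    define A where "A = (\<lambda>y. y / complex_of_real (norm y)) ` ball \<sigma> \<delta>"
    define I where "I = (\<lambda>t. s * t) ` {0<..<\<delta>}"
    have I: "t \<in> I \<longleftrightarrow> 0 < s * t \<and> s * t < \<delta>" for t
    proof -
      have ss: "s * s = 1" using s by auto
      have "t \<in> I" if "0 < s * t" "s * t < \<delta>"
        unfolding I_def using that ss by (intro image_eqI[of _ _ "s * t"]) (auto simp flip: mult.assoc)
      moreover have "0 < s * t \<and> s * t < \<delta>" if "t \<in> I"
        using that ss unfolding I_def by (auto simp flip: mult.assoc)
      ultimately show ?thesis by blast
    qed
    have AI: "A \<times> I \<subseteq> Ann"
    proof
      fix q assume "q \<in> A \<times> I"
      then obtain y where "y \<in> ball \<sigma> \<delta>" "fst q = y / of_real (norm y)" "snd q \<in> I"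
        by (auto simp: A_def)
      then show "q \<in> Ann" using radial_ball_near(1)[OF \<sigma>, of y \<delta>] I[of "snd q"] s \<delta>
        by (auto simp: Ann_def mem_Times_iff)
    qed
    have near: "q \<in> h ` (U \<inter> N)" if "q \<in> A \<times> I" for q
    proof (rule e(2))
      show "q \<in> Ann" using that AI by blast
      have "dist (fst q) \<sigma> < 2 * \<delta>" using that radial_ball_near(2)[OF \<sigma>] \<delta> by (auto simp: A_def)
      moreover have "dist (snd q) 0 < \<delta>" using that I[of "snd q"] s by (auto simp: dist_norm)
      moreover have "dist q (\<sigma>, 0) \<le> dist (fst q) \<sigma> + dist (snd q) 0"
        unfolding dist_prod_def using sqrt_sum_squares_le_sum_abs[of "dist (fst q) \<sigma>" "dist (snd q) 0"] by simp
      ultimately show "dist q (\<sigma>, 0) < e" using \<delta> by linarith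
    qed
    define H where "H = g ` (A \<times> I)"
    have "connectedin X H"
    proof -
      have "Topological_Spaces.connected A" unfolding A_def by (rule connected_radial_ball[OF \<sigma> \<delta>(2)])
      moreover have "Topological_Spaces.connected I" unfolding I_def
        by (intro connected_continuous_image continuous_intros) auto
      ultimately have "connectedin (top_of_set Ann) (A \<times> I)"
        using AI by (simp add: connectedin_subtopology connected_Times)
      then have "connectedin (subtopology X N) H"
        unfolding H_def by (rule connectedin_continuous_map_image[OF cg])
      then show ?thesis by (simp add: connectedin_subtopology)
    qed
    moreover have "H \<noteq> {}"
    proof -
      have "\<sigma> \<in> ball \<sigma> \<delta>" "s * (\<delta> / 2) \<in> I" using \<delta> s by (auto simp: I_def)
      then show ?thesis unfolding H_def A_def by blast
    qed
    moreover have "H \<subseteq> U \<inter> Z s"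
    proof
      fix r assume "r \<in> H"
      then obtain q where q: "q \<in> A \<times> I" "r = g q" unfolding H_def by blast
      obtain u where "u \<in> U \<inter> N" "q = h u" using near[OF q(1)] by blast
      then have "r = u" using gh q(2) by simp
      moreover have "0 < s * snd (h u)" using q(1) \<open>q = h u\<close> I[of "snd q"] by (simp add: mem_Times_iff)
      ultimately show "r \<in> U \<inter> Z s" using \<open>u \<in> U \<inter> N\<close> by (simp add: Z_def)
    qed
    moreover define B where "B = Ann \<inter> (ball \<sigma> \<delta> \<times> {-\<delta><..<\<delta>})"
    have "openin (top_of_set Ann) B" unfolding B_def
      by (intro openin_open_Int open_Times) auto
    then have "openin X (g ` B)" by (rule gopen)
    moreover have "p \<in> g ` B"
    proof -
      have "(\<sigma>, 0) \<in> B" using \<delta> \<sigma> by (auto simp: B_def Ann_def)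
      then show ?thesis using gh[OF pN] hp by (metis image_eqI)
    qed
    moreover have "g ` B \<inter> Z s \<subseteq> H"
    proof
      fix r assume r: "r \<in> g ` B \<inter> Z s"
      then obtain q where q: "q \<in> B" "r = g q" by blast
      then have "q \<in> Ann" by (simp add: B_def)
      then have "h r = q" using q(2) hgi by simp
      then have "0 < s * snd q" using r by (simp add: Z_def)
      then have "snd q \<in> I" using q(1) s by (auto simp: I B_def)
      moreover have "fst q \<in> A"
      proof -
        have "norm (fst q) = 1" "fst q \<in> ball \<sigma> \<delta>" using q(1) by (auto simp: B_def Ann_def)
        then show ?thesis unfolding A_def by (intro image_eqI[of _ _ "fst q"]) auto
      qed
      ultimately show "r \<in> H" using q(2) unfolding H_def by (auto simp: mem_Times_iff)
    qed
    ultimately show ?thesis by blast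
  qed
  have "two_sided X C (Z 1) (Z (-1))"
    unfolding two_sided_def
  proof (intro conjI ballI allI impI Z)
    show "Z 1 \<inter> Z (- 1) = {}" by (auto simp: Z_def)
    show "C \<inter> (Z 1 \<union> Z (- 1)) = {}" using C by (auto simp: Z_def)
    have "p \<in> C \<union> Z 1 \<union> Z (- 1) \<longleftrightarrow> p \<in> N" for p
      using C[of p] linorder_less_linear[of "snd (h p)" 0] by (auto simp: Z_def)
    then have "C \<union> Z 1 \<union> Z (- 1) = N" by blast
    then show "openin X (C \<union> Z 1 \<union> Z (- 1))" using N(1) by simp
    fix W p U assume W: "W \<in> {Z 1, Z (- 1)}" and p: "p \<in> C" and U: "openin X U \<and> p \<in> U"
    from W obtain s where "W = Z s" "s = 1 \<or> s = -1" by blast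
    then show "\<exists>H V. connectedin X H \<and> H \<noteq> {} \<and> H \<subseteq> U \<inter> W \<and> openin X V \<and> p \<in> V \<and> V \<inter> W \<subseteq> H"
      using loc[OF _ p] U by blast
  qed
  then show ?thesis by blast
qed

text \<open>Both the annulus and the charts of the surface are moved to the realization in this way.\<close>

lemma homeomorphic_map_preimage_subtopology:
  assumes \<phi>: "homeomorphic_map X S \<phi>" and N: "openin S N"
  shows "openin X {x \<in> topspace X. \<phi> x \<in> N}"
    "homeomorphic_map (subtopology X {x \<in> topspace X. \<phi> x \<in> N}) (subtopology S N) \<phi>"
proof -
  have c: "continuous_map X S \<phi>" using \<phi> homeomorphic_imp_continuous_map by blast
  show "openin X {x \<in> topspace X. \<phi> x \<in> N}" using openin_continuous_map_preimage[OF c N] .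
  have surj: "\<phi> ` topspace X = topspace S" using \<phi> homeomorphic_imp_surjective_map by blast
  have "\<phi> ` (topspace X \<inter> {x \<in> topspace X. \<phi> x \<in> N}) = topspace S \<inter> N"
    using surj by auto
  then show "homeomorphic_map (subtopology X {x \<in> topspace X. \<phi> x \<in> N}) (subtopology S N) \<phi>"
    using homeomorphic_map_subtopologies[OF \<phi>] by blast
qed

lemma orientation_preserving_homeomorphic:
  assumes \<phi>: "homeomorphic_map X S \<phi>" and C: "C \<subseteq> topspace X"
    and op: "orientation_preserving S (\<phi> ` C)"
  shows "orientation_preserving X C"
proof -
  obtain N h where N: "openin S N" "\<phi> ` C \<subseteq> N"
    and h: "homeomorphic_map (subtopology S N)
          (top_of_set (sphere (0 :: complex) 1 \<times> {-1 <..< 1 :: real})) h"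
    and hC: "h ` \<phi> ` C = sphere 0 1 \<times> {0}"
    using op unfolding orientation_preserving_def by blast
  note pre = homeomorphic_map_preimage_subtopology[OF \<phi> N(1)]
  show ?thesis unfolding orientation_preserving_def
  proof (intro exI conjI)
    show "openin X {x \<in> topspace X. \<phi> x \<in> N}" by (rule pre(1))
    show "homeomorphic_map (subtopology X {x \<in> topspace X. \<phi> x \<in> N})
          (top_of_set (sphere (0 :: complex) 1 \<times> {-1 <..< 1 :: real})) (h \<circ> \<phi>)"
      by (rule homeomorphic_map_compose[OF pre(2) h])
    show "C \<subseteq> {x \<in> topspace X. \<phi> x \<in> N}" using C N(2) by blast
    show "(h \<circ> \<phi>) ` C = sphere 0 1 \<times> {0}" using hC by (simp add: image_comp)
  qed
qed

text \<open>A disc in a chart stays connected when its center is removed.\<close>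

lemma punctured_neighbourhood:
  assumes \<phi>: "homeomorphic_map X S \<phi>" and S: "closed_surface S"
    and x: "x \<in> topspace X" and V: "openin X V" "x \<in> V"
  shows "\<exists>N. openin X N \<and> x \<in> N \<and> N \<subseteq> V \<and> connectedin X (N - {x})"
proof -
  have "\<phi> x \<in> topspace S"
    using \<phi> x homeomorphic_imp_surjective_map by blast
  then obtain U where U: "openin S U" "\<phi> x \<in> U"
      "subtopology S U homeomorphic_space (euclidean :: (real ^ 2) topology)"
    using S unfolding closed_surface_def by blast
  define U' where "U' = {x \<in> topspace X. \<phi> x \<in> U}"
  note pre = homeomorphic_map_preimage_subtopology[OF \<phi> U(1), folded U'_def]
  have "subtopology X U' homeomorphic_space (euclidean :: (real ^ 2) topology)"
    using pre(2) U(3) homeomorphic_space homeomorphic_space_trans by blast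
  then obtain h g where hg: "homeomorphic_maps (subtopology X U') (euclidean :: (real ^ 2) topology) h g"
    unfolding homeomorphic_space_def by blast
  have top: "topspace (subtopology X U') = U'" by (auto simp: U'_def)
  have hm: "homeomorphic_map (subtopology X U') (euclidean :: (real ^ 2) topology) h"
    and gm: "homeomorphic_map (euclidean :: (real ^ 2) topology) (subtopology X U') g"
    using hg homeomorphic_maps_map homeomorphic_maps_sym by blast+
  have gh: "\<And>p. p \<in> U' \<Longrightarrow> g (h p) = p" and hgi: "\<And>q. h (g q) = q"
    using hg unfolding homeomorphic_maps_def top by auto
  have xU: "x \<in> U'" using x U(2) by (simp add: U'_def)
  have "openin (subtopology X U') (V \<inter> U')" using V by (simp add: openin_subtopology_Int)
  then have "open (h ` (V \<inter> U'))"
    using homeomorphic_imp_open_map[OF hm] unfolding open_map_def by simp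
  then obtain r where r: "r > 0" "ball (h x) r \<subseteq> h ` (V \<inter> U')"
    using V(2) xU open_contains_ball by (metis IntI image_eqI)
  define N where "N = g ` ball (h x) r"
  have "openin (subtopology X U') N"
    using homeomorphic_imp_open_map[OF gm] unfolding open_map_def N_def by simp
  then have "openin X N" using pre(1) by (metis openin_open_subtopology)
  moreover have "x \<in> N" using gh[OF xU] r(1) unfolding N_def by (metis centre_in_ball image_eqI)
  moreover have "N \<subseteq> V"
  proof
    fix p assume "p \<in> N"
    then obtain q where q: "q \<in> ball (h x) r" "p = g q" unfolding N_def by blast
    then obtain u where "u \<in> V \<inter> U'" "q = h u" using r(2) by blast
    then show "p \<in> V" using gh q(2) by simp
  qed
  moreover have "connectedin X (N - {x})"
  proof -
    have "N - {x} = g ` (ball (h x) r - {h x})"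
      unfolding N_def using gh[OF xU] hgi by (metis (no_types, lifting) image_empty image_insert inj_on_def image_set_diff)
    moreover have "Topological_Spaces.connected (ball (h x) r - {h x})"
      by (rule connected_punctured_ball) simp
    then have "connectedin (subtopology X U') (g ` (ball (h x) r - {h x}))"
      by (intro connectedin_continuous_map_image[OF homeomorphic_imp_continuous_map[OF gm]]) simp
    ultimately show ?thesis by (simp add: connectedin_subtopology)
  qed
  ultimately show ?thesis by blast
qed

text \<open>
  An open sector around the direction of the \<open>i\<close>-th corner, reaching a third of the way along the two
  adjacent sides. As an image under \<open>exp\<close>, it is open because \<open>exp\<close> is a covering of the punctured plane,
  and sectors at different corners are disjoint because \<open>exp\<close> has period \<open>2 * pi * \<i>\<close>.
\<close>

definition sector :: "nat \<Rightarrow> nat \<Rightarrow> complex set" where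
  "sector n i = exp ` {w. \<bar>Re w\<bar> < 1 \<and> \<bar>Im w - 2 * pi * real i / real n\<bar> < 2 * pi / (3 * real n)}"

lemma open_sector: "open (sector n i)"
proof -
  have "open {w. \<bar>Re w\<bar> < 1 \<and> \<bar>Im w - 2 * pi * real i / real n\<bar> < 2 * pi / (3 * real n)}"
    by (intro open_Collect_conj open_Collect_less continuous_intros)
  then have "openin (top_of_set (- {0})) (sector n i)"
    unfolding sector_def
    by (intro covering_space_open_map[OF covering_space_exp_punctured_plane]) simp
  then show ?thesis
    by (metis open_Compl closed_singleton openin_open_eq)
qed

lemma rim_in_sector:
  assumes "n > 0" "\<bar>t\<bar> < 1 / 3" shows "rim n (real i + t) \<in> sector n i"
proof -
  have "\<bar>2 * pi * (real i + t) / real n - 2 * pi * real i / real n\<bar> = 2 * pi * \<bar>t\<bar> / real n"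
    using assms(1) by (simp add: diff_divide_distrib[symmetric] algebra_simps abs_mult)
  also have "\<dots> < 2 * pi * (1 / 3) / real n"
    using assms by (intro divide_strict_right_mono mult_strict_left_mono) auto
  finally show ?thesis unfolding sector_def rim_def cis_conv_exp
    by (intro imageI) simp
qed

lemma sector_disjoint:
  assumes n: "n > 0" and i: "i < n" "j < n" and w: "w \<in> sector n i" "w \<in> sector n j"
  shows "i = j"
proof -
  let ?p = "2 * pi / real n"
  obtain a where a: "w = exp a" "\<bar>Im a - 2 * pi * real i / real n\<bar> < 2 * pi / (3 * real n)"
    using w(1) by (auto simp: sector_def)
  obtain b where b: "w = exp b" "\<bar>Im b - 2 * pi * real j / real n\<bar> < 2 * pi / (3 * real n)"
    using w(2) by (auto simp: sector_def)
  obtain k :: int where k: "a = b + complex_of_real (of_int (2 * k) * pi) * \<i>"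
    using a(1) b(1) exp_eq[of a b] by auto
  then have im: "Im a = Im b + of_int (2 * k) * pi" by simp
  have A: "\<bar>Im a - ?p * real i\<bar> < ?p / 3" "\<bar>Im b - ?p * real j\<bar> < ?p / 3"
    using a(2) b(2) by (simp_all add: field_simps)
  have "of_int (2 * k) * pi = ?p * (real_of_int k * real n)" using n by simp
  then have eq: "?p * (real i - real j - real_of_int k * real n)
      = (Im b - ?p * real j) - (Im a - ?p * real i)"
    unfolding right_diff_distrib using im by linarith
  have pp: "0 < ?p" using n by simp
  have gen: "\<bar>x\<bar> < q" if "x = v - u" "0 < q" "\<bar>u\<bar> < q / 3" "\<bar>v\<bar> < q / 3" for x u v q :: real
    using that by linarith
  have "\<bar>?p * (real i - real j - real_of_int k * real n)\<bar> < ?p"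
    by (rule gen[OF eq pp A])
  then have "?p * \<bar>real i - real j - real_of_int k * real n\<bar> < ?p * 1"
    by (simp only: abs_mult[of ?p] abs_of_pos[OF pp] mult_1_right)
  then have "\<bar>real i - real j - real_of_int k * real n\<bar> < 1"
    by (simp only: mult_less_cancel_left_pos[OF pp])
  moreover have "real i - real j - real_of_int k * real n = real_of_int (int i - int j - k * int n)"
    by simp
  ultimately have "\<bar>int i - int j - k * int n\<bar> < 1" by linarith
  then have e: "int i - int j = k * int n" by linarith
  have "k = 0"
  proof (rule ccontr)
    assume "k \<noteq> 0"
    then have "\<bar>k\<bar> \<ge> 1" by linarith
    then have "\<bar>k * int n\<bar> \<ge> int n" by (simp add: abs_mult mult_le_cancel_right1)
    then show False using e i by linarith
  qed
  then show ?thesis using e by simp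
qed

section \<open>Sides of a curve in the 1-skeleton\<close>

text \<open>
  This is used for boundary points \<open>y\<close> of the polygon, to express on which side of a curve through the image
  of \<open>y\<close> the face lies there.
\<close>

definition side_at :: "('v, 'd, 'f) point set \<Rightarrow> 'f \<Rightarrow> complex \<Rightarrow> bool" where
  "side_at Z f y \<longleftrightarrow> (\<exists>\<epsilon>>0. \<forall>w\<in>ball y \<epsilon> \<inter> ball 0 1. FPt f w \<in> Z)"

lemma side_at_open: "open {y. side_at Z f y}"
  unfolding open_contains_ball
proof
  fix y assume "y \<in> {y. side_at Z f y}"
  then obtain e where e: "e > 0" "\<forall>w\<in>ball y e \<inter> ball 0 1. FPt f w \<in> Z" by (auto simp: side_at_def)
  have "side_at Z f y'" if y': "y' \<in> ball y (e / 2)" for y'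
  proof -
    have "w \<in> ball y e" if "w \<in> ball y' (e / 2)" for w
      using that y' dist_triangle[of y w y'] by simp
    then show ?thesis unfolding side_at_def using e by (intro exI[of _ "e / 2"]) auto
  qed
  then show "\<exists>\<epsilon>>0. ball y \<epsilon> \<subseteq> {y. side_at Z f y}"
    using e(1) by (intro exI[of _ "e / 2"]) auto
qed

lemma side_at_common_point:
  assumes "norm y = 1" "side_at Z f y" "open V" "y \<in> V"
  shows "\<exists>w\<in>V \<inter> ball 0 1. FPt f w \<in> Z"
proof -
  obtain e where e: "e > 0" "\<forall>w\<in>ball y e \<inter> ball 0 1. FPt f w \<in> Z"
    using assms(2) by (auto simp: side_at_def)
  have "y \<in> closure (ball 0 1)" using assms(1) by simp
  moreover have "open (V \<inter> ball y e)" "y \<in> V \<inter> ball y e" using assms e by auto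
  ultimately have "V \<inter> ball y e \<inter> ball 0 1 \<noteq> {}"
    using open_Int_closure_eq_empty[of "V \<inter> ball y e" "ball 0 1"] by blast
  then show ?thesis using e(2) by blast
qed

lemma side_at_exclusive:
  assumes "norm y = 1" "side_at Z f y" "side_at Z' f y" "Z \<inter> Z' = {}"
  shows False
proof -
  obtain e where e: "e > 0" "\<forall>w\<in>ball y e \<inter> ball 0 1. FPt f w \<in> Z'"
    using assms(3) by (auto simp: side_at_def)
  then obtain w where "w \<in> ball y e \<inter> ball 0 1" "FPt f w \<in> Z"
    using side_at_common_point[OF assms(1,2), of "ball y e"] by auto
  then show False using e(2) assms(4) by blast
qed

context polygonal
begin

abbreviation curve :: "'d set \<Rightarrow> ('v, 'd, 'f) point set" where
  "curve z \<equiv> chain_points (skel K) z"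

lemma side_at_openin:
  assumes f: "f \<in> faces K" and U: "openin (realization K) U" "face_map K f y \<in> U" "norm y = 1"
  shows "side_at U f y"
proof -
  obtain e where e: "e > 0" "\<forall>w\<in>cball 0 1. dist y w < e \<longrightarrow> face_map K f w \<in> U"
    using open_preimage_near[OF f U(1,2)] U(3) by auto
  have "FPt f w \<in> U" if "w \<in> ball y e \<inter> ball 0 1" for w
  proof -
    have "w \<in> cball 0 1" "dist y w < e" using that by auto
    then have "face_map K f w \<in> U" using e(2) by blast
    then show ?thesis using that by (simp add: face_map_inner)
  qed
  then show ?thesis unfolding side_at_def using e(1) by blast
qed

text \<open>The index of the dart that enters the \<open>i\<close>-th corner.\<close>

definition prev :: "'f \<Rightarrow> nat \<Rightarrow> nat" where
  "prev f i = (i + gonality K f - 1) mod gonality K f"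

lemma prev_less: "f \<in> faces K \<Longrightarrow> prev f i < gonality K f"
  unfolding prev_def using gonality_pos by simp

lemma Suc_prev: "f \<in> faces K \<Longrightarrow> i < gonality K f \<Longrightarrow> Suc (prev f i) mod gonality K f = i"
  unfolding prev_def using gonality_pos[of f]
  by (metis Suc_diff_1 add_gr_0 mod_Suc_eq mod_add_self2 mod_less)

lemma prev_Suc:
  assumes "i < gonality K f" shows "prev f (Suc i mod gonality K f) = i"
proof (cases "Suc i < gonality K f")
  case True then show ?thesis by (simp add: prev_def)
next
  case False
  then have "Suc i = gonality K f" using assms by simp
  then have "Suc i mod gonality K f = 0" "gonality K f - 1 = i" by auto
  then show ?thesis using assms by (simp add: prev_def)
qed

lemma rim_Suc_mod:
  assumes "f \<in> faces K" "i < gonality K f"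
  shows "rim (gonality K f) (real (Suc i mod gonality K f) + t) = rim (gonality K f) (real i + (1 + t))"
proof (cases "Suc i < gonality K f")
  case True then show ?thesis by (simp add: algebra_simps)
next
  case False
  then have "Suc i = gonality K f" using assms(2) by simp
  then have eq: "real i + (1 + t) = t + real (gonality K f)" by (simp flip: \<open>Suc i = gonality K f\<close>)
  have "rim (gonality K f) (real i + (1 + t)) = rim (gonality K f) t"
    unfolding eq by (rule rim_add_period[OF gonality_pos[OF assms(1)]])
  moreover have "real (Suc i mod gonality K f) + t = t" using \<open>Suc i = gonality K f\<close> by simp
  ultimately show ?thesis by metis
qed

lemma flank_True [simp]: "flank K (f, i) True = bd K f ! i"
  by (simp add: flank_def)

lemma flank_False: "flank K (f, i) False = flip K (bd K f ! prev f i)"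
  by (simp add: flank_def prev_def Let_def)

text \<open>
  Either flanking dart leaves the vertex of the corner: the one that leaves along the boundary walk by
  definition, and the reversed entering one because the walk is connected.
\<close>

lemma flank_dart:
  assumes "c \<in> corners K"
  shows "flank K c s \<in> darts K" "src K (flank K c s) = corner_vertex K c"
proof -
  obtain f i where c: "c = (f, i)" "f \<in> faces K" "i < gonality K f"
    using assms by (auto simp: corners_def)
  have "tgt K (bd K f ! prev f i) = src K (bd K f ! i)"
    using bd_consecutive[OF c(2) prev_less[OF c(2), of i]] Suc_prev[OF c(2,3)] by simp
  then show "flank K c s \<in> darts K" "src K (flank K c s) = corner_vertex K c"
    using c prev_less[OF c(2), of i] by (cases s; simp add: flank_False corner_vertex_def)+
qed

lemma flank_side:
  assumes "c \<in> corners K" shows "has_side K (fst c) (edge_under K (flank K c s))"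
proof -
  obtain f i where c: "c = (f, i)" "f \<in> faces K" "i < gonality K f"
    using assms by (auto simp: corners_def)
  have "edge_under K (flank K c s) = edge_under K (bd K f ! (if s then i else prev f i))"
    using c prev_less[OF c(2), of i] by (simp add: flank_False)
  then show ?thesis using c prev_less[OF c(2), of i] unfolding has_side_def by (cases s) auto
qed

text \<open>
  If the boundary walk runs along \<open>d\<close>, the corner is the one where it starts to do so; if it runs along
  the reverse of \<open>d\<close>, the corner is the next one.
\<close>

lemma side_flank:
  assumes "f \<in> faces K" "has_side K f (edge_under K d)" "d \<in> darts K"
  shows "\<exists>i s. (f, i) \<in> corners K \<and> flank K (f, i) s = d"
proof -
  obtain i where i: "i < gonality K f" "edge_under K (bd K f ! i) = edge_under K d"
    using assms(2) by (auto simp: has_side_def)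
  have "bd K f ! i = d \<or> bd K f ! i = flip K d"
    using i assms(3) bd_dart[OF assms(1) i(1)] by (auto simp: under_edge_def split: if_splits) (metis flip_flip)+
  then show ?thesis
  proof
    assume "bd K f ! i = d" then show ?thesis using assms(1) i(1)
      by (intro exI[of _ i] exI[of _ True]) (simp add: corners_def)
  next
    assume e: "bd K f ! i = flip K d"
    let ?j = "Suc i mod gonality K f"
    have j: "?j < gonality K f" using gonality_pos[OF assms(1)] by simp
    have "prev f ?j = i" by (rule prev_Suc[OF i(1)])
    then show ?thesis using e assms j
      by (intro exI[of _ ?j] exI[of _ False]) (simp add: corners_def flank_False)
  qed
qed

lemma corner_has_corner: "c \<in> corners K \<Longrightarrow> has_corner K (fst c) (corner_vertex K c)"
  by (auto simp: corners_def corner_vertex_def has_corner_def)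

text \<open>
  A piece of a star-shaped neighborhood of a vertex: the sectors at the corners in \<open>T\<close> and the initial
  thirds of the darts in \<open>E\<close>, together with \<open>V\<close>, which is empty or consists of the vertex itself. The
  thirds match the size of the sectors, so that the fan is open if it is closed under passing from a
  dart to the corners next to it.
\<close>

definition fan :: "('f \<times> nat) set \<Rightarrow> 'd set \<Rightarrow> ('v, 'd, 'f) point set \<Rightarrow> ('v, 'd, 'f) point set" where
  "fan T E V =
     {FPt f w | f i w. (f, i) \<in> T \<and> w \<in> sector (gonality K f) i \<inter> ball 0 1} \<union>
     {dart_point (skel K) d t | d t. d \<in> E \<and> 0 < t \<and> t < 1 / 3} \<union> V"

lemma dart_point_eq_iff:
  assumes "d \<in> darts K" "d' \<in> darts K" "0 < t" "t < 1" "0 < u" "u < 1"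
  shows "(dart_point (skel K) d t :: ('v, 'd, 'f) point) = dart_point (skel K) d' u \<longleftrightarrow>
     d' = d \<and> u = t \<or> d' = flip K d \<and> u = 1 - t"
proof -
  have "d' = d \<or> d' = flip K d" if "edge_under K d = edge_under K d'"
    using that assms(1,2) by (auto simp: under_edge_def split: if_splits) (metis flip_flip)+
  then consider "d' = d" | "d' = flip K d" | "d' \<noteq> d" "d' \<noteq> flip K d" "edge_under K d \<noteq> edge_under K d'"
    by blast
  moreover have "flip K d \<noteq> d" using flip_edge[OF assms(1)] by metis
  ultimately show ?thesis
  proof cases
    case 2
    then show ?thesis using assms \<open>flip K d \<noteq> d\<close> flip_edge[OF assms(1)]
      by (auto simp: dart_point_inner)
  qed (use assms \<open>flip K d \<noteq> d\<close> in \<open>auto simp: dart_point_inner\<close>)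
qed

lemma dart_point_on_curve:
  assumes "d \<in> darts K" "0 < t" "t < 1"
  shows "dart_point (skel K) d t \<in> curve z \<longleftrightarrow> edge_under K d \<in> z"
  unfolding dart_point_inner[OF assms] using assms(2,3) by (intro chain_points_EPt) auto

lemma dart_point_fan:
  assumes E: "E \<subseteq> darts K" and V: "V \<subseteq> {VPt x}" and d: "d \<in> darts K" and t: "0 < t" "t < 1"
  shows "dart_point (skel K) d t \<in> fan T E V \<longleftrightarrow> d \<in> E \<and> t < 1 / 3 \<or> flip K d \<in> E \<and> 2 / 3 < t"
proof -
  have "dart_point (skel K) d t \<in> fan T E V \<longleftrightarrow>
     (\<exists>d' u. d' \<in> E \<and> 0 < u \<and> u < 1 / 3 \<and> (dart_point (skel K) d t :: ('v, 'd, 'f) point) = dart_point (skel K) d' u)"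
    using V by (auto simp: fan_def dart_point_inner[OF d t])
  also have "\<dots> \<longleftrightarrow> (\<exists>d' u. d' \<in> E \<and> 0 < u \<and> u < 1 / 3 \<and> (d' = d \<and> u = t \<or> d' = flip K d \<and> u = 1 - t))"
  proof -
    have "(dart_point (skel K) d t :: ('v, 'd, 'f) point) = dart_point (skel K) d' u \<longleftrightarrow>
        d' = d \<and> u = t \<or> d' = flip K d \<and> u = 1 - t"
      if "d' \<in> E" "0 < u" "u < 1 / 3" for d' u
      using that E by (intro dart_point_eq_iff[OF d _ t]) auto
    then show ?thesis by (intro ex_cong1) blast
  qed
  also have "\<dots> \<longleftrightarrow> d \<in> E \<and> t < 1 / 3 \<or> flip K d \<in> E \<and> 2 / 3 < t" (is "?L \<longleftrightarrow> ?R")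
  proof
    assume ?R
    then show ?L
    proof
      assume "d \<in> E \<and> t < 1 / 3"
      then show ?L using t by (intro exI[of _ d] exI[of _ t]) simp
    next
      assume "flip K d \<in> E \<and> 2 / 3 < t"
      then show ?L using t by (intro exI[of _ "flip K d"] exI[of _ "1 - t"]) simp
    qed
  qed auto
  finally show ?thesis .
qed

lemma VPt_fan: "E \<subseteq> darts K \<Longrightarrow> VPt y \<in> fan T E V \<longleftrightarrow> VPt y \<in> V"
  by (force simp: fan_def dart_point_inner)

lemma FPt_fan: "E \<subseteq> darts K \<Longrightarrow> V \<subseteq> {VPt x} \<Longrightarrow>
  FPt f w \<in> fan T E V \<longleftrightarrow> norm w < 1 \<and> (\<exists>i. (f, i) \<in> T \<and> w \<in> sector (gonality K f) i)"
  by (force simp: fan_def dart_point_inner)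

text \<open>
  Near a boundary point, only the sector at the nearest corner matters. The last condition lets the
  vertex belong to the fan only if the fan goes all the way around it.
\<close>

lemma openin_fan:
  assumes T: "T \<subseteq> {c \<in> corners K. corner_vertex K c = x}"
    and E: "E \<subseteq> {d \<in> darts K. src K d = x}"
    and TE: "\<And>c s. c \<in> corners K \<Longrightarrow> corner_vertex K c = x \<Longrightarrow> flank K c s \<in> E \<Longrightarrow> c \<in> T"
    and V: "V = {} \<or> V = {VPt x} \<and> x \<in> nodes K \<and> E = {d \<in> darts K. src K d = x} \<and>
       T = {c \<in> corners K. corner_vertex K c = x}"
  shows "openin (realization K) (fan T E V)"
proof (rule openin_realizationI)
  have E': "E \<subseteq> darts K" and V': "V \<subseteq> {VPt x}" using E V by auto
  note in_fan = dart_point_fan[OF E' V'] VPt_fan[OF E'] FPt_fan[OF E' V']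
  show "fan T E V \<subseteq> points K"
  proof -
    have "FPt f w \<in> points K" if "(f, i) \<in> T" "norm w < 1" for f i w
      using that T by (auto simp: points_def corners_def)
    moreover have "V \<subseteq> points K" using V by (auto simp: points_def)
    moreover have "dart_point (skel K) d t \<in> points K" if "d \<in> E" "0 < t" "t < 1 / 3" for d t
      using that E' by (intro dart_point_in_points) auto
    ultimately show ?thesis unfolding fan_def by auto
  qed
  {
    fix e assume e: "e \<in> edges K"
    have ed: "e \<in> darts K" by (rule edges_darts[OF e])
    define I where "I = (if V = {} then {0<..<1/3} else {..<1/3 :: real})"
    define J where "J = (if V = {} then {2/3<..<1} else {2/3 :: real<..})"
    have "t \<in> {t \<in> {0..1}. edge_point (skel K) e t \<in> fan T E V} \<longleftrightarrow>
        t \<in> {0..1} \<inter> ((if e \<in> E then I else {}) \<union> (if flip K e \<in> E then J else {}))" for t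
    proof (cases "t \<in> {0..1}")
      case True
      then show ?thesis
      proof (cases t rule: unit_interval_cases)
        case 1
        have "VPt (src K e) \<in> V \<longleftrightarrow> V \<noteq> {} \<and> e \<in> E" using V ed by auto
        then show ?thesis using 1 in_fan(2) by (auto simp: I_def J_def)
      next
        case 2
        have "VPt (tgt K e) \<in> V \<longleftrightarrow> V \<noteq> {} \<and> flip K e \<in> E" using V ed by auto
        then show ?thesis using 2 in_fan(2) by (auto simp: I_def J_def)
      next
        case 3
        have iff: "edge_point (skel K) e t \<in> fan T E V \<longleftrightarrow> e \<in> E \<and> t < 1 / 3 \<or> flip K e \<in> E \<and> 2 / 3 < t"
          using in_fan(1)[OF ed 3, of T] e by (simp add: dart_point_def)
        show ?thesis unfolding mem_Collect_eq iff using 3 by (auto simp: I_def J_def)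
      qed
    qed auto
    then have "{t \<in> {0..1}. edge_point (skel K) e t \<in> fan T E V} =
       {0..1} \<inter> ((if e \<in> E then I else {}) \<union> (if flip K e \<in> E then J else {}))" by blast
    moreover have "open ((if e \<in> E then I else {}) \<union> (if flip K e \<in> E then J else {}))"
      unfolding I_def J_def by auto
    ultimately show "openin (top_of_set {0..1}) {t \<in> {0..1}. edge_point (skel K) e t \<in> fan T E V}"
      by (metis openin_open_Int)
  }
  {
    fix f assume "f \<in> faces K"
    have "{y \<in> ball 0 1. FPt f y \<in> fan T E V} =
       (\<Union>i\<in>{i. (f, i) \<in> T}. sector (gonality K f) i \<inter> ball 0 1)"
      using in_fan(3) by auto
    then show "open {y \<in> ball 0 1. FPt f y \<in> fan T E V}"
      by (metis (no_types, lifting) open_Int open_UN open_ball open_sector)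
  }
  fix f y assume f: "f \<in> faces K" and y: "norm y = 1" "face_map K f y \<in> fan T E V"
  let ?n = "gonality K f"
  have "\<exists>i. (f, i) \<in> T \<and> y \<in> sector ?n i"
  proof -
    obtain i t where it: "i < ?n" "0 \<le> t" "t < 1" "y = rim ?n (real i + t)"
      "face_map K f y = dart_point (skel K) (bd K f ! i) t"
      using rim_pointE[OF f y(1)] by blast
    let ?d = "bd K f ! i"
    have d: "?d \<in> darts K" using f it(1) by simp
    show ?thesis
    proof (cases "t = 0")
      case True
      then have "VPt (src K ?d) \<in> V" using y(2) it(5) d in_fan(2) by simp
      then have "(f, i) \<in> T" using V f it(1) by (auto simp: corners_def corner_vertex_def)
      moreover have "y \<in> sector ?n i"
        using rim_in_sector[OF gonality_pos[OF f], of 0 i] it(4) True by simp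
      ultimately show ?thesis by blast
    next
      case False
      then have t: "0 < t" using it(2) by simp
      from y(2) consider "?d \<in> E" "t < 1 / 3" | "flip K ?d \<in> E" "2 / 3 < t"
        unfolding it(5) in_fan(1)[OF d t it(3)] by blast
      then show ?thesis
      proof cases
        case 1
        have "(f, i) \<in> T"
          using 1(1) E f it(1) by (intro TE[of _ True]) (auto simp: corners_def corner_vertex_def)
        moreover have "y \<in> sector ?n i"
          using rim_in_sector[OF gonality_pos[OF f], of t i] it(4) t 1(2) by simp
        ultimately show ?thesis by blast
      next
        case 2
        let ?j = "Suc i mod ?n"
        have j: "(f, ?j) \<in> corners K" using gonality_pos[OF f] f by (simp add: corners_def)
        have "prev f ?j = i" by (rule prev_Suc[OF it(1)])
        then have fl: "flank K (f, ?j) False = flip K ?d" by (simp add: flank_False)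
        then have "src K (flip K ?d) = corner_vertex K (f, ?j)"
          using flank_dart(2)[OF j, of False] by simp
        then have "(f, ?j) \<in> T"
          using 2(1) E j fl by (intro TE[of _ False]) auto
        moreover have "y \<in> sector ?n ?j"
          using rim_in_sector[OF gonality_pos[OF f], of "t - 1" ?j] rim_Suc_mod[OF f it(1), of "t - 1"]
            it(3,4) 2(2) by simp
        ultimately show ?thesis by blast
      qed
    qed
  qed
  then obtain i where i: "(f, i) \<in> T" "y \<in> sector ?n i" by blast
  then obtain e where "e > 0" "ball y e \<subseteq> sector ?n i"
    using open_sector open_contains_ball by metis
  then show "\<exists>\<epsilon>>0. \<forall>w\<in>ball y \<epsilon> \<inter> ball 0 1. FPt f w \<in> fan T E V"
    using i(1) in_fan(3) by (intro exI[of _ e]) auto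
qed

end

text \<open>
  The two sides \<open>P\<close> and \<open>M\<close> stand for the halves of an annulus around the curve. That the complex is a
  surface is recorded by the connectedness of punctured neighborhoods.
\<close>

locale cut_surface = polygonal K
  for K :: "('v, 'd, 'f) cell_complex" +
  fixes z :: "'d set" and P M :: "('v, 'd, 'f) point set"
  assumes z: "z \<subseteq> edges K"
    and two_sided: "two_sided (realization K) (chain_points (skel K) z) P M"
    and punctured: "\<And>p V. p \<in> points K \<Longrightarrow> openin (realization K) V \<Longrightarrow> p \<in> V \<Longrightarrow>
        \<exists>N. openin (realization K) N \<and> p \<in> N \<and> N \<subseteq> V \<and> connectedin (realization K) (N - {p})"
    and nodes_have_darts: "\<And>x. x \<in> nodes K \<Longrightarrow> \<exists>d\<in>darts K. src K d = x"
begin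

lemma open_P: "openin (realization K) P" and open_M: "openin (realization K) M"
  and disj: "P \<inter> M = {}" and disjC: "curve z \<inter> (P \<union> M) = {}"
  and open_N: "openin (realization K) (curve z \<union> P \<union> M)"
  using two_sided by (auto simp: two_sided_def)

lemma two_sided_local:
  assumes "Z \<in> {P, M}" "p \<in> curve z" "openin (realization K) U" "p \<in> U"
  obtains H V where "connectedin (realization K) H" "H \<noteq> {}" "H \<subseteq> U \<inter> Z"
    "openin (realization K) V" "p \<in> V" "V \<inter> Z \<subseteq> H"
  using two_sided assms unfolding two_sided_def by meson

text \<open>
  An edge that is on no face would be an open arc, and any point of an arc disconnects its small
  neighborhoods in the arc.
\<close>

lemma edge_has_side:
  assumes e: "e \<in> edges K" shows "\<exists>f\<in>faces K. has_side K f e"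
proof (rule ccontr)
  assume no: "\<not> ?thesis"
  have op: "openin (realization K) (EPt e ` T)" if T: "open T" "T \<subseteq> {0<..<1}" for T
  proof (rule openin_realization_cellular)
    show "EPt e ` T \<subseteq> points K" using T(2) e by (auto simp: points_def)
  next
    fix e' assume "e' \<in> edges K"
    have "{t \<in> {0..1}. edge_point (skel K) e' t \<in> (EPt e ` T :: ('v, 'd, 'f) point set)} = {0..1} \<inter> (if e' = e then T else {})"
      using T(2) by (auto simp: edge_point_def)
    moreover have "open (if e' = e then T else {})" using T(1) by simp
    ultimately show "openin (top_of_set {0..1}) {t \<in> {0..1}. edge_point (skel K) e' t \<in> (EPt e ` T :: ('v, 'd, 'f) point set)}"
      by (metis openin_open_Int)
  next
    fix f assume "f \<in> faces K" "EPt e ` T \<inter> closed_face K f \<noteq> {}"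
    then show "FPt f ` ball 0 1 \<subseteq> EPt e ` T"
      using no EPt_closed_face[of f e] by auto
  qed
  let ?p = "EPt e (1/2) :: ('v, 'd, 'f) point"
  have "?p \<in> points K" using edge_point_in_points[OF e, of "1/2"] by (simp add: edge_point_def)
  moreover have "?p \<in> EPt e ` {0<..<1}" by auto
  ultimately obtain N where N: "openin (realization K) N" "?p \<in> N" "N \<subseteq> EPt e ` {0<..<1}"
      "connectedin (realization K) (N - {?p})"
    using punctured[OF _ op[of "{0<..<1}"]] by auto
  have "openin (top_of_set {0..1}) {t \<in> {0..1}. edge_point (skel K) e t \<in> N}"
    using N(1) e by (simp add: openin_realization)
  moreover have "1/2 \<in> {t \<in> {0..1}. edge_point (skel K) e t \<in> N}"
    using N(2) by (simp add: edge_point_def)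
  ultimately obtain r where r: "r > 0" "\<And>t. t \<in> {0..1} \<Longrightarrow> dist t (1/2) < r \<Longrightarrow> edge_point (skel K) e t \<in> N"
    unfolding openin_euclidean_subtopology_iff by blast
  \<comment> \<open>Two points of the edge on different sides of the midpoint, both in the neighborhood.\<close>
  define q where "q = min (r / 2) (1 / 4)"
  have q: "0 < q" "q < r" "q \<le> 1 / 4" using r(1) by (auto simp: q_def)
  have "EPt e (1/2 - q) \<in> N" "EPt e (1/2 + q) \<in> N"
    using r(2)[of "1/2 - q"] r(2)[of "1/2 + q"] q by (auto simp: dist_real_def edge_point_inner)
  then have in1: "EPt e (1/2 - q) \<in> N - {?p}" "EPt e (1/2 + q) \<in> N - {?p}" using q by auto
  have "N - {?p} \<subseteq> EPt e ` {0<..<1/2} \<or> N - {?p} \<subseteq> EPt e ` {1/2<..<1}"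
  proof (rule connectedin_in_one_part[OF N(4)])
    show "openin (realization K) (EPt e ` {0<..<1/2})" "openin (realization K) (EPt e ` {1/2<..<1})"
      by (rule op; auto)+
    show "EPt e ` {0<..<1/2} \<inter> EPt e ` {1/2<..<1} = {}" by auto
    show "N - {?p} \<subseteq> EPt e ` {0<..<1/2} \<union> EPt e ` {1/2<..<1}"
    proof
      fix p assume "p \<in> N - {?p}"
      then obtain t where t: "0 < t" "t < 1" "p = EPt e t" using N(3) by auto
      moreover have "t \<noteq> 1/2" using \<open>p \<in> N - {?p}\<close> t(3) by blast
      ultimately show "p \<in> EPt e ` {0<..<1/2} \<union> EPt e ` {1/2<..<1}"
        by (cases "t < 1/2") auto
    qed
  qed
  then show False using in1 q by auto
qed

lemma dart_has_flank:
  assumes "d \<in> darts K"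
  shows "\<exists>c s. c \<in> corners K \<and> flank K c s = d"
  using edge_has_side[of "edge_under K d"] side_flank[OF _ _ assms] assms by fastforce

lemma node_has_corner:
  assumes "x \<in> nodes K" shows "\<exists>c\<in>corners K. corner_vertex K c = x"
  using nodes_have_darts[OF assms] dart_has_flank flank_dart(2) by metis

lemma faces_cover: "points K \<subseteq> region_of (faces K)"
proof
  fix p assume p: "p \<in> points K"
  show "p \<in> region_of (faces K)"
  proof (cases p)
    case (VPt x)
    then have "x \<in> nodes K" using p by (auto simp: points_def)
    then obtain c where "c \<in> corners K" "corner_vertex K c = x" using node_has_corner by blast
    then have "fst c \<in> faces K" "has_corner K (fst c) x" using corner_has_corner by (auto simp: corners_def)
    then show ?thesis using VPt by (auto simp: region_of_def VPt_closed_face)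
  next
    case (EPt e t)
    then have "e \<in> edges K" "0 < t" "t < 1" using p by (auto simp: points_def)
    then show ?thesis using EPt edge_has_side by (auto simp: region_of_def EPt_closed_face)
  next
    case (FPt f w)
    then show ?thesis using p by (auto simp: points_def region_of_def FPt_closed_face)
  qed
qed

text \<open>
  If \<open>F\<close> and its complement were both nonempty, the faces in them would have no common points off the
  curve. The complements of the two closed regions would then be disjoint open sets that separate the
  complement of the curve.
\<close>

lemma faces_connected_off_curve:
  assumes con: "connectedin (realization K) (points K - curve z)"
    and F: "F \<subseteq> faces K" "F \<noteq> {}"
    and step: "\<And>f g p. f \<in> F \<Longrightarrow> g \<in> faces K \<Longrightarrow> p \<in> closed_face K f \<Longrightarrow> p \<in> closed_face K g \<Longrightarrow>
        p \<notin> curve z \<Longrightarrow> g \<in> F"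
  shows "F = faces K"
proof (rule ccontr)
  assume "F \<noteq> faces K"
  then obtain g where g: "g \<in> faces K" "g \<notin> F" using F(1) by blast
  obtain f where f: "f \<in> F" "f \<in> faces K" using F by blast
  let ?F' = "faces K - F"
  have cov: "p \<in> region_of F \<or> p \<in> region_of ?F'" if "p \<in> points K" for p
    using faces_cover that by (auto simp: region_of_def)
  have "points K - curve z \<subseteq> points K - region_of ?F' \<or> points K - curve z \<subseteq> points K - region_of F"
  proof (rule connectedin_in_one_part[OF con])
    show "openin (realization K) (points K - region_of ?F')"
      "openin (realization K) (points K - region_of F)"
      using F by (auto intro: openin_compl_region)
    show "(points K - region_of ?F') \<inter> (points K - region_of F) = {}" using cov by blast
    show "points K - curve z \<subseteq> (points K - region_of ?F') \<union> (points K - region_of F)"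
      using step F by (auto simp: region_of_def)
  qed
  moreover have "FPt f 0 \<in> points K - curve z" "FPt g 0 \<in> points K - curve z"
    using f g by (auto simp: points_def chain_points_FPt)
  moreover have "FPt f 0 \<in> region_of F" "FPt g 0 \<in> region_of ?F'"
    using f g FPt_closed_face[OF f(2), of f 0] FPt_closed_face[OF g(1), of g 0]
    unfolding region_of_def by auto
  ultimately show False by blast
qed

text \<open>
  Near a point of the curve the open face is a convex piece of the disc that stays in the annulus and
  misses the curve, so it lies in one half.
\<close>

lemma side_total:
  assumes f: "f \<in> faces K" and y: "norm y = 1" "face_map K f y \<in> curve z"
  shows "side_at P f y \<or> side_at M f y"
proof -
  obtain e where e: "e > 0" "\<forall>w\<in>cball 0 1. dist y w < e \<longrightarrow> face_map K f w \<in> curve z \<union> P \<union> M"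
    using open_preimage_near[OF f open_N, of y] y by auto
  define B where "B = ball y e \<inter> ball 0 1"
  have "FPt f w \<in> P \<union> M" if "w \<in> B" for w
    using e(2) that face_map_inner[of w f] chain_points_FPt[of f w "skel K" z] unfolding B_def by auto
  then have sub: "FPt f ` B \<subseteq> P \<union> M" by blast
  have "Topological_Spaces.connected B"
    unfolding B_def by (intro convex_connected convex_Int convex_ball)
  moreover have "B \<subseteq> cball 0 1" unfolding B_def using ball_subset_cball by blast
  ultimately have "connectedin (top_of_set (cball 0 1)) B"
    by (simp add: connectedin_subtopology)
  then have "connectedin (realization K) (face_map K f ` B)"
    by (rule connectedin_continuous_map_image[OF continuous_map_face_map[OF f]])
  moreover have "face_map K f ` B = FPt f ` B"
    by (rule image_cong) (auto simp: face_map_inner B_def)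
  ultimately have "FPt f ` B \<subseteq> P \<or> FPt f ` B \<subseteq> M"
    using connectedin_in_one_part[OF _ open_P open_M disj sub] by simp
  then show ?thesis using e(1) unfolding side_at_def B_def by blast
qed

text \<open>
  Lying in \<open>P\<close> and lying in \<open>M\<close> are open conditions on the boundary point, they exclude each other, and
  one of them holds all along a side on the curve. The parameter interval is connected.
\<close>

lemma side_constant:
  assumes Z: "Z \<in> {P, M}" and f: "f \<in> faces K" "i < gonality K f" and e: "edge_under K (bd K f ! i) \<in> z"
    and t: "t \<in> {0..1}" "u \<in> {0..1}"
    and s: "side_at Z f (rim (gonality K f) (real i + t))"
  shows "side_at Z f (rim (gonality K f) (real i + u))"
proof -
  let ?r = "\<lambda>t. rim (gonality K f) (real i + t)"
  define T where "T Z = {0..1} \<inter> ?r -` {y. side_at Z f y}" for Z :: "('v, 'd, 'f) point set"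
  have op: "openin (top_of_set {0..1}) (T Z)" for Z
    unfolding T_def
    by (intro continuous_openin_preimage_gen side_at_open continuous_on_rim continuous_intros)
  have onC: "face_map K f (?r t) \<in> curve z" if "t \<in> {0..1}" for t
  proof -
    have d: "bd K f ! i \<in> darts K" using f by simp
    have "dart_point (skel K) (bd K f ! i) t \<in> curve z"
      unfolding chain_points_def dart_point_edge[OF d] using that by (intro UN_I[OF e] imageI) auto
    then show ?thesis using face_map_rim[OF f that] by simp
  qed
  have cov: "T P \<union> T M = {0..1}"
  proof -
    have "side_at P f (?r t) \<or> side_at M f (?r t)" if "t \<in> {0..1}" for t
      by (rule side_total[OF f(1) norm_rim onC[OF that]])
    then show ?thesis unfolding T_def by blast
  qed
  have dis: "T P \<inter> T M = {}"
    using side_at_exclusive[OF norm_rim _ _ disj] by (auto simp: T_def)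
  have sub: "T Z \<subseteq> {0..1}" for Z by (auto simp: T_def)
  obtain Z' where Z': "T Z \<union> T Z' = {0..1}" "T Z \<inter> T Z' = {}"
    using Z cov dis by (metis Int_commute Un_commute empty_iff insert_iff)
  have "connectedin (top_of_set {0..1::real}) {0..1}" by (simp add: connectedin_subtopology)
  from connectedin_in_one_part[OF this op op Z'(2)] Z'(1)
  have "{0..1} \<subseteq> T Z \<or> {0..1} \<subseteq> T Z'" by simp
  moreover have "t \<in> T Z" using t(1) s by (simp add: T_def)
  ultimately have "{0..1} \<subseteq> T Z" using Z'(2) t(1) by blast
  then show ?thesis using t(2) by (auto simp: T_def)
qed

definition corner_on :: "('v, 'd, 'f) point set \<Rightarrow> 'f \<times> nat \<Rightarrow> bool" where
  "corner_on Z c \<longleftrightarrow> side_at Z (fst c) (rim (gonality K (fst c)) (real (snd c)))"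

lemma corner_rim:
  assumes "(f, i) \<in> corners K"
  shows "face_map K f (rim (gonality K f) (real i)) = VPt (corner_vertex K (f, i))"
  using assms face_map_rim[of f i 0] by (auto simp: corners_def corner_vertex_def)

lemma corner_on_total:
  assumes "c \<in> corners K" "VPt (corner_vertex K c) \<in> curve z"
  shows "corner_on P c \<or> corner_on M c"
proof -
  obtain f i where c: "c = (f, i)" "f \<in> faces K" using assms by (auto simp: corners_def)
  show ?thesis unfolding corner_on_def c fst_conv snd_conv
    using assms corner_rim[of f i] c by (intro side_total) auto
qed

lemma corner_on_next:
  assumes Z: "Z \<in> {P, M}" and f: "f \<in> faces K" "i < gonality K f"
    and e: "edge_under K (bd K f ! i) \<in> z"
  shows "corner_on Z (f, i) \<longleftrightarrow> corner_on Z (f, Suc i mod gonality K f)"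
proof -
  have "rim (gonality K f) (real (Suc i mod gonality K f)) = rim (gonality K f) (real i + 1)"
    using rim_Suc_mod[OF f, of 0] by simp
  then show ?thesis
    using side_constant[OF Z f e, of 0 1] side_constant[OF Z f e, of 1 0] by (auto simp: corner_on_def)
qed

text \<open>
  Otherwise all sides of the edge are in the other half, and the union of that half and the open edge
  is open. It is disjoint from \<open>Z\<close>, although \<open>Z\<close> accumulates at the edge.
\<close>

lemma edge_both_sides:
  assumes Z: "Z \<in> {P, M}" and e: "e \<in> z"
  shows "\<exists>f i. f \<in> faces K \<and> i < gonality K f \<and> edge_under K (bd K f ! i) = e \<and> corner_on Z (f, i)"
proof (rule ccontr)
  assume no: "\<not> ?thesis"
  have ed: "e \<in> edges K" using e z by blast
  obtain Z' where Z': "Z' \<in> {P, M}" "Z \<inter> Z' = {}" "Z = P \<and> Z' = M \<or> Z = M \<and> Z' = P"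
  proof (cases "Z = P")
    case True then show ?thesis using that[of M] disj by simp
  next
    case False then show ?thesis using that[of P] disj Z by (simp add: Int_commute)
  qed
  define J where "J = (EPt e ` {0<..<1} :: ('v, 'd, 'f) point set)"
  have JC: "J \<subseteq> curve z" using e by (auto simp: J_def chain_points_EPt)
  have oZ': "openin (realization K) Z'" using Z'(1) open_P open_M by auto
  have "openin (realization K) (Z' \<union> J)"
  proof (rule openin_realizationI)
    show "Z' \<union> J \<subseteq> points K"
    proof -
      have "J \<subseteq> points K" using ed by (auto simp: J_def points_def)
      then show ?thesis using openin_subset[OF oZ'] by simp
    qed
  next
    fix e' assume e': "e' \<in> edges K"
    have eq: "{t \<in> {0..1}. edge_point (skel K) e' t \<in> Z' \<union> J} =
       {t \<in> {0..1}. edge_point (skel K) e' t \<in> Z'} \<union> ({0..1} \<inter> (if e' = e then {0<..<1} else {}))"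
    proof -
      have "edge_point (skel K) e' t \<in> J \<longleftrightarrow> t \<in> (if e' = e then {0<..<1} else {})" if "t \<in> {0..1}" for t
        using that by (cases t rule: unit_interval_cases) (auto simp: J_def edge_point_inner)
      then show ?thesis by blast
    qed
    moreover have "openin (top_of_set {0..1}) {t \<in> {0..1}. edge_point (skel K) e' t \<in> Z'}"
      using oZ' e' by (simp add: openin_realization)
    moreover have "openin (top_of_set {0..1}) ({0..1} \<inter> (if e' = e then {0<..<1::real} else {}))"
      by (intro openin_open_Int) simp
    ultimately show "openin (top_of_set {0..1}) {t \<in> {0..1}. edge_point (skel K) e' t \<in> Z' \<union> J}"
      unfolding eq by (intro openin_Un)
  next
    fix f assume f: "f \<in> faces K"
    have "openin (top_of_set (cball 0 1)) {x \<in> cball 0 1. face_map K f x \<in> Z'}"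
      using oZ' f by (simp add: openin_realization)
    then obtain O' where O': "open O'" "{x \<in> cball 0 1. face_map K f x \<in> Z'} = cball 0 1 \<inter> O'"
      by (auto simp: openin_open)
    have "FPt f y \<in> Z' \<union> J \<longleftrightarrow> y \<in> O'" if "y \<in> ball 0 1" for y
    proof -
      have y: "y \<in> cball 0 1" "face_map K f y = FPt f y" using that by (auto simp: face_map_inner)
      have "y \<in> {x \<in> cball 0 1. face_map K f x \<in> Z'} \<longleftrightarrow> y \<in> cball 0 1 \<inter> O'" using O'(2) by simp
      then have "FPt f y \<in> Z' \<longleftrightarrow> y \<in> O'" using y by simp
      moreover have "FPt f y \<notin> J" by (auto simp: J_def)
      ultimately show ?thesis by blast
    qed
    then have "{y \<in> ball 0 1. FPt f y \<in> Z' \<union> J} = ball 0 1 \<inter> O'" by blast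
    then show "open {y \<in> ball 0 1. FPt f y \<in> Z' \<union> J}" using O'(1) by (metis open_Int open_ball)
  next
    fix f y assume f: "f \<in> faces K" and y: "norm y = 1" "face_map K f y \<in> Z' \<union> J"
    have "side_at Z' f y"
    proof (cases "face_map K f y \<in> Z'")
      case True then show ?thesis using side_at_openin[OF f oZ' _ y(1)] by blast
    next
      case False
      obtain i t where it: "i < gonality K f" "0 \<le> t" "t < 1" "y = rim (gonality K f) (real i + t)"
        "face_map K f y = dart_point (skel K) (bd K f ! i) t"
        using rim_pointE[OF f y(1)] by blast
      obtain t' where "face_map K f y = EPt e t'" using False y(2) by (auto simp: J_def)
      then have ei: "edge_under K (bd K f ! i) = e"
        using it f by (auto simp: dart_point_edge edge_point_def split: if_splits)
      have tt: "t \<in> {0..1}" using it(2,3) by simp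
      have "side_at P f y \<or> side_at M f y" using side_total[OF f y(1)] False y(2) JC by blast
      moreover have "\<not> side_at Z f y"
      proof
        assume "side_at Z f y"
        then have "side_at Z f (rim (gonality K f) (real i + 0))"
          unfolding it(4) using side_constant[OF Z f it(1) _ tt, of 0] ei e by simp
        then show False using no f it(1) ei by (auto simp: corner_on_def)
      qed
      ultimately show ?thesis using Z'(3) by blast
    qed
    then show "\<exists>\<epsilon>>0. \<forall>w\<in>ball y \<epsilon> \<inter> ball 0 1. FPt f w \<in> Z' \<union> J"
      unfolding side_at_def by blast
  qed
  note op = this
  have "EPt e (1/2) \<in> J" by (auto simp: J_def)
  then have p: "EPt e (1/2) \<in> curve z" "EPt e (1/2) \<in> Z' \<union> J" using JC by blast+
  obtain H where H: "H \<noteq> {}" "H \<subseteq> (Z' \<union> J) \<inter> Z"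
    using two_sided_local[OF Z p(1) op p(2)] by metis
  then obtain q where "q \<in> H" by blast
  then have "q \<in> Z" "q \<in> J" using H(2) Z'(2) by blast+
  then have "q \<in> curve z" "q \<in> P \<union> M" using JC Z by blast+
  then show False using disjC by blast
qed

lemma edge_side_ends:
  assumes Z: "Z \<in> {P, M}" and e: "e \<in> z"
  obtains f i j where "f \<in> faces K" "i < gonality K f" "j = Suc i mod gonality K f"
    "edge_under K (bd K f ! i) = e" "corner_on Z (f, i)" "corner_on Z (f, j)"
    "(f, i) \<in> corners K" "(f, j) \<in> corners K"
    "corner_vertex K (f, i) = src K (bd K f ! i)" "corner_vertex K (f, j) = tgt K (bd K f ! i)"
proof -
  obtain f i where fi: "f \<in> faces K" "i < gonality K f" "edge_under K (bd K f ! i) = e" "corner_on Z (f, i)"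
    using edge_both_sides[OF Z e] by blast
  show ?thesis
    using that[OF fi(1,2) refl fi(3,4)] corner_on_next[OF Z fi(1,2)] fi e gonality_pos[OF fi(1)]
      bd_consecutive[OF fi(1,2)] by (simp add: corners_def corner_vertex_def)
qed

text \<open>
  The corners at \<open>x\<close> that lie on one side form a chain in which neighbors share an edge off the curve.
  The reason is local: fans over \<open>T\<close> and over the remaining corners are disjoint open sets, and together
  they contain a punctured neighborhood of \<open>x\<close> minus the curve. Since the half \<open>Z\<close> is connected near \<open>x\<close>, it
  meets only one of the fans.
\<close>

lemma corners_on_one_side:
  assumes Z: "Z \<in> {P, M}" and x: "VPt x \<in> curve z"
    and T: "T \<subseteq> {c \<in> corners K. corner_vertex K c = x}"
    and closed: "\<And>c c' s s'. c \<in> T \<Longrightarrow> c' \<in> corners K \<Longrightarrow> flank K c' s' = flank K c s \<Longrightarrow>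
        edge_under K (flank K c s) \<notin> z \<Longrightarrow> c' \<in> T"
    and c: "c \<in> T" "corner_on Z c"
    and c': "c' \<in> corners K" "corner_vertex K c' = x" "corner_on Z c'"
  shows "c' \<in> T"
proof (rule ccontr)
  assume nc': "c' \<notin> T"
  define R where "R = {c \<in> corners K. corner_vertex K c = x}"
  define E where "E T = {flank K c s | c s. c \<in> T \<and> edge_under K (flank K c s) \<notin> z}" for T
  define T' where "T' = R - T"
  have TR: "T \<subseteq> R" "T' \<subseteq> R" using T by (auto simp: R_def T'_def)
  have xn: "x \<in> nodes K" using c'(1,2) flank_dart[OF c'(1), of True] src_node by metis
  have ER: "E Q \<subseteq> {d \<in> darts K. src K d = x}" if "Q \<subseteq> R" for Q
    using that flank_dart by (auto simp: E_def R_def)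
  have ED: "E Q \<subseteq> darts K" if "Q \<subseteq> R" for Q using ER[OF that] by blast
  have opT: "openin (realization K) (fan T (E T) {})"
  proof (rule openin_fan[OF T ER[OF TR(1)]])
    fix c s assume c: "c \<in> corners K" "flank K c s \<in> E T"
    then obtain c1 s1 where "c1 \<in> T" "flank K c s = flank K c1 s1" "edge_under K (flank K c1 s1) \<notin> z"
      unfolding E_def by blast
    then show "c \<in> T" using closed[of c1 c s s1] c(1) by blast
  qed simp
  have opT': "openin (realization K) (fan T' (E T') {})"
  proof (rule openin_fan[OF _ ER[OF TR(2)]])
    fix c s assume c: "c \<in> corners K" "corner_vertex K c = x" "flank K c s \<in> E T'"
    then obtain c1 s1 where c1: "c1 \<in> T'" "flank K c s = flank K c1 s1" "edge_under K (flank K c1 s1) \<notin> z"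
      unfolding E_def by blast
    have "c \<notin> T"
    proof
      assume "c \<in> T"
      then have "c1 \<in> T" using closed[of c c1 s1 s] c1 by (auto simp: T'_def R_def)
      then show False using c1(1) by (simp add: T'_def)
    qed
    then show "c \<in> T'" using c by (simp add: T'_def R_def)
  qed (use TR in \<open>auto simp: R_def\<close>)
  define D where "D = {d \<in> darts K. src K d = x}"
  have DD: "D \<subseteq> darts K" by (auto simp: D_def)
  have opR: "openin (realization K) (fan R D {VPt x})"
    by (rule openin_fan) (auto simp: R_def D_def xn)
  obtain H V where H: "connectedin (realization K) H" "H \<subseteq> fan R D {VPt x} \<inter> Z"
    "openin (realization K) V" "VPt x \<in> V" "V \<inter> Z \<subseteq> H"
  proof -
    have "VPt x \<in> fan R D {VPt x}" by (simp add: fan_def)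
    from two_sided_local[OF Z x opR this] show ?thesis using that by metis
  qed
  have fanT: "FPt f w \<in> fan T (E T) {} \<longleftrightarrow> norm w < 1 \<and> (\<exists>i. (f, i) \<in> T \<and> w \<in> sector (gonality K f) i)"
    and fanT': "FPt f w \<in> fan T' (E T') {} \<longleftrightarrow> norm w < 1 \<and> (\<exists>i. (f, i) \<in> T' \<and> w \<in> sector (gonality K f) i)"
    and fanR: "FPt f w \<in> fan R D {VPt x} \<longleftrightarrow> norm w < 1 \<and> (\<exists>i. (f, i) \<in> R \<and> w \<in> sector (gonality K f) i)"
    for f w
    by (rule FPt_fan[OF ED[OF TR(1)] empty_subsetI] FPt_fan[OF ED[OF TR(2)] empty_subsetI]
        FPt_fan[OF DD order_refl])+
  have HC: "p \<notin> curve z" if "p \<in> H" for p using that H(2) Z disjC by auto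
  have "fan T (E T) {} \<inter> fan T' (E T') {} = {}"
  proof -
    have False if p: "p \<in> fan T (E T) {}" "p \<in> fan T' (E T') {}" for p
    proof (cases p)
      case (VPt y)
      then have "VPt y \<in> fan T (E T) {}" using p(1) by simp
      then show False using VPt_fan[OF ED[OF TR(1)], of y T "{}"] by simp
    next
      case (FPt f w)
      obtain i j where ij: "(f, i) \<in> T" "(f, j) \<in> T'" "w \<in> sector (gonality K f) i" "w \<in> sector (gonality K f) j"
        using p unfolding FPt fanT fanT' by blast
      have "(f, i) \<in> corners K" "(f, j) \<in> corners K" using ij TR by (auto simp: R_def)
      then have "i = j" using ij(3,4) gonality_pos by (intro sector_disjoint[of "gonality K f"]) (auto simp: corners_def)
      then show False using ij by (simp add: T'_def)
    next
      case (EPt e t)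
      obtain d u where d: "d \<in> E T" "0 < u" "u < 1 / 3" "p = dart_point (skel K) d u"
        using p(1) unfolding fan_def EPt by auto
      obtain d' u' where d': "d' \<in> E T'" "0 < u'" "u' < 1 / 3" "p = dart_point (skel K) d' u'"
        using p(2) unfolding fan_def EPt by auto
      have "d \<in> darts K" "d' \<in> darts K" using d(1) d'(1) ED TR by blast+
      then have "d' = d" using dart_point_eq_iff[of d d' u u'] d d' by auto
      then obtain c1 s1 c2 s2 where "c1 \<in> T" "c2 \<in> T'" "flank K c2 s2 = flank K c1 s1" "edge_under K (flank K c1 s1) \<notin> z"
        using d(1) d'(1) unfolding E_def by blast
      then show False using closed[of c1 c2 s2 s1] by (auto simp: T'_def R_def)
    qed
    then show ?thesis by blast
  qed
  moreover have "H \<subseteq> fan T (E T) {} \<union> fan T' (E T') {}"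
  proof
    fix p assume p: "p \<in> H"
    then have pf: "p \<in> fan R D {VPt x}" using H(2) by blast
    show "p \<in> fan T (E T) {} \<union> fan T' (E T') {}"
    proof (cases p)
      case (VPt y)
      then have "VPt y \<in> fan R D {VPt x}" using pf by simp
      then have "y = x" using VPt_fan[OF DD, of y R "{VPt x}"] by simp
      then show ?thesis using VPt HC[OF p] x by simp
    next
      case (FPt f w)
      obtain i where "(f, i) \<in> R" "w \<in> sector (gonality K f) i" "norm w < 1"
        using pf unfolding FPt fanR by blast
      moreover then have "(f, i) \<in> T \<or> (f, i) \<in> T'" by (simp add: T'_def)
      ultimately show ?thesis unfolding FPt Un_iff fanT fanT' by blast
    next
      case (EPt e t)
      obtain d u where d: "d \<in> D" "0 < u" "u < 1 / 3" "p = dart_point (skel K) d u"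
        using pf unfolding fan_def EPt by auto
      have dd: "d \<in> darts K" "src K d = x" using d(1) by (auto simp: D_def)
      have dz: "edge_under K d \<notin> z"
        using HC[OF p] d dart_point_on_curve[OF dd(1), of u] by simp
      obtain c s where cs: "c \<in> corners K" "flank K c s = d" using dart_has_flank[OF dd(1)] by blast
      then have "c \<in> R" using flank_dart(2)[OF cs(1)] dd(2) by (auto simp: R_def)
      then have "d \<in> E T \<or> d \<in> E T'" using cs dz unfolding E_def T'_def by blast
      then show ?thesis using d unfolding fan_def by blast
    qed
  qed
  ultimately have one: "H \<subseteq> fan T (E T) {} \<or> H \<subseteq> fan T' (E T') {}"
    using connectedin_in_one_part[OF H(1) opT opT'] by blast
  \<comment> \<open>A corner on side \<open>Z\<close> has points of its sector in \<open>H\<close>, so \<open>H\<close> meets the fan over each set containing it.\<close>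
  have meet: "\<exists>p. p \<in> H \<and> p \<in> fan Q (E Q) {}" if Q: "Q \<subseteq> R" and q: "q \<in> Q" "corner_on Z q" for Q q
  proof -
    obtain f i where fi: "q = (f, i)" "f \<in> faces K" "i < gonality K f" "corner_vertex K (f, i) = x"
      using Q q(1) by (auto simp: R_def corners_def)
    let ?y = "rim (gonality K f) (real i)"
    have "face_map K f ?y = VPt x" using corner_rim[of f i] fi by (simp add: corners_def)
    then have "side_at V f ?y" using side_at_openin[OF fi(2) H(3) _ norm_rim] H(4) by metis
    then obtain e where e: "e > 0" "\<forall>w\<in>ball ?y e \<inter> ball 0 1. FPt f w \<in> V" by (auto simp: side_at_def)
    have "side_at Z f ?y" using q(2) by (simp add: corner_on_def fi(1))
    moreover have "?y \<in> sector (gonality K f) i"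
      using rim_in_sector[OF gonality_pos[OF fi(2)], of 0 i] by simp
    ultimately obtain w where w: "w \<in> ball ?y e \<inter> sector (gonality K f) i \<inter> ball 0 1" "FPt f w \<in> Z"
      using side_at_common_point[OF norm_rim, of Z f "gonality K f" "real i" "ball ?y e \<inter> sector (gonality K f) i"]
        e(1) open_sector by (metis IntI centre_in_ball open_Int open_ball)
    then have "FPt f w \<in> H" using e(2) H(5) by blast
    moreover have "FPt f w \<in> fan Q (E Q) {}"
      using w(1) q(1) unfolding fi(1) FPt_fan[OF ED[OF Q] empty_subsetI] by auto
    ultimately show ?thesis by blast
  qed
  have "c' \<in> T'" using c' nc' by (simp add: T'_def R_def)
  then show False
    using one meet[OF TR(1) c] meet[OF TR(2) _ c'(3)] \<open>fan T (E T) {} \<inter> fan T' (E T') {} = {}\<close> by blast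
qed

end

section \<open>The derived complex\<close>

lemma cas_concat_replicate:
  assumes "pre_digraph.cas H u p u"
  shows "pre_digraph.cas H u (concat (replicate k p)) u"
proof -
  interpret pre_digraph H .
  have app: "cas a (q @ r) c" if "cas a q b" "cas b r c" for a b c q r
    using that by (induction q arbitrary: a) auto
  show ?thesis
  proof (induction k)
    case (Suc k)
    show ?case using app[OF assms Suc.IH] by (simp only: replicate_Suc concat.simps)
  qed simp
qed

locale derived_embedding = polygonal K
  for K :: "('v, 'd, 'f) cell_complex" +
  fixes A :: "('a, 'm) monoid_scheme" and \<alpha> :: "'d \<Rightarrow> 'a"
  assumes group: "group A" and finite_group: "finite (carrier A)"
    and voltage: "voltage_assignment A (skel K) \<alpha>"
begin

sublocale A: group A by (rule group)

text \<open>
  The name of the derived complex also serves as prefix for the facts about it as a polygonal complex.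
\<close>

abbreviation D :: "('v \<times> 'a, 'd \<times> 'a, 'f \<times> 'a set) cell_complex" where
  "D \<equiv> derived_complex A \<alpha> K"

abbreviation times (infixl "\<odot>" 70) where "a \<odot> b \<equiv> a \<otimes>\<^bsub>A\<^esub> b"

abbreviation boundary_voltage :: "'f \<Rightarrow> 'a" where
  "boundary_voltage f \<equiv> net_voltage A \<alpha> (bd K f)"

text \<open>
  The order of ramification: a face over \<open>f\<close> runs this many times around the boundary of \<open>f\<close>.
\<close>

definition turns :: "'f \<Rightarrow> nat" where
  "turns f = A.ord (boundary_voltage f)"

lemma voltage_closed [simp]: "d \<in> darts K \<Longrightarrow> \<alpha> d \<in> carrier A"
  and voltage_flip: "d \<in> darts K \<Longrightarrow> \<alpha> (flip K d) = inv\<^bsub>A\<^esub> \<alpha> d"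
  using voltage by (auto simp: voltage_assignment_def)

lemma bd_voltages: "f \<in> faces K \<Longrightarrow> \<forall>d\<in>set (bd K f). \<alpha> d \<in> carrier A"
  by (metis in_set_conv_nth bd_dart voltage_closed)

lemma boundary_voltage_closed: "f \<in> faces K \<Longrightarrow> boundary_voltage f \<in> carrier A"
  by (rule A.net_voltage_closed[OF bd_voltages])

lemma turns_pos: "f \<in> faces K \<Longrightarrow> 0 < turns f"
  using A.ord_ge_1[OF finite_group boundary_voltage_closed, of f] by (simp add: turns_def)

lemma skel_D: "skel D = derived_graph A \<alpha> (skel K)"
  by (simp add: derived_complex_def)

lemma nodes_D [simp]: "nodes D = nodes K \<times> carrier A"
  and darts_D [simp]: "darts D = darts K \<times> carrier A"
  and edges_D [simp]: "edges D = edges K \<times> carrier A"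
  and src_D [simp]: "src D (d, a) = (src K d, a)"
  and tgt_D [simp]: "tgt D (d, a) = (tgt K d, a \<odot> \<alpha> d)"
  and flip_D [simp]: "flip D (d, a) = (flip K d, a \<odot> \<alpha> d)"
  by (simp_all add: skel_D derived_graph_def)

lemma face_D: "F \<in> faces D \<longleftrightarrow>
    (\<exists>f a. f \<in> faces K \<and> a \<in> carrier A \<and> F = (f, a <#\<^bsub>A\<^esub> generate A {boundary_voltage f}))"
  by (auto simp: derived_complex_def)

lemma bd_D: "bd D (f, C) =
    lift_walk A \<alpha> (SOME a. a \<in> C) (concat (replicate (turns f) (bd K f)))"
  by (simp add: derived_complex_def turns_def)

lemma gonality_D: "gonality D F = turns (fst F) * gonality K (fst F)"
  by (cases F) (simp add: bd_D)

text \<open>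
  The boundary walk of a derived face starts at a chosen element of its coset; as cosets are nonempty,
  the choice is a group element.
\<close>

lemma coset_base:
  assumes F: "(f, C) \<in> faces D" shows "f \<in> faces K" "(SOME a. a \<in> C) \<in> carrier A"
proof -
  obtain a where a: "f \<in> faces K" "a \<in> carrier A" "C = a <#\<^bsub>A\<^esub> generate A {boundary_voltage f}"
    using F by (auto simp: face_D)
  show "f \<in> faces K" by (rule a(1))
  have sub: "subgroup (generate A {boundary_voltage f}) A"
    using boundary_voltage_closed[OF a(1)] by (intro A.generate_is_subgroup) auto
  have "a \<in> C" using A.in_own_l_coset[OF a(2) sub] a(3) by simp
  then have "(SOME a. a \<in> C) \<in> C" by (rule someI)
  moreover have "C \<subseteq> carrier A" unfolding a(3) l_coset_def using a(2) subgroup.subset[OF sub] by auto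
  ultimately show "(SOME a. a \<in> C) \<in> carrier A" by blast
qed

lemma cas_lift:
  assumes "pre_digraph.cas (dg (skel K)) u p w" "\<forall>d\<in>set p. \<alpha> d \<in> carrier A" "a \<in> carrier A"
  shows "pre_digraph.cas (dg (skel D)) (u, a) (lift_walk A \<alpha> a p) (w, a \<odot> net_voltage A \<alpha> p)"
  using assms
proof (induction p arbitrary: u a)
  case Nil
  then show ?case by (simp add: pre_digraph.cas.simps net_voltage_def)
next
  case (Cons d p)
  have "net_voltage A \<alpha> p \<in> carrier A" using Cons.prems by (intro A.net_voltage_closed) auto
  moreover have "net_voltage A \<alpha> (d # p) = \<alpha> d \<odot> net_voltage A \<alpha> p" by (simp add: net_voltage_def)
  ultimately show ?case
    using Cons.IH[of "tgt K d" "a \<odot> \<alpha> d"] Cons.prems by (simp add: pre_digraph.cas.simps A.m_assoc)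
qed

lemma set_lift_walk:
  "\<forall>d\<in>set p. \<alpha> d \<in> carrier A \<Longrightarrow> a \<in> carrier A \<Longrightarrow> set (lift_walk A \<alpha> a p) \<subseteq> set p \<times> carrier A"
proof (induction p arbitrary: a)
  case (Cons d p)
  then show ?case using Cons.IH[of "a \<odot> \<alpha> d"] by auto
qed simp

text \<open>
  Going around \<open>f\<close> as often as the order of its net voltage gives total voltage \<open>1\<close>, so the lifted walk
  closes up.
\<close>

lemma walk_bd_D:
  assumes F: "F \<in> faces D" shows "bd D F \<noteq> []" "\<exists>u. walk (skel D) u (bd D F) u"
proof -
  obtain f C where FC: "F = (f, C)" by (cases F)
  note f = coset_base[OF F[unfolded FC]]
  define a where "a = (SOME a. a \<in> C)"
  define q where "q = concat (replicate (turns f) (bd K f))"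
  have a: "a \<in> carrier A" using f(2) by (simp add: a_def)
  show "bd D F \<noteq> []"
    using gonality_D[of F] turns_pos[OF f(1)] gonality_pos[OF f(1)] unfolding FC by fastforce
  obtain u where u: "pre_digraph.awalk (dg (skel K)) u (bd K f) u"
    using polygonal f(1) unfolding polygonal_complex_def walk_def by blast
  then have un: "u \<in> nodes K" and ud: "set (bd K f) \<subseteq> darts K"
    and uc: "pre_digraph.cas (dg (skel K)) u (bd K f) u"
    by (auto simp: pre_digraph.awalk_def)
  have qv: "\<forall>d\<in>set q. \<alpha> d \<in> carrier A" using bd_voltages[OF f(1)] by (auto simp: q_def)
  have "net_voltage A \<alpha> q = boundary_voltage f [^]\<^bsub>A\<^esub> turns f"
    unfolding q_def by (rule A.net_voltage_concat_replicate[OF bd_voltages[OF f(1)]])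
  also have "\<dots> = \<one>\<^bsub>A\<^esub>"
    unfolding turns_def by (rule A.pow_ord_eq_1[OF boundary_voltage_closed[OF f(1)]])
  finally have "a \<odot> net_voltage A \<alpha> q = a" using a by simp
  then have "pre_digraph.cas (dg (skel D)) (u, a) (lift_walk A \<alpha> a q) (u, a)"
    using cas_lift[OF cas_concat_replicate[OF uc, of "turns f", folded q_def] qv a] by simp
  moreover have "set (lift_walk A \<alpha> a q) \<subseteq> darts D"
  proof -
    have "set q \<subseteq> set (bd K f)" by (auto simp: q_def)
    then show ?thesis using set_lift_walk[OF qv a] ud by auto
  qed
  ultimately have "walk (skel D) (u, a) (bd D F) (u, a)"
    unfolding walk_def pre_digraph.awalk_def FC bd_D a_def[symmetric] q_def[symmetric]
    using un a by simp
  then show "\<exists>u. walk (skel D) u (bd D F) u" by blast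
qed

lemma polygonal_D: "polygonal_complex D"
  unfolding polygonal_complex_def
proof (intro conjI ballI)
  have "wf_digraph (dg (skel D))" by unfold_locales auto
  moreover have "finite (nodes K)" "finite (darts K)"
    using fin_digraph by (auto simp: fin_digraph_def fin_digraph_axioms_def)
  ultimately have fd: "fin_digraph (dg (skel D))"
    by (simp add: fin_digraph_def fin_digraph_axioms_def finite_group)
  interpret wf_digraph "dg (skel D)" by fact
  show "multigraph (skel D)" unfolding multigraph_def
  proof (intro conjI ballI fd)
    have neq: "flip K d \<noteq> d" if "d \<in> darts K" for d using flip_edge[OF that] by metis
    show "bidirected_digraph (dg (skel D)) (\<lambda>d. if d \<in> darts D then flip D d else d)"
      by (rule bidirected_digraphI) (auto simp: neq voltage_flip A.m_assoc)
    show "edges D \<subseteq> darts D" using edges_darts by auto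
    fix d assume "d \<in> darts D"
    then show "d \<in> edges D \<longleftrightarrow> flip D d \<notin> edges D" using flip_edge by (cases d) auto
  qed
  have "faces D \<subseteq> (\<lambda>(f, a). (f, a <#\<^bsub>A\<^esub> generate A {boundary_voltage f})) ` (faces K \<times> carrier A)"
    by (auto simp: derived_complex_def)
  then show "finite (faces D)"
    using finite_faces finite_group by (meson finite_SigmaI finite_imageI finite_subset)
qed (use walk_bd_D in auto)

sublocale D: polygonal D by unfold_locales (rule polygonal_D)

lemma bd_D_nth:
  assumes F: "F \<in> faces D" and j: "j < gonality D F"
  shows "fst F \<in> faces K" "fst (bd D F ! j) = bd K (fst F) ! (j mod gonality K (fst F))"
proof -
  obtain f C where FC: "F = (f, C)" by (cases F)
  note f = coset_base[OF F[unfolded FC]]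
  show "fst F \<in> faces K" using f(1) FC by simp
  have "\<forall>d\<in>set (concat (replicate (turns f) (bd K f))). \<alpha> d \<in> carrier A"
    using bd_voltages[OF f(1)] by auto
  from A.nth_lift_walk[OF this f(2)]
  show "fst (bd D F ! j) = bd K (fst F) ! (j mod gonality K (fst F))"
    using j A.nth_concat_replicate[of j "turns f" "bd K f"] unfolding FC bd_D by simp
qed

text \<open>
  The index of a corner of a derived face counts all turns around the face below; the projection only
  keeps the position within one turn.
\<close>

definition below :: "('f \<times> 'a set) \<times> nat \<Rightarrow> 'f \<times> nat" where
  "below k = (fst (fst k), snd k mod gonality K (fst (fst k)))"

abbreviation over :: "'f \<times> nat \<Rightarrow> 'a \<Rightarrow> ('f \<times> 'a set) \<times> nat" where
  "over \<equiv> corner_over A \<alpha> K"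

lemma below_corner: "k \<in> corners D \<Longrightarrow> below k \<in> corners K"
  using bd_D_nth gonality_pos by (fastforce simp: corners_def below_def)

text \<open>
  These are the three properties by which the lift of a corner is characterized; existence and
  uniqueness hold because each coset is swept exactly once by the turns of the boundary walk.
\<close>

lemma over_props:
  assumes "c \<in> corners K" "b \<in> carrier A"
  shows "over c b \<in> corners D" "corner_vertex D (over c b) = (corner_vertex K c, b)" "below (over c b) = c"
proof -
  have "over c b \<in> corners D \<and> corner_vertex D (over c b) = (corner_vertex K c, b) \<and>
             fst (fst (over c b)) = fst c \<and> snd (over c b) mod gonality K (fst c) = snd c"
    unfolding corner_over_def
    by (rule theI'[OF corner_over_unique[OF group finite_group polygonal voltage assms]])
  then show "over c b \<in> corners D" "corner_vertex D (over c b) = (corner_vertex K c, b)" "below (over c b) = c"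
    by (auto simp: below_def prod_eq_iff)
qed

lemma over_unique:
  assumes "k \<in> corners D" "corner_vertex D k = (corner_vertex K c, b)" "below k = c" "b \<in> carrier A"
  shows "k = over c b"
proof -
  have c: "c \<in> corners K" using below_corner assms by blast
  have "fst (fst k) = fst c" "snd k mod gonality K (fst c) = snd c"
    using assms(3) by (auto simp: below_def)
  then show ?thesis
    using corner_over_unique[OF group finite_group polygonal voltage c assms(4)] assms
      over_props[OF c assms(4)] unfolding below_def by (metis fst_conv snd_conv)
qed

lemma corner_vertex_D:
  assumes "k \<in> corners D"
  shows "fst (corner_vertex D k) = corner_vertex K (below k)" "snd (corner_vertex D k) \<in> carrier A"
proof -
  obtain F j where k: "k = (F, j)" "F \<in> faces D" "j < gonality D F"
    using assms by (auto simp: corners_def)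
  have d: "bd D F ! j \<in> darts D" using D.bd_dart k by blast
  obtain e b where e: "bd D F ! j = (e, b)" by (cases "bd D F ! j")
  then have "e = bd K (fst F) ! (j mod gonality K (fst F))" using bd_D_nth(2)[OF k(2,3)] by simp
  then show "fst (corner_vertex D k) = corner_vertex K (below k)" "snd (corner_vertex D k) \<in> carrier A"
    using e d by (auto simp: k corner_vertex_def below_def)
qed

lemma over_below: "k \<in> corners D \<Longrightarrow> over (below k) (snd (corner_vertex D k)) = k"
  using over_unique[of k "below k" "snd (corner_vertex D k)"] corner_vertex_D[of k]
  by (simp add: prod_eq_iff)

text \<open>
  The second component is forced: a flanking dart starts at the vertex of the corner. The first one
  follows from the index arithmetic \<open>j - 1\<close> modulo the length of the long and of the short boundary walk.
\<close>

lemma flank_D: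
  assumes k: "k \<in> corners D"
  shows "flank D k s = (flank K (below k) s, snd (corner_vertex D k))"
proof -
  obtain F j where Fj: "k = (F, j)" "F \<in> faces D" "j < gonality D F"
    using k by (auto simp: corners_def)
  let ?f = "fst F" and ?n = "gonality K (fst F)"
  note f = bd_D_nth(1)[OF Fj(2,3)]
  have "src D (flank D k s) = corner_vertex D k" using D.flank_dart[OF k] by blast
  then have "snd (flank D k s) = snd (corner_vertex D k)"
    by (cases "flank D k s") (metis snd_conv src_D)
  moreover have "fst (flank D k s) = flank K (below k) s"
  proof (cases s)
    case True
    then show ?thesis using bd_D_nth(2)[OF Fj(2,3)] unfolding Fj(1) below_def by simp
  next
    case False
    let ?p = "D.prev F j"
    have p: "?p < gonality D F" by (rule D.prev_less[OF Fj(2)])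
    have n: "0 < ?n" "0 < turns ?f" using gonality_pos[OF f] turns_pos[OF f] by auto
    \<comment> \<open>Since \<open>j\<close> may be \<open>0\<close>, one full turn of the long walk is split off before reducing modulo the short one.\<close>
    have e1: "j + gonality D F - 1 = (j + (?n - 1)) + (turns ?f - 1) * ?n"
    proof -
      have "turns ?f * ?n = ?n + (turns ?f - 1) * ?n"
        using n(2) by (metis Suc_diff_1 mult_Suc)
      then show ?thesis unfolding gonality_D using n(1) by arith
    qed
    have "?p mod ?n = (j + gonality D F - 1) mod ?n"
      unfolding D.prev_def gonality_D by (rule mod_mod_cancel) simp
    also have "\<dots> = (j + (?n - 1)) mod ?n" unfolding e1 by (rule mod_mult_self1)
    also have "\<dots> = (j mod ?n + (?n - 1)) mod ?n" by (simp add: mod_add_left_eq)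
    also have "\<dots> = prev ?f (j mod ?n)"
    proof -
      have "j mod ?n + (?n - 1) = j mod ?n + ?n - 1" using n(1) by arith
      then show ?thesis unfolding prev_def by simp
    qed
    finally have pm: "?p mod ?n = prev ?f (j mod ?n)" .
    have "fst (flank D k s) = flip K (fst (bd D F ! ?p))"
      using False unfolding Fj(1) by (cases "bd D F ! ?p") (simp add: D.flank_False)
    also have "\<dots> = flip K (bd K ?f ! prev ?f (j mod ?n))"
      using bd_D_nth(2)[OF Fj(2) p] pm by simp
    finally show ?thesis using False unfolding Fj(1) below_def by (simp add: flank_False)
  qed
  ultimately show ?thesis by (simp add: prod_eq_iff)
qed

lemma edge_under_D:
  assumes "d \<in> darts K" "b \<in> carrier A"
  shows "fst (edge_under D (d, b)) = edge_under K d" "edge_under D (d, b) \<in> edges D"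
    "e \<in> edges K \<Longrightarrow> a \<in> carrier A \<Longrightarrow> d = flip K e \<Longrightarrow> b = a \<odot> \<alpha> e \<Longrightarrow> edge_under D (d, b) = (e, a)"
proof -
  show "fst (edge_under D (d, b)) = edge_under K d"
    using assms by (auto simp: under_edge_def)
  show "edge_under D (d, b) \<in> edges D" using assms by (intro D.edge_under_edge) simp
  assume "e \<in> edges K" "a \<in> carrier A" "d = flip K e" "b = a \<odot> \<alpha> e"
  then show "edge_under D (d, b) = (e, a)"
    using edges_darts[of e] flip_edge[of e] by (auto simp: under_edge_def voltage_flip A.m_assoc)
qed

text \<open>
  Following the boundary walk of a derived face by one dart leads to the next corner of the same face,
  and multiplies the group element by the voltage of that dart.
\<close>

lemma over_next:
  assumes f: "f \<in> faces K" "i < gonality K f" and b: "b \<in> carrier A"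
  shows "fst (over (f, Suc i mod gonality K f) (b \<odot> \<alpha> (bd K f ! i))) = fst (over (f, i) b)"
proof -
  have c: "(f, i) \<in> corners K" using f by (simp add: corners_def)
  obtain F j where k: "over (f, i) b = (F, j)" by (cases "over (f, i) b")
  note o = over_props[OF c b, unfolded k]
  have F: "F \<in> faces D" "j < gonality D F" using o(1) by (auto simp: corners_def)
  have fF: "fst F = f" "j mod gonality K f = i" using o(3) by (auto simp: below_def)
  have bdj: "bd D F ! j = (bd K f ! i, b)"
    using flank_D[OF o(1), of True] o(2,3) by simp
  let ?j = "Suc j mod gonality D F"
  have k': "(F, ?j) \<in> corners D" using F by (auto simp: corners_def intro!: mod_less_divisor D.gonality_pos)
  have "corner_vertex D (F, ?j) = tgt D (bd D F ! j)"
    using D.bd_consecutive[OF F] by (simp add: corner_vertex_def)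
  also have "\<dots> = (tgt K (bd K f ! i), b \<odot> \<alpha> (bd K f ! i))" by (simp add: bdj)
  also have "tgt K (bd K f ! i) = corner_vertex K (f, Suc i mod gonality K f)"
    using bd_consecutive[OF f] by (simp add: corner_vertex_def)
  finally have v: "corner_vertex D (F, ?j) = (corner_vertex K (f, Suc i mod gonality K f), b \<odot> \<alpha> (bd K f ! i))" .
  have "?j mod gonality K f = Suc j mod gonality K f"
    unfolding gonality_D fF(1) by (rule mod_mod_cancel) simp
  also have "\<dots> = Suc i mod gonality K f" using fF(2) by (metis mod_Suc_eq)
  finally have "below (F, ?j) = (f, Suc i mod gonality K f)" by (simp add: below_def fF(1))
  from over_unique[OF k' v this] show ?thesis using b f k by (metis A.m_closed bd_dart fst_conv voltage_closed)
qed

text \<open>Vertices and edges of the derived complex inherit an incident face from below.\<close>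

lemma D_covered:
  assumes side: "\<And>e. e \<in> edges K \<Longrightarrow> \<exists>f\<in>faces K. has_side K f e"
    and corner: "\<And>x. x \<in> nodes K \<Longrightarrow> \<exists>c\<in>corners K. corner_vertex K c = x"
  shows "points D \<subseteq> D.region_of (faces D)"
proof
  fix p assume p: "p \<in> points D"
  show "p \<in> D.region_of (faces D)"
  proof (cases p)
    case (VPt u)
    then obtain x b where u: "u = (x, b)" "x \<in> nodes K" "b \<in> carrier A"
      using p by (auto simp: points_def)
    obtain c where c: "c \<in> corners K" "corner_vertex K c = x" using corner[OF u(2)] by blast
    note o = over_props[OF c(1) u(3)]
    have "fst (over c b) \<in> faces D" using o(1) by (auto simp: corners_def)
    moreover have "has_corner D (fst (over c b)) u"
      using D.corner_has_corner[OF o(1)] o(2) c(2) u(1) by simp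
    ultimately show ?thesis unfolding VPt D.region_of_def using D.VPt_closed_face by blast
  next
    case (EPt e' t)
    then obtain e b where e: "e' = (e, b)" "e \<in> edges K" "b \<in> carrier A" "0 < t" "t < 1"
      using p by (auto simp: points_def)
    obtain f where f: "f \<in> faces K" "has_side K f e" using side[OF e(2)] by blast
    obtain i s where c: "(f, i) \<in> corners K" "flank K (f, i) s = e"
      using side_flank[OF f(1), of e] f(2) e(2) edges_darts by auto
    note o = over_props[OF c(1) e(3)]
    have F: "fst (over (f, i) b) \<in> faces D" using o(1) by (auto simp: corners_def)
    have "flank D (over (f, i) b) s = (e, b)" using flank_D[OF o(1)] o(2,3) c(2) by simp
    then have "has_side D (fst (over (f, i) b)) (e, b)"
      using D.flank_side[OF o(1), of s] D.edge_under_id[of "(e, b)"] e by simp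
    then show ?thesis unfolding EPt e(1) D.region_of_def using D.EPt_closed_face[OF F] F e by blast
  next
    case (FPt F w)
    then have "F \<in> faces D" "norm w < 1" using p by (auto simp: points_def)
    then show ?thesis unfolding FPt D.region_of_def using D.FPt_closed_face by blast
  qed
qed

end

section \<open>Counting sheets over a region\<close>

text \<open>
  Here \<open>FQ\<close> stands for the set of faces in a component of the derived surface, or of a part of it, minus
  the curves in \<open>X\<close>. All that is used about this component is that \<open>FQ\<close> is nonempty and closed under sharing
  a point off these curves.
\<close>

locale derived_region =
  derived_embedding K A \<alpha> + cut_surface K z P M
  for K :: "('v, 'd, 'f) cell_complex" and A :: "('a, 'm) monoid_scheme" and \<alpha> :: "'d \<Rightarrow> 'a"
    and z :: "'d set" and P M :: "('v, 'd, 'f) point set" +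
  fixes X :: "('d \<times> 'a) set set" and FQ :: "('f \<times> 'a set) set"
  assumes connected_off: "connectedin (realization K) (points K - chain_points (skel K) z)"
    and FQ: "FQ \<subseteq> faces (derived_complex A \<alpha> K)" "FQ \<noteq> {}"
    and X_over: "\<And>c. c \<in> X \<Longrightarrow> c \<subseteq> z \<times> carrier A"
    and step: "\<And>F F' p. F \<in> FQ \<Longrightarrow> F' \<in> faces (derived_complex A \<alpha> K) \<Longrightarrow>
        p \<in> closed_face (derived_complex A \<alpha> K) F \<Longrightarrow> p \<in> closed_face (derived_complex A \<alpha> K) F' \<Longrightarrow>
        p \<notin> (\<Union>c\<in>X. chain_points (skel (derived_complex A \<alpha> K)) c) \<Longrightarrow> F' \<in> FQ"
begin

text \<open>
  The corner over \<open>c\<close> with index \<open>b\<close> belongs to a face in \<open>FQ\<close>. For fixed \<open>c\<close>, the elements \<open>b\<close> number the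
  sheets of the derived surface near \<open>c\<close>.
\<close>

definition inQ :: "'f \<times> nat \<Rightarrow> 'a \<Rightarrow> bool" where
  "inQ c b \<longleftrightarrow> fst (over c b) \<in> FQ"

lemma z_dart: "e \<in> z \<Longrightarrow> e \<in> darts K"
  using z edges_darts by blast

lemma EPt_off_X:
  assumes "fst e \<notin> z" "0 < t" "t < 1"
  shows "EPt e t \<notin> (\<Union>c\<in>X. chain_points (skel D) c)"
proof
  assume "EPt e t \<in> (\<Union>c\<in>X. chain_points (skel D) c)"
  then obtain c where "c \<in> X" "e \<in> c"
    unfolding UN_iff chain_points_EPt[OF assms(2,3)] by blast
  then show False using X_over assms(1) by fastforce
qed

lemma VPt_off_X:
  assumes "VPt x \<notin> curve z" shows "VPt (x, b) \<notin> (\<Union>c\<in>X. chain_points (skel D) c)"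
proof
  assume "VPt (x, b) \<in> (\<Union>c\<in>X. chain_points (skel D) c)"
  then obtain c e where c: "c \<in> X" "e \<in> c" "(x, b) = src D e \<or> (x, b) = tgt D e"
    unfolding UN_iff chain_points_VPt by blast
  then have "fst e \<in> z" using X_over[OF c(1)] by auto
  moreover have "x = src K (fst e) \<or> x = tgt K (fst e)" using c(3) by (cases e) auto
  ultimately have "VPt x \<in> curve z" unfolding chain_points_VPt by blast
  then show False using assms by blast
qed

text \<open>
  The lifts of the two corners with the same index share the lift of the flanking edge, which is not
  over the curve.
\<close>

lemma inQ_flank:
  assumes c: "c \<in> corners K" "c' \<in> corners K" "flank K c' s' = flank K c s"
    and e: "edge_under K (flank K c s) \<notin> z" and b: "b \<in> carrier A" and q: "inQ c b"
  shows "inQ c' b"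
proof -
  let ?d = "flank K c s"
  note o = over_props[OF c(1) b] and o' = over_props[OF c(2) b]
  have d: "?d \<in> darts K" by (rule flank_dart(1)[OF c(1)])
  define e' where "e' = edge_under D (?d, b)"
  have fl: "flank D (over c b) s = (?d, b)" "flank D (over c' b) s' = (?d, b)"
    using flank_D[OF o(1)] flank_D[OF o'(1)] o o' c(3) by simp_all
  have sides: "has_side D (fst (over c b)) e'" "has_side D (fst (over c' b)) e'"
    using D.flank_side[OF o(1), of s] D.flank_side[OF o'(1), of s'] fl by (simp_all add: e'_def)
  have F: "fst (over c b) \<in> faces D" "fst (over c' b) \<in> faces D"
    using o(1) o'(1) by (auto simp: corners_def)
  have "fst e' \<notin> z" using edge_under_D(1)[OF d b] e by (simp add: e'_def)
  then have "EPt e' (1/2) \<notin> (\<Union>c\<in>X. chain_points (skel D) c)" by (intro EPt_off_X) auto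
  moreover have "EPt e' (1/2) \<in> closed_face D (fst (over c b))" "EPt e' (1/2) \<in> closed_face D (fst (over c' b))"
    using D.EPt_closed_face F sides by auto
  ultimately show ?thesis using step[OF _ F(2)] q by (simp add: inQ_def)
qed

lemma inQ_vertex:
  assumes c: "c \<in> corners K" "c' \<in> corners K" "corner_vertex K c' = corner_vertex K c"
    and x: "VPt (corner_vertex K c) \<notin> curve z" and b: "b \<in> carrier A" and q: "inQ c b"
  shows "inQ c' b"
proof -
  note o = over_props[OF c(1) b] and o' = over_props[OF c(2) b]
  let ?p = "VPt (corner_vertex K c, b) :: ('v \<times> 'a, 'd \<times> 'a, 'f \<times> 'a set) point"
  have F: "fst (over c b) \<in> faces D" "fst (over c' b) \<in> faces D"
    using o(1) o'(1) by (auto simp: corners_def)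
  have "?p \<in> closed_face D (fst (over c b))" "?p \<in> closed_face D (fst (over c' b))"
    using D.VPt_closed_face[OF F(1)] D.VPt_closed_face[OF F(2)]
      D.corner_has_corner[OF o(1)] D.corner_has_corner[OF o'(1)] o(2) o'(2) c(3) by simp_all
  then show ?thesis using step[OF _ F(2) _ _ VPt_off_X[OF x]] q by (simp add: inQ_def)
qed

text \<open>
  The shared point is a vertex or lies on an edge. In the first case the corners at that vertex serve,
  in the second case the corners flanked by that edge.
\<close>

lemma shared_point_corners:
  assumes f: "f \<in> faces K" "g \<in> faces K" "f \<noteq> g" and p: "p \<in> closed_face K f" "p \<in> closed_face K g" "p \<notin> curve z"
  shows "\<exists>i j. (f, i) \<in> corners K \<and> (g, j) \<in> corners K \<and> (\<forall>b\<in>carrier A. inQ (f, i) b = inQ (g, j) b)"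
proof (cases p)
  case (VPt x)
  then obtain i j where ij: "i < gonality K f" "src K (bd K f ! i) = x" "j < gonality K g" "src K (bd K g ! j) = x"
    using p f VPt_closed_face by (auto simp: has_corner_def)
  have c: "(f, i) \<in> corners K" "(g, j) \<in> corners K" "corner_vertex K (f, i) = x" "corner_vertex K (g, j) = x"
    using ij f by (auto simp: corners_def corner_vertex_def)
  have "inQ (f, i) b = inQ (g, j) b" if "b \<in> carrier A" for b
    using inQ_vertex[OF c(1,2) _ _ that] inQ_vertex[OF c(2,1) _ _ that] c p(3) VPt by auto
  then show ?thesis using c by blast
next
  case (EPt e t)
  then have e: "has_side K f e" "has_side K g e" "0 < t" "t < 1" using p f EPt_closed_face by auto
  have ez: "e \<notin> z" using p(3) unfolding EPt chain_points_EPt[OF e(3,4)] .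
  have ed: "e \<in> edges K"
    using e(1) f(1) bd_dart edge_under_edge unfolding has_side_def by blast
  then have ed': "e \<in> darts K" "edge_under K e = e" using edges_darts by auto
  obtain i s where i: "(f, i) \<in> corners K" "flank K (f, i) s = e"
    using side_flank[OF f(1) _ ed'(1)] e(1) ed'(2) by auto
  obtain j s' where j: "(g, j) \<in> corners K" "flank K (g, j) s' = e"
    using side_flank[OF f(2) _ ed'(1)] e(2) ed'(2) by auto
  have "inQ (f, i) b = inQ (g, j) b" if "b \<in> carrier A" for b
    using inQ_flank[OF i(1) j(1) _ _ that, of s' s] inQ_flank[OF j(1) i(1) _ _ that, of s s'] i j ed' ez by auto
  then show ?thesis using i j by blast
next
  case (FPt h w)
  then show ?thesis using p f FPt_closed_face by auto
qed

lemma face_under: "F \<in> FQ \<Longrightarrow> fst F \<in> faces K"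
  using FQ(1) coset_base(1)[of "fst F" "snd F"] by auto

lemma face_lifts_over:
  assumes c: "c \<in> corners K" "b \<in> carrier A" "inQ c b"
  shows "\<exists>F\<in>FQ. fst F = fst c"
proof -
  have "fst (below (over c b)) = fst c" using over_props(3)[OF c(1,2)] by simp
  then show ?thesis using c(3) by (auto simp: inQ_def below_def)
qed

lemma lifted_face_corner:
  assumes F: "F \<in> FQ" and i: "(fst F, i) \<in> corners K"
  shows "(F, i) \<in> corners D" "below (F, i) = (fst F, i)"
    "inQ (fst F, i) (snd (corner_vertex D (F, i)))"
proof -
  have f: "fst F \<in> faces K" "i < gonality K (fst F)" using i by (auto simp: corners_def)
  have "1 * gonality K (fst F) \<le> gonality D F"
    unfolding gonality_D using turns_pos[OF f(1)] by (intro mult_le_mono1) simp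
  then show c: "(F, i) \<in> corners D" using FQ(1) F f(2) by (auto simp: corners_def)
  show bl: "below (F, i) = (fst F, i)" using f(2) by (simp add: below_def)
  show "inQ (fst F, i) (snd (corner_vertex D (F, i)))"
    using over_below[OF c] bl F by (simp add: inQ_def)
qed

text \<open>
  The faces below \<open>FQ\<close> are closed under sharing points off the curve, and the complement of the curve is
  connected.
\<close>

lemma every_face_lifts: "fst ` FQ = faces K"
proof (rule faces_connected_off_curve[OF connected_off])
  show "fst ` FQ \<subseteq> faces K" "fst ` FQ \<noteq> {}" using face_under FQ(2) by auto
  fix f g p assume f: "f \<in> fst ` FQ" and g: "g \<in> faces K" and p: "p \<in> closed_face K f" "p \<in> closed_face K g" "p \<notin> curve z"
  show "g \<in> fst ` FQ"
  proof (cases "f = g")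
    case False
    obtain F where F: "F \<in> FQ" "f = fst F" using f by blast
    obtain i j where ij: "(f, i) \<in> corners K" "(g, j) \<in> corners K" "\<forall>b\<in>carrier A. inQ (f, i) b = inQ (g, j) b"
      using shared_point_corners[OF _ g False p] f face_under by blast
    note lc = lifted_face_corner[OF F(1), of i, folded F(2), OF ij(1)]
    have "snd (corner_vertex D (F, i)) \<in> carrier A" by (rule corner_vertex_D(2)[OF lc(1)])
    then show ?thesis using face_lifts_over[OF ij(2)] ij(3) lc(3) by force
  qed (use f in simp)
qed

text \<open>Each derived face over \<open>f\<close> counts with its ramification order.\<close>

definition sheets_in_Q :: "'f \<Rightarrow> nat" where
  "sheets_in_Q f = card {F \<in> FQ. fst F = f} * turns f"

text \<open>
  The boundary walk of each face over \<open>f\<close> passes over a given corner of \<open>f\<close> once per turn. In particular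
  the number does not depend on the corner.
\<close>

lemma card_inQ_face:
  assumes c: "(f, i) \<in> corners K"
  shows "card {b \<in> carrier A. inQ (f, i) b} = sheets_in_Q f"
proof -
  let ?n = "gonality K f" and ?r = "turns f"
  have f: "f \<in> faces K" "i < ?n" using c by (auto simp: corners_def)
  define S where "S = {k \<in> corners D. below k = (f, i) \<and> fst k \<in> FQ}"
  have "bij_betw (over (f, i)) {b \<in> carrier A. inQ (f, i) b} S"
  proof (rule bij_betw_byWitness[where f' = "\<lambda>k. snd (corner_vertex D k)"])
    show "\<forall>b\<in>{b \<in> carrier A. inQ (f, i) b}. snd (corner_vertex D (over (f, i) b)) = b"
      using over_props(2)[OF c] by auto
    show "\<forall>k\<in>S. over (f, i) (snd (corner_vertex D k)) = k"
    proof
      fix k assume "k \<in> S"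
      then have "k \<in> corners D" "below k = (f, i)" by (simp_all add: S_def)
      then show "over (f, i) (snd (corner_vertex D k)) = k" using over_below[of k] by simp
    qed
    show "over (f, i) ` {b \<in> carrier A. inQ (f, i) b} \<subseteq> S"
      using over_props(1,3)[OF c] by (auto simp: S_def inQ_def)
    show "(\<lambda>k. snd (corner_vertex D k)) ` S \<subseteq> {b \<in> carrier A. inQ (f, i) b}"
    proof
      fix b assume "b \<in> (\<lambda>k. snd (corner_vertex D k)) ` S"
      then obtain k where k: "k \<in> S" "b = snd (corner_vertex D k)" by blast
      then have kc: "k \<in> corners D" "below k = (f, i)" "fst k \<in> FQ" by (auto simp: S_def)
      have "over (f, i) b = k" using over_below[OF kc(1)] kc(2) k(2) by simp
      then show "b \<in> {b \<in> carrier A. inQ (f, i) b}"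
        using corner_vertex_D(2)[OF kc(1)] k(2) kc(3) by (simp add: inQ_def)
    qed
  qed
  then have "card {b \<in> carrier A. inQ (f, i) b} = card S" by (rule bij_betw_same_card)
  \<comment> \<open>A corner over \<open>(f, i)\<close> is given by its face and the number of complete turns before it.\<close>
  also have "\<dots> = card ({F \<in> FQ. fst F = f} \<times> {..<?r})"
  proof (rule bij_betw_same_card[symmetric], rule bij_betw_byWitness[where f' = "\<lambda>(F, j). (F, j div ?n)"])
    let ?h = "\<lambda>(F, q). (F, q * ?n + i)"
    have "(q * ?n + i) div ?n = q" for q
      using f(2) gonality_pos[OF f(1)] by (subst div_mult_self3) auto
    then show "\<forall>x\<in>{F \<in> FQ. fst F = f} \<times> {..<?r}. (\<lambda>(F, j). (F, j div ?n)) (?h x) = x" by auto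
    show "\<forall>k\<in>S. ?h ((\<lambda>(F, j). (F, j div ?n)) k) = k" by (auto simp: S_def below_def)
    show "?h ` ({F \<in> FQ. fst F = f} \<times> {..<?r}) \<subseteq> S"
    proof
      fix x assume "x \<in> ?h ` ({F \<in> FQ. fst F = f} \<times> {..<?r})"
      then obtain F q where Fq: "F \<in> FQ" "fst F = f" "q < ?r" "x = ?h (F, q)" by blast
      define C where "C = snd F"
      have F: "(f, C) \<in> FQ" and q: "q < ?r" and x: "x = ((f, C), q * ?n + i)"
        using Fq by (auto simp: C_def)
      have "q * ?n + i < (q + 1) * ?n" using f(2) by simp
      also have "\<dots> \<le> ?r * ?n" using q by (intro mult_le_mono1) simp
      finally show "x \<in> S"
        using F FQ(1) f(2) gonality_D[of "(f, C)"] unfolding x by (auto simp: S_def corners_def below_def)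
    qed
    show "(\<lambda>(F, j). (F, j div ?n)) ` S \<subseteq> {F \<in> FQ. fst F = f} \<times> {..<?r}"
    proof
      fix x assume "x \<in> (\<lambda>(F, j). (F, j div ?n)) ` S"
      then obtain F j where k: "(F, j) \<in> S" and x: "x = (F, j div ?n)" by auto
      then have F: "fst F = f" "F \<in> FQ" "j < gonality D F" by (auto simp: S_def below_def corners_def)
      then have "j < ?r * ?n" using gonality_D[of F] by simp
      then show "x \<in> {F \<in> FQ. fst F = f} \<times> {..<?r}"
        using F unfolding x by (simp add: less_mult_imp_div_less)
    qed
  qed
  also have "\<dots> = sheets_in_Q f" by (simp add: card_cartesian_product sheets_in_Q_def)
  finally show ?thesis .
qed

text \<open>
  For two faces sharing a point off the curve, suitable corners have the same sheets in \<open>FQ\<close>. As the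
  complement of the curve is connected, the number of sheets is the same for all faces, including those
  on different sides of the curve.
\<close>

lemma card_inQ_constant:
  assumes c: "c \<in> corners K" and c': "c' \<in> corners K"
  shows "card {b \<in> carrier A. inQ c b} = card {b \<in> carrier A. inQ c' b}"
proof -
  define F where "F = {f \<in> faces K. sheets_in_Q f = sheets_in_Q (fst c)}"
  have "F = faces K"
  proof (rule faces_connected_off_curve[OF connected_off])
    show "F \<subseteq> faces K" by (auto simp: F_def)
    show "F \<noteq> {}" using c by (auto simp: F_def corners_def)
    fix f g p assume f: "f \<in> F" and g: "g \<in> faces K" and p: "p \<in> closed_face K f" "p \<in> closed_face K g" "p \<notin> curve z"
    show "g \<in> F"
    proof (cases "f = g")
      case False
      obtain i j where ij: "(f, i) \<in> corners K" "(g, j) \<in> corners K" "\<forall>b\<in>carrier A. inQ (f, i) b = inQ (g, j) b"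
        using shared_point_corners[OF _ g False p] f by (auto simp: F_def)
      have "{b \<in> carrier A. inQ (f, i) b} = {b \<in> carrier A. inQ (g, j) b}" using ij(3) by blast
      then have "sheets_in_Q f = sheets_in_Q g"
        using card_inQ_face[OF ij(1)] card_inQ_face[OF ij(2)] by simp
      then show ?thesis using f g by (simp add: F_def)
    qed (use f in simp)
  qed
  moreover have "fst c' \<in> faces K" using c' by (auto simp: corners_def)
  ultimately have "sheets_in_Q (fst c') = sheets_in_Q (fst c)" by (auto simp: F_def)
  then show ?thesis using card_inQ_face[of "fst c" "snd c"] card_inQ_face[of "fst c'" "snd c'"] c c' by simp
qed

section \<open>The two sides of the lifted curves\<close>

text \<open>
  The vertex \<open>u\<close> lies over the curve. By the next lemma, all the corners at \<open>u\<close> on side \<open>Z\<close> agree on whether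
  they are in \<open>FQ\<close>, so it is enough to ask for one.
\<close>

definition inside :: "('v, 'd, 'f) point set \<Rightarrow> 'v \<times> 'a \<Rightarrow> bool" where
  "inside Z u \<longleftrightarrow> (\<exists>c\<in>corners K. corner_vertex K c = fst u \<and> corner_on Z c \<and> inQ c (snd u))"

text \<open>
  The corners on side \<open>Z\<close> form a chain with common edges off the curve, and such a chain can be lifted
  with constant index \<open>b\<close>.
\<close>

lemma inside_iff:
  assumes Z: "Z \<in> {P, M}" and x: "VPt x \<in> curve z" and b: "b \<in> carrier A"
    and c: "c \<in> corners K" "corner_vertex K c = x" "corner_on Z c"
  shows "inside Z (x, b) \<longleftrightarrow> inQ c b"
proof
  assume "inside Z (x, b)"
  then obtain c1 where c1: "c1 \<in> corners K" "corner_vertex K c1 = x" "corner_on Z c1" "inQ c1 b"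
    by (auto simp: inside_def)
  have "c \<in> {c \<in> corners K. corner_vertex K c = x \<and> inQ c b}"
  proof (rule corners_on_one_side[OF Z x _ _ _ c1(3) c])
    show "c1 \<in> {c \<in> corners K. corner_vertex K c = x \<and> inQ c b}" using c1 by simp
    fix c c' s s'
    assume c: "c \<in> {c \<in> corners K. corner_vertex K c = x \<and> inQ c b}" and c': "c' \<in> corners K"
      and s: "flank K c' s' = flank K c s" and e: "edge_under K (flank K c s) \<notin> z"
    then have "inQ c' b" using inQ_flank[OF _ c' s e b] by simp
    moreover have "corner_vertex K c' = corner_vertex K c"
      using flank_dart(2)[of c s] flank_dart(2)[of c' s'] c c' s by simp
    ultimately show "c' \<in> {c \<in> corners K. corner_vertex K c = x \<and> inQ c b}" using c c' by simp
  qed auto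
  then show "inQ c b" by simp
next
  assume "inQ c b" then show "inside Z (x, b)" using c by (auto simp: inside_def)
qed

lemma endpoint_on_curve: "e \<in> z \<Longrightarrow> VPt (src K e) \<in> curve z" "e \<in> z \<Longrightarrow> VPt (tgt K e) \<in> curve z"
  unfolding chain_points_VPt by blast+

text \<open>
  A face on side \<open>Z\<close> of an edge of the curve is on side \<open>Z\<close> at both ends of this edge, and so is each face
  over it. Therefore belonging to \<open>FQ\<close> is the same question at both ends.
\<close>

lemma side_lift:
  assumes Z: "Z \<in> {P, M}" and e: "e \<in> z" and b: "b \<in> carrier A"
  shows "\<exists>F\<in>faces D. has_side D F (e, b) \<and> (F \<in> FQ \<longleftrightarrow> inside Z (src K e, b)) \<and>
     (F \<in> FQ \<longleftrightarrow> inside Z (tgt K e, b \<odot> \<alpha> e))"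
proof -
  have ee: "e \<in> edges K" "e \<in> darts K" using e z z_dart by auto
  obtain f i j where fi: "f \<in> faces K" "i < gonality K f" "j = Suc i mod gonality K f"
    and ei: "edge_under K (bd K f ! i) = e" and on: "corner_on Z (f, i)" "corner_on Z (f, j)"
    and c: "(f, i) \<in> corners K" "(f, j) \<in> corners K"
    and v: "corner_vertex K (f, i) = src K (bd K f ! i)" "corner_vertex K (f, j) = tgt K (bd K f ! i)"
    by (rule edge_side_ends[OF Z e])
  let ?d = "bd K f ! i"
  have d: "?d \<in> darts K" using fi by simp
  have main: "\<exists>F\<in>faces D. has_side D F (edge_under D (?d, b')) \<and> (F \<in> FQ \<longleftrightarrow> inside Z (src K ?d, b')) \<and>
     (F \<in> FQ \<longleftrightarrow> inside Z (tgt K ?d, b' \<odot> \<alpha> ?d))"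
    if b': "b' \<in> carrier A" and C: "VPt (src K ?d) \<in> curve z" "VPt (tgt K ?d) \<in> curve z" for b'
  proof -
    note o = over_props[OF c(1) b']
    let ?F = "fst (over (f, i) b')"
    have bb: "b' \<odot> \<alpha> ?d \<in> carrier A" using b' d by simp
    have "?F \<in> faces D" using o(1) by (auto simp: corners_def)
    moreover have "has_side D ?F (edge_under D (?d, b'))"
      using D.flank_side[OF o(1), of True] flank_D[OF o(1), of True] o(2,3) by simp
    moreover have "?F \<in> FQ \<longleftrightarrow> inside Z (src K ?d, b')"
      using inside_iff[OF Z C(1) b' c(1) v(1) on(1)] by (simp add: inQ_def)
    moreover have "?F \<in> FQ \<longleftrightarrow> inside Z (tgt K ?d, b' \<odot> \<alpha> ?d)"
      using inside_iff[OF Z C(2) bb c(2) v(2) on(2)] over_next[OF fi(1,2) b'] fi(3) by (simp add: inQ_def)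
    ultimately show ?thesis by blast
  qed
  have "?d = e \<or> ?d = flip K e" by (rule edge_under_cases[OF d ei])
  then show ?thesis
  proof
    assume de: "?d = e"
    have "edge_under D (e, b) = (e, b)" using ee b by simp
    then show ?thesis using main[OF b] endpoint_on_curve[OF e] unfolding de by simp
  next
    assume de: "?d = flip K e"
    have bb: "b \<odot> \<alpha> e \<in> carrier A" using b ee by simp
    have "edge_under D (flip K e, b \<odot> \<alpha> e) = (e, b)"
      using edge_under_D(3)[OF _ bb ee(1) b refl refl] ee(2) by simp
    moreover have "b \<odot> \<alpha> e \<odot> \<alpha> (flip K e) = b" using b ee by (simp add: voltage_flip A.m_assoc)
    ultimately show ?thesis using main[OF bb] endpoint_on_curve[OF e] ee(2) unfolding de by auto
  qed
qed

lemma inside_edge: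
  assumes "Z \<in> {P, M}" "e \<in> z" "b \<in> carrier A"
  shows "inside Z (src K e, b) \<longleftrightarrow> inside Z (tgt K e, b \<odot> \<alpha> e)"
  using side_lift[OF assms] by blast

lemma corner_on_exists:
  assumes Z: "Z \<in> {P, M}" and x: "VPt x \<in> curve z"
  shows "\<exists>c\<in>corners K. corner_vertex K c = x \<and> corner_on Z c"
proof -
  obtain e where e: "e \<in> z" "x = src K e \<or> x = tgt K e" using x unfolding chain_points_VPt by blast
  obtain f i j where fi: "f \<in> faces K" "i < gonality K f" "j = Suc i mod gonality K f"
    and ei: "edge_under K (bd K f ! i) = e" and on: "corner_on Z (f, i)" "corner_on Z (f, j)"
    and c: "(f, i) \<in> corners K" "(f, j) \<in> corners K"
    and v: "corner_vertex K (f, i) = src K (bd K f ! i)" "corner_vertex K (f, j) = tgt K (bd K f ! i)"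
    by (rule edge_side_ends[OF Z e(1)])
  let ?d = "bd K f ! i"
  have d: "?d \<in> darts K" using fi by simp
  have "x = src K ?d \<or> x = tgt K ?d"
    using edge_under_cases[OF d ei] e z_dart[OF e(1)] by auto
  then show ?thesis using c v on by metis
qed

text \<open>
  Both numbers are the constant number of sheets: one is counted at a corner on side \<open>P\<close>, the other at a
  corner on side \<open>M\<close>.
\<close>

lemma card_inside:
  assumes x: "VPt x \<in> curve z"
  shows "card {b \<in> carrier A. inside P (x, b)} = card {b \<in> carrier A. inside M (x, b)}"
proof -
  obtain c where c: "c \<in> corners K" "corner_vertex K c = x" "corner_on P c"
    using corner_on_exists[OF _ x, of P] by blast
  obtain c' where c': "c' \<in> corners K" "corner_vertex K c' = x" "corner_on M c'"
    using corner_on_exists[OF _ x, of M] by blast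
  have "{b \<in> carrier A. inside P (x, b)} = {b \<in> carrier A. inQ c b}"
    using inside_iff[OF _ x _ c] by auto
  moreover have "{b \<in> carrier A. inside M (x, b)} = {b \<in> carrier A. inQ c' b}"
    using inside_iff[OF _ x _ c'] by auto
  ultimately show ?thesis using card_inQ_constant[OF c(1) c'(1)] by simp
qed

section \<open>Lifts of the curve\<close>

text \<open>The components of the preimage of the curve, described by reachability of vertices.\<close>

abbreviation lift_graph :: "('v \<times> 'a, 'd \<times> 'a) pre_digraph" where
  "lift_graph \<equiv> dg (derived_graph A \<alpha> (induced_graph (skel K) z))"

abbreviation reach :: "'v \<times> 'a \<Rightarrow> 'v \<times> 'a \<Rightarrow> bool" where
  "reach u w \<equiv> u \<rightarrow>\<^sup>*\<^bsub>lift_graph\<^esub> w"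

abbreviation lift_at :: "'v \<times> 'a \<Rightarrow> ('d \<times> 'a) set" where
  "lift_at \<equiv> lifted_chain A \<alpha> (skel K) z"

lemma lift_graph_simps:
  "verts lift_graph = (src K ` z \<union> tgt K ` z) \<times> carrier A"
  "arcs lift_graph = (z \<union> flip K ` z) \<times> carrier A"
  "tail lift_graph (d, a) = (src K d, a)"
  "head lift_graph (d, a) = (tgt K d, a \<odot> \<alpha> d)"
  by (simp_all add: derived_graph_def induced_graph_def)

lemma lift_at_iff: "(e, b) \<in> lift_at u \<longleftrightarrow> e \<in> z \<and> b \<in> carrier A \<and> reach u (src K e, b)"
  by (auto simp: lifted_chain_def Let_def derived_graph_def induced_graph_def)

lemma arcs_ends_lift_graph:
  "(u, w) \<in> arcs_ends lift_graph \<longleftrightarrow>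
     (\<exists>d a. d \<in> z \<union> flip K ` z \<and> a \<in> carrier A \<and> u = (src K d, a) \<and> w = (tgt K d, a \<odot> \<alpha> d))"
proof
  assume "(u, w) \<in> arcs_ends lift_graph"
  then obtain x where x: "x \<in> arcs lift_graph" "(u, w) = arc_to_ends lift_graph x"
    unfolding arcs_ends_def by blast
  then obtain d a where "x = (d, a)" "d \<in> z \<union> flip K ` z" "a \<in> carrier A"
    unfolding lift_graph_simps(2) by blast
  then show "\<exists>d a. d \<in> z \<union> flip K ` z \<and> a \<in> carrier A \<and> u = (src K d, a) \<and> w = (tgt K d, a \<odot> \<alpha> d)"
    using x(2) unfolding arc_to_ends_def by (auto simp: lift_graph_simps(3,4))
next
  assume "\<exists>d a. d \<in> z \<union> flip K ` z \<and> a \<in> carrier A \<and> u = (src K d, a) \<and> w = (tgt K d, a \<odot> \<alpha> d)"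
  then obtain d a where d: "(d, a) \<in> arcs lift_graph" "(u, w) = arc_to_ends lift_graph (d, a)"
    unfolding arc_to_ends_def lift_graph_simps by blast
  show "(u, w) \<in> arcs_ends lift_graph" unfolding arcs_ends_def d(2) using d(1) by (rule imageI)
qed

lemma lift_dart: "d \<in> z \<union> flip K ` z \<Longrightarrow> d \<in> darts K \<and> flip K d \<in> z \<union> flip K ` z"
  using z_dart by auto

lemma reach_sym: "reach u w \<Longrightarrow> reach w u"
proof -
  have "sym (arcs_ends lift_graph)"
  proof (rule symI)
    fix u w assume "(u, w) \<in> arcs_ends lift_graph"
    then obtain d a where d: "d \<in> z \<union> flip K ` z" "a \<in> carrier A" "u = (src K d, a)" "w = (tgt K d, a \<odot> \<alpha> d)"
      unfolding arcs_ends_lift_graph by blast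
    note dd = lift_dart[OF d(1)]
    have "w = (src K (flip K d), a \<odot> \<alpha> d)" "u = (tgt K (flip K d), a \<odot> \<alpha> d \<odot> \<alpha> (flip K d))"
      using dd d by (simp_all add: voltage_flip A.m_assoc)
    moreover have "a \<odot> \<alpha> d \<in> carrier A" using dd d(2) by simp
    ultimately show "(w, u) \<in> arcs_ends lift_graph" unfolding arcs_ends_lift_graph using dd by blast
  qed
  then have "sym (rtrancl_on (verts lift_graph) (arcs_ends lift_graph))" by (rule rtrancl_on_sym)
  then show "reach u w \<Longrightarrow> reach w u" unfolding reachable_def by (rule symD)
qed

lemma reach_trans: "reach u w \<Longrightarrow> reach w y \<Longrightarrow> reach u y"
  unfolding reachable_def by (rule rtrancl_on_trans)

lemma reach_carrier: "reach u w \<Longrightarrow> w \<in> (src K ` z \<union> tgt K ` z) \<times> carrier A"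
  unfolding reachable_def lift_graph_simps(1)[symmetric] by (rule in_rtrancl_on_in_F(2))

lemma reach_edge:
  assumes "e \<in> z" "b \<in> carrier A" shows "reach (src K e, b) (tgt K e, b \<odot> \<alpha> e)"
proof -
  have "((src K e, b), (tgt K e, b \<odot> \<alpha> e)) \<in> arcs_ends lift_graph"
    using assms unfolding arcs_ends_lift_graph by blast
  moreover have "(src K e, b) \<in> verts lift_graph" "(tgt K e, b \<odot> \<alpha> e) \<in> verts lift_graph"
    unfolding lift_graph_simps using assms z_dart by auto
  ultimately show ?thesis unfolding reachable_def
    by (meson rtrancl_on_into_rtrancl_on rtrancl_on_refl)
qed

lemma reach_refl: "VPt x \<in> curve z \<Longrightarrow> b \<in> carrier A \<Longrightarrow> reach (x, b) (x, b)"
  unfolding reachable_def by (rule rtrancl_on_refl) (auto simp: lift_graph_simps chain_points_VPt)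

lemma reach_inside:
  assumes Z: "Z \<in> {P, M}" and r: "reach u w"
  shows "inside Z u \<longleftrightarrow> inside Z w"
  using r unfolding reachable_def
proof (induction rule: rtrancl_on_induct)
  case (step y w)
  obtain d a where d: "d \<in> z \<union> flip K ` z" "a \<in> carrier A" "y = (src K d, a)" "w = (tgt K d, a \<odot> \<alpha> d)"
    using step(2) unfolding arcs_ends_lift_graph by blast
  have "inside Z y \<longleftrightarrow> inside Z w"
  proof (cases "d \<in> z")
    case True then show ?thesis using inside_edge[OF Z True d(2)] d by simp
  next
    case False
    then obtain e where e: "e \<in> z" "d = flip K e" using d(1) by blast
    note ed = z_dart[OF e(1)]
    have b: "a \<odot> \<alpha> d \<in> carrier A" using d(2) ed e(2) by simp
    have "a \<odot> \<alpha> d \<odot> \<alpha> e = a" using d(2) ed e(2) by (simp add: voltage_flip A.m_assoc)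
    then show ?thesis using inside_edge[OF Z e(1) b] d e(2) ed by simp
  qed
  then show ?case using step by simp
qed simp

text \<open>
  Left multiplication commutes with the right multiplications by voltages along darts, so the group
  acts on the lifts. This makes all the lifts equally long.
\<close>

lemma reach_translate:
  assumes "reach u w" "g \<in> carrier A"
  shows "reach (fst u, g \<odot> snd u) (fst w, g \<odot> snd w)"
  using assms(1) unfolding reachable_def
proof (induction rule: rtrancl_on_induct)
  case base then show ?case using assms(2) by (auto simp: lift_graph_simps)
next
  case (step y w)
  obtain d a where d: "d \<in> z \<union> flip K ` z" "a \<in> carrier A" "y = (src K d, a)" "w = (tgt K d, a \<odot> \<alpha> d)"
    using step(2) unfolding arcs_ends_lift_graph by blast
  have "\<alpha> d \<in> carrier A" using lift_dart[OF d(1)] by simp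
  then have "((fst y, g \<odot> snd y), (fst w, g \<odot> snd w)) \<in> arcs_ends lift_graph"
    unfolding arcs_ends_lift_graph using d assms(2)
    by (intro exI[of _ d] exI[of _ "g \<odot> a"]) (simp add: A.m_assoc)
  moreover have "(fst w, g \<odot> snd w) \<in> verts lift_graph"
    using step(4) assms(2) by (auto simp: lift_graph_simps)
  ultimately show ?case using step(5) by (meson rtrancl_on_into_rtrancl_on)
qed

text \<open>
  A lift determines the component it spans, since it contains an edge, or the reverse of one, that
  starts over \<open>v\<close>.
\<close>

lemma lift_at_eq_iff:
  assumes v: "VPt v \<in> curve z" and b: "b \<in> carrier A" "b' \<in> carrier A"
  shows "lift_at (v, b) = lift_at (v, b') \<longleftrightarrow> reach (v, b) (v, b')"
proof
  assume "reach (v, b) (v, b')"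
  then have iff: "reach (v, b) y \<longleftrightarrow> reach (v, b') y" for y
    using reach_trans reach_sym by blast
  have "x \<in> lift_at (v, b) \<longleftrightarrow> x \<in> lift_at (v, b')" for x
    by (cases x) (simp add: lift_at_iff iff)
  then show "lift_at (v, b) = lift_at (v, b')" by blast
next
  assume eq: "lift_at (v, b) = lift_at (v, b')"
  obtain e where e: "e \<in> z" "v = src K e \<or> v = tgt K e" using v unfolding chain_points_VPt by blast
  obtain a where a: "a \<in> carrier A" "reach (v, b) (src K e, a)"
  proof (cases "v = src K e")
    case True
    then show ?thesis using that[OF b(1)] reach_refl[OF v b(1)] by simp
  next
    case False
    note ed = z_dart[OF e(1)]
    have i: "b \<odot> inv\<^bsub>A\<^esub> \<alpha> e \<in> carrier A" using b ed by simp
    have "b \<odot> inv\<^bsub>A\<^esub> \<alpha> e \<odot> \<alpha> e = b" using b ed by (simp add: A.m_assoc)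
    then have "reach (src K e, b \<odot> inv\<^bsub>A\<^esub> \<alpha> e) (v, b)"
      using reach_edge[OF e(1) i] e(2) False by simp
    then show ?thesis using that[OF i] reach_sym by blast
  qed
  have "(e, a) \<in> lift_at (v, b)" using a e(1) by (simp add: lift_at_iff)
  then have "reach (v, b') (src K e, a)" using eq by (simp add: lift_at_iff)
  then show "reach (v, b) (v, b')" using a(2) reach_sym reach_trans by blast
qed

text \<open>
  The fibers of \<open>b \<mapsto> lift_at (v, b)\<close> are left translates of each other, so a set of group elements that is a
  union of fibers has as many elements as it has lifts, times the size of one fiber.
\<close>

lemma card_lifts:
  assumes v: "VPt v \<in> curve z" and B: "B \<subseteq> carrier A"
    and sat: "\<And>b b'. b \<in> B \<Longrightarrow> b' \<in> carrier A \<Longrightarrow> reach (v, b) (v, b') \<Longrightarrow> b' \<in> B"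
  shows "card B = card {h \<in> carrier A. reach (v, \<one>\<^bsub>A\<^esub>) (v, h)} * card ((\<lambda>b. lift_at (v, b)) ` B)"
proof -
  let ?m = "card {h \<in> carrier A. reach (v, \<one>\<^bsub>A\<^esub>) (v, h)}" and ?l = "\<lambda>b. lift_at (v, b)"
  have fin: "finite B" using B finite_group finite_subset by blast
  have fib: "card {b' \<in> B. ?l b' = ?l b} = ?m" if b: "b \<in> B" for b
  proof -
    have bc: "b \<in> carrier A" using b B by blast
    have "{b' \<in> B. ?l b' = ?l b} = (\<lambda>h. b \<odot> h) ` {h \<in> carrier A. reach (v, \<one>\<^bsub>A\<^esub>) (v, h)}" (is "?L = ?R")
    proof
      show "?L \<subseteq> ?R"
      proof
        fix b' assume "b' \<in> ?L"
        then have b': "b' \<in> carrier A" "?l b = ?l b'" using B by auto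
        then have "reach (v, b) (v, b')" using lift_at_eq_iff[OF v bc] by blast
        from reach_translate[OF this, of "inv\<^bsub>A\<^esub> b"]
        have "reach (v, \<one>\<^bsub>A\<^esub>) (v, inv\<^bsub>A\<^esub> b \<odot> b')" using bc by simp
        moreover have "b' = b \<odot> (inv\<^bsub>A\<^esub> b \<odot> b')" using bc b' by (simp flip: A.m_assoc)
        ultimately show "b' \<in> ?R" using bc b' by blast
      qed
      show "?R \<subseteq> ?L"
      proof
        fix b' assume "b' \<in> ?R"
        then obtain h where h: "h \<in> carrier A" "reach (v, \<one>\<^bsub>A\<^esub>) (v, h)" "b' = b \<odot> h" by blast
        then have "reach (v, b) (v, b')" using reach_translate[OF h(2) bc] bc by simp
        moreover have "b' \<in> carrier A" using h bc by simp
        ultimately show "b' \<in> ?L" using sat[OF b] lift_at_eq_iff[OF v bc, of b'] by simp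
      qed
    qed
    moreover have "inj_on (\<lambda>h. b \<odot> h) {h \<in> carrier A. reach (v, \<one>\<^bsub>A\<^esub>) (v, h)}"
      using bc by (auto simp: inj_on_def)
    ultimately show ?thesis by (simp add: card_image)
  qed
  have "card B = (\<Sum>c\<in>?l ` B. card {b' \<in> B. ?l b' = c})"
    using sum.image_gen[OF fin, of "\<lambda>_. 1::nat" ?l] by simp
  also have "\<dots> = (\<Sum>c\<in>?l ` B. ?m)" by (rule sum.cong) (use fib in auto)
  finally show ?thesis by simp
qed

definition frontier_lifts :: "'v \<Rightarrow> ('d \<times> 'a) set set" where
  "frontier_lifts v = {lift_at (v, b) | b. b \<in> carrier A \<and> inside P (v, b) \<noteq> inside M (v, b)}"

text \<open>
  As many lifts have side \<open>P\<close> in \<open>FQ\<close> as have side \<open>M\<close> in \<open>FQ\<close>. The symmetric difference of two finite sets of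
  equal size has even size.
\<close>

lemma frontier_lifts_even:
  assumes v: "VPt v \<in> curve z"
  shows "finite (frontier_lifts v)" "even (card (frontier_lifts v))"
proof -
  let ?l = "\<lambda>b. lift_at (v, b)"
  define m where "m = card {h \<in> carrier A. reach (v, \<one>\<^bsub>A\<^esub>) (v, h)}"
  define L where "L Z = ?l ` {b \<in> carrier A. inside Z (v, b)}" for Z
  have m: "m > 0"
  proof -
    have "\<one>\<^bsub>A\<^esub> \<in> {h \<in> carrier A. reach (v, \<one>\<^bsub>A\<^esub>) (v, h)}" using reach_refl[OF v] by simp
    then show ?thesis unfolding m_def using finite_group by (subst card_gt_0_iff) auto
  qed
  have fin: "finite (L Z)" for Z unfolding L_def using finite_group by simp
  have "card {b \<in> carrier A. inside Z (v, b)} = m * card (L Z)" if Z: "Z \<in> {P, M}" for Z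
    unfolding m_def L_def by (rule card_lifts[OF v]) (use reach_inside[OF Z] in auto)
  then have "m * card (L P) = m * card (L M)" using card_inside[OF v] by simp
  then have eq: "card (L P) = card (L M)" using m by simp
  have mem: "?l b \<in> L Z \<longleftrightarrow> inside Z (v, b)" if "b \<in> carrier A" "Z \<in> {P, M}" for b Z
  proof
    assume "?l b \<in> L Z"
    then obtain b' where b': "b' \<in> carrier A" "inside Z (v, b')" "?l b = ?l b'" unfolding L_def by blast
    then have "reach (v, b) (v, b')" using lift_at_eq_iff[OF v that(1)] by blast
    then show "inside Z (v, b)" using reach_inside[OF that(2)] b'(2) by blast
  qed (use that in \<open>auto simp: L_def\<close>)
  \<comment> \<open>Membership in \<open>L Z\<close> does not depend on the choice of the vertex \<open>v\<^sup>b\<close> on the lift.\<close>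
  have split: "frontier_lifts v = (L P - L M) \<union> (L M - L P)"
  proof -
    have "c \<in> frontier_lifts v \<longleftrightarrow> c \<in> (L P - L M) \<union> (L M - L P)" for c
    proof -
      have "c \<in> frontier_lifts v \<longleftrightarrow> (\<exists>b\<in>carrier A. c = ?l b \<and> (c \<in> L P) \<noteq> (c \<in> L M))"
        unfolding frontier_lifts_def using mem by auto
      also have "\<dots> \<longleftrightarrow> c \<in> (L P - L M) \<union> (L M - L P)"
        unfolding L_def by blast
      finally show ?thesis .
    qed
    then show ?thesis by blast
  qed
  show "finite (frontier_lifts v)" unfolding split using fin by simp
  have "card (frontier_lifts v) = card (L P - L M) + card (L M - L P)"
    unfolding split using fin by (intro card_Un_disjoint) auto
  moreover have "card (L P - L M) = card (L M - L P)"
    using card_Diff_subset_Int[of "L P" "L M"] card_Diff_subset_Int[of "L M" "L P"] fin eq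
    by (simp add: Int_commute)
  ultimately show "even (card (frontier_lifts v))" by simp
qed

text \<open>
  A common point of two faces, one in \<open>FQ\<close> and one not, lies on a curve in \<open>X\<close>. The two faces have corners
  at a vertex of this curve, which therefore are on different sides. Conversely, each edge of the lifted
  curve has faces on both sides.
\<close>

lemma frontier_lifts_meet:
  assumes v: "VPt v \<in> curve z"
    and X: "\<And>c. c \<in> X \<Longrightarrow> \<exists>b\<in>carrier A. c = lift_at (v, b)"
  shows "D.region_of FQ \<inter> D.region_of (faces D - FQ) = (\<Union>c\<in>frontier_lifts v. chain_points (skel D) c)"
proof (intro equalityI subsetI)
  fix p assume "p \<in> D.region_of FQ \<inter> D.region_of (faces D - FQ)"
  then obtain F F' where F: "F \<in> FQ" "F \<in> faces D" "p \<in> closed_face D F"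
    and F': "F' \<in> faces D" "F' \<notin> FQ" "p \<in> closed_face D F'"
    using FQ(1) by (auto simp: D.region_of_def)
  obtain c where c: "c \<in> X" "p \<in> chain_points (skel D) c"
    using step[OF F(1) F'(1) F(3) F'(3)] F'(2) by blast
  obtain b where b: "b \<in> carrier A" "c = lift_at (v, b)" using X[OF c(1)] by blast
  have "\<exists>u. reach (v, b) u \<and> has_corner D F u \<and> has_corner D F' u"
  proof (cases p)
    case (VPt u)
    then obtain e where e: "e \<in> c" "u = src D e \<or> u = tgt D e" using c(2) unfolding VPt chain_points_VPt by blast
    obtain e0 b0 where e0: "e = (e0, b0)" "e0 \<in> z" "b0 \<in> carrier A" "reach (v, b) (src K e0, b0)"
      using e(1) b(2) by (cases e) (auto simp: lift_at_iff)
    have "reach (v, b) u"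
      using e(2) e0(4) reach_trans[OF e0(4) reach_edge[OF e0(2,3)]] unfolding e0(1) by auto
    then show ?thesis
      using F(3) F'(3) D.VPt_closed_face[OF F(2), of u] D.VPt_closed_face[OF F'(1), of u] unfolding VPt by blast
  next
    case (EPt e t)
    have s: "has_side D F e" "has_side D F' e" "0 < t" "t < 1"
      using F(3) F'(3) D.EPt_closed_face[OF F(2), of e t] D.EPt_closed_face[OF F'(1), of e t]
      unfolding EPt by simp_all
    have "e \<in> c" using c(2) unfolding EPt chain_points_EPt[OF s(3,4)] .
    then obtain e0 b0 where e0: "e = (e0, b0)" "e0 \<in> z" "b0 \<in> carrier A" "reach (v, b) (src K e0, b0)"
      using b(2) by (cases e) (auto simp: lift_at_iff)
    have ee: "e \<in> edges D" using e0 z by auto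
    have "has_corner D F (src D e)" "has_corner D F' (src D e)"
      using D.has_corner_endpoint[OF F(2) s(1) ee] D.has_corner_endpoint[OF F'(1) s(2) ee] by blast+
    then show ?thesis using e0(1,4) by auto
  next
    case (FPt G w)
    then show ?thesis
      using F(1,3) F'(2,3) D.FPt_closed_face[OF F(2), of G w] D.FPt_closed_face[OF F'(1), of G w]
      unfolding FPt by simp
  qed
  then obtain x b1 where u: "reach (v, b) (x, b1)" "has_corner D F (x, b1)" "has_corner D F' (x, b1)" by auto
  have x: "VPt x \<in> curve z" and b1: "b1 \<in> carrier A"
    using reach_carrier[OF u(1)] unfolding chain_points_VPt by auto
  have corner: "\<exists>c\<in>corners K. corner_vertex K c = x \<and> (inQ c b1 \<longleftrightarrow> F \<in> FQ)"
    if F: "F \<in> faces D" "has_corner D F (x, b1)" for F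
  proof -
    obtain j where j: "j < gonality D F" "src D (bd D F ! j) = (x, b1)"
      using F(2) by (auto simp: has_corner_def)
    have k: "(F, j) \<in> corners D" "corner_vertex D (F, j) = (x, b1)"
      using F j by (auto simp: corners_def corner_vertex_def)
    have "inQ (below (F, j)) b1 \<longleftrightarrow> F \<in> FQ" using over_below[OF k(1)] k(2) by (simp add: inQ_def)
    then show ?thesis using below_corner[OF k(1)] corner_vertex_D(1)[OF k(1)] k(2) by auto
  qed
  obtain c1 where c1: "c1 \<in> corners K" "corner_vertex K c1 = x" "inQ c1 b1" using corner[OF F(2) u(2)] F(1) by blast
  obtain c2 where c2: "c2 \<in> corners K" "corner_vertex K c2 = x" "\<not> inQ c2 b1" using corner[OF F'(1) u(3)] F'(2) by blast
  have "inside P (x, b1) \<noteq> inside M (x, b1)"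
  proof -
    have "corner_on P c1 \<or> corner_on M c1" "corner_on P c2 \<or> corner_on M c2"
      using corner_on_total c1 c2 x by simp_all
    moreover have "inside Z (x, b1)" if "Z \<in> {P, M}" "corner_on Z c1" for Z
      using inside_iff[OF that(1) x b1 c1(1,2) that(2)] c1(3) by simp
    moreover have "\<not> inside Z (x, b1)" if "Z \<in> {P, M}" "corner_on Z c2" for Z
      using inside_iff[OF that(1) x b1 c2(1,2) that(2)] c2(3) by simp
    ultimately show ?thesis by blast
  qed
  then have "inside P (v, b) \<noteq> inside M (v, b)"
    using reach_inside[OF _ u(1), of P] reach_inside[OF _ u(1), of M] by simp
  then have "c \<in> frontier_lifts v" unfolding frontier_lifts_def using b by blast
  then show "p \<in> (\<Union>c\<in>frontier_lifts v. chain_points (skel D) c)" using c(2) by blast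
next
  fix p :: "('v \<times> 'a, 'd \<times> 'a, 'f \<times> 'a set) point"
  assume "p \<in> (\<Union>c\<in>frontier_lifts v. chain_points (skel D) c)"
  then obtain b where b: "b \<in> carrier A" "inside P (v, b) \<noteq> inside M (v, b)" "p \<in> chain_points (skel D) (lift_at (v, b))"
    unfolding frontier_lifts_def by blast
  then obtain e t where e: "e \<in> lift_at (v, b)" "t \<in> {0..1}" "p = edge_point (skel D) e t"
    unfolding chain_points_def by blast
  obtain e0 b0 where e0: "e = (e0, b0)" "e0 \<in> z" "b0 \<in> carrier A" "reach (v, b) (src K e0, b0)"
    using e(1) by (cases e) (auto simp: lift_at_iff)
  have ins: "inside P (src K e0, b0) \<noteq> inside M (src K e0, b0)"
    using b(2) reach_inside[OF _ e0(4), of P] reach_inside[OF _ e0(4), of M] by simp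
  have ee: "e \<in> edges D" using e0 z by auto
  have ex: "\<exists>F\<in>faces D. p \<in> closed_face D F \<and> (F \<in> FQ \<longleftrightarrow> inside Z (src K e0, b0))" if "Z \<in> {P, M}" for Z
    using side_lift[OF that e0(2,3)] D.edge_in_closed_face[OF _ _ ee e(2)] unfolding e(3) e0(1) by metis
  obtain F where F: "F \<in> faces D" "p \<in> closed_face D F" "F \<in> FQ \<longleftrightarrow> inside P (src K e0, b0)"
    using ex[of P] by auto
  obtain F' where F': "F' \<in> faces D" "p \<in> closed_face D F'" "F' \<in> FQ \<longleftrightarrow> inside M (src K e0, b0)"
    using ex[of M] by auto
  show "p \<in> D.region_of FQ \<inter> D.region_of (faces D - FQ)"
    using ins F F' unfolding D.region_of_def by (cases "F \<in> FQ") auto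
qed

lemma region_bounded:
  assumes v: "VPt v \<in> curve z"
    and X: "\<And>c. c \<in> X \<Longrightarrow> \<exists>b\<in>carrier A. c = lift_at (v, b)"
  shows "bounded_by D (D.region_of FQ) (frontier_lifts v)"
proof -
  have "points D \<subseteq> D.region_of (faces D)" by (rule D_covered[OF edge_has_side node_has_corner])
  from D.frontier_region[OF FQ(1) this] frontier_lifts_meet[OF v X]
  show ?thesis unfolding bounded_by_def by simp
qed

lemma corner_in_region:
  assumes c: "c \<in> corners K"
  shows "\<exists>u\<in>total_fiber A \<alpha> K (CornerV c). total_position A \<alpha> K u \<in> D.region_of FQ"
proof -
  have "fst c \<in> faces K" using c by (auto simp: corners_def)
  then obtain F where F: "F \<in> FQ" "fst F = fst c" using every_face_lifts by (metis imageE)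
  let ?k = "(F, snd c)"
  have cc: "(fst F, snd c) \<in> corners K" using c F(2) by simp
  note lc = lifted_face_corner[OF F(1) cc]
  define b where "b = snd (corner_vertex D ?k)"
  have b: "b \<in> carrier A" unfolding b_def by (rule corner_vertex_D(2)[OF lc(1)])
  have "over c b = ?k" using over_below[OF lc(1)] lc(2) F(2) by (simp add: b_def)
  then have "total_position A \<alpha> K (CornerV c, b) = FPt F (cis (2 * pi * real (snd c) / real (gonality D F)) / 2)"
    by (simp add: corner_point_def)
  moreover have "\<dots> \<in> closed_face D F" 
    using D.FPt_closed_face[of F F] F(1) FQ(1) by (auto simp: norm_divide)
  moreover have "(CornerV c, b) \<in> total_fiber A \<alpha> K (CornerV c)"
    using c b by (auto simp: total_fiber_def derived_graph_def total_graph_def Let_def)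
  ultimately show ?thesis using F(1) by (auto simp: D.region_of_def intro!: bexI[of _ "(CornerV c, b)"])
qed

end

section \<open>Regions of the derived surface\<close>

text \<open>
  An open face together with a boundary point off the curves is connected, so it is absorbed by each
  component that it meets. The component \<open>Q\<close> is taken within a component of the whole surface, which
  absorbs such sets for the same reason.
\<close>

lemma (in polygonal) component_faces:
  assumes Q: "Q \<in> connected_components_of
      (subtopology (realization K) (connected_component_of_set (realization K) s - X))"
    and X: "\<And>f w. FPt f w \<notin> X" and cover: "points K \<subseteq> region_of (faces K)"
  shows "{f \<in> faces K. FPt f ` ball 0 1 \<subseteq> Q} \<noteq> {}"
    and "f \<in> faces K \<Longrightarrow> FPt f ` ball 0 1 \<subseteq> Q \<Longrightarrow> g \<in> faces K \<Longrightarrow>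
      p \<in> closed_face K f \<Longrightarrow> p \<in> closed_face K g \<Longrightarrow> p \<notin> X \<Longrightarrow> FPt g ` ball 0 1 \<subseteq> Q"
proof -
  let ?S = "connected_component_of_set (realization K) s"
  have Qsub: "Q \<subseteq> points K \<inter> (?S - X)"
    using connected_components_of_subset[OF Q] by simp
  have absorb: "Y \<subseteq> Q" if Y: "connectedin (realization K) Y" "Y \<inter> X = {}" and y: "y \<in> Y" "y \<in> Q" for Y y
  proof -
    have ys: "connected_component_of (realization K) s y" using Qsub y(2) by blast
    have "Y \<subseteq> ?S"
    proof
      fix y' assume "y' \<in> Y"
      then have "connected_component_of (realization K) y y'"
        unfolding connected_component_of_def using Y(1) y(1) by blast
      then show "y' \<in> ?S" using connected_component_of_trans[OF ys] by simp
    qed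
    then have "connectedin (subtopology (realization K) (?S - X)) Y"
      using Y unfolding connectedin_subtopology by blast
    moreover have "\<not> disjnt Q Y" using y by (auto simp: disjnt_iff)
    ultimately show ?thesis using connected_components_of_maximal[OF Q] by blast
  qed
  have face: "FPt g ` ball 0 1 \<subseteq> Q" if g: "g \<in> faces K" and p: "p \<in> closed_face K g" "p \<in> Q" for g p
  proof -
    obtain y where y: "y \<in> cball 0 1" "p = face_map K g y" using p(1) by (auto simp: closed_face_def)
    have "insert p (FPt g ` ball 0 1) \<inter> X = {}" using X p(2) Qsub by auto
    then have "insert p (FPt g ` ball 0 1) \<subseteq> Q"
      using absorb[of "insert p (FPt g ` ball 0 1)" p] connectedin_face_point[OF g y(1)] p(2) y(2) by auto
    then show ?thesis by blast
  qed
  have "Q \<noteq> {}" using Q nonempty_connected_components_of by blast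
  then obtain p0 where p0: "p0 \<in> Q" by blast
  then obtain g0 where "g0 \<in> faces K" "p0 \<in> closed_face K g0"
    using cover Qsub by (auto simp: region_of_def)
  then show "{f \<in> faces K. FPt f ` ball 0 1 \<subseteq> Q} \<noteq> {}" using face p0 by blast
  assume f: "f \<in> faces K" "FPt f ` ball 0 1 \<subseteq> Q" and g: "g \<in> faces K"
    and p: "p \<in> closed_face K f" "p \<in> closed_face K g" "p \<notin> X"
  obtain y where y: "y \<in> cball 0 1" "p = face_map K f y" using p(1) by (auto simp: closed_face_def)
  have "insert p (FPt f ` ball 0 1) \<subseteq> Q"
  proof (rule absorb)
    show "connectedin (realization K) (insert p (FPt f ` ball 0 1))"
      using connectedin_face_point[OF f(1) y(1)] y(2) by simp
    show "insert p (FPt f ` ball 0 1) \<inter> X = {}" using X p(3) by auto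
    show "FPt f 0 \<in> insert p (FPt f ` ball 0 1)" by auto
    show "FPt f 0 \<in> Q" using f(2) by auto
  qed
  then show "FPt g ` ball 0 1 \<subseteq> Q" using face[OF g p(2)] by blast
qed

text \<open>An isolated vertex would be an open and closed point of the surface.\<close>

lemma (in polygonal) node_has_dart:
  assumes con: "connectedin (realization K) (points K)" and e: "e \<in> edges K" and x: "x \<in> nodes K"
  shows "\<exists>d\<in>darts K. src K d = x"
proof (rule ccontr)
  assume no: "\<not> ?thesis"
  then have no': "src K d \<noteq> x" "tgt K d \<noteq> x" if "d \<in> darts K" for d
    using no that src_flip[OF that] flip_dart[OF that] by metis+
  have tr: "edge_point (skel K) e t \<noteq> VPt x" if "e \<in> edges K" for e t
    using no' edges_darts[OF that] by (auto simp: edge_point_def)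
  have nc: "VPt x \<notin> closed_face K f" if "f \<in> faces K" for f
    using VPt_closed_face[OF that] no' bd_dart[OF that] by (auto simp: has_corner_def)
  have "points K \<subseteq> {VPt x} \<or> points K \<subseteq> points K - {VPt x}"
  proof (rule connectedin_in_one_part[OF con])
    show "openin (realization K) {VPt x}"
    proof (rule openin_realization_cellular)
      fix e assume "e \<in> edges K"
      then have "{t \<in> {0..1}. edge_point (skel K) e t \<in> ({VPt x} :: ('v, 'd, 'f) point set)} = {}" using tr by auto
      then show "openin (top_of_set {0..1}) {t \<in> {0..1}. edge_point (skel K) e t \<in> ({VPt x} :: ('v, 'd, 'f) point set)}"
        by (metis openin_empty)
    qed (use x nc in \<open>auto simp: points_def\<close>)
    show "openin (realization K) (points K - {VPt x})"
    proof (rule openin_realization_cellular)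
      fix e assume "e \<in> edges K"
      then have "{t \<in> {0..1}. edge_point (skel K) e t \<in> points K - {VPt x}} = {0..1}"
        using tr edge_point_in_points by auto
      then show "openin (top_of_set {0..1}) {t \<in> {0..1}. edge_point (skel K) e t \<in> points K - {VPt x}}"
        by (metis openin_subtopology_self)
    qed (auto simp: points_def)
  qed auto
  moreover have "EPt e (1/2) \<in> points K" "VPt x \<in> points K"
    using edge_point_in_points[OF e, of "1/2"] x by (auto simp: edge_point_def points_def)
  ultimately show False by blast
qed

text \<open>The hypotheses on the curve in the surface, carried over to the realization by the embedding.\<close>

lemma embedded_curve_cuts:
  assumes S: "closed_surface S" and emb: "cellular_embedding K S \<phi>"
    and z: "z \<subseteq> edges K" "z \<noteq> {}"
    and nonsep: "\<not> separating S (\<phi> ` chain_points (skel K) z)"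
    and op: "orientation_preserving S (\<phi> ` chain_points (skel K) z)"
  shows "\<exists>P M. cut_surface K z P M"
    and "connectedin (realization K) (points K - chain_points (skel K) z)"
proof -
  interpret polygonal K
    using emb by unfold_locales (simp add: cellular_embedding_def)
  have \<phi>: "homeomorphic_map (realization K) S \<phi>" using emb by (simp add: cellular_embedding_def)
  let ?C = "chain_points (skel K) z"
  have C: "?C \<subseteq> points K"
    unfolding chain_points_def using z(1) edge_point_in_points by blast
  have surj: "\<phi> ` points K = topspace S" and inj: "inj_on \<phi> (points K)"
    using homeomorphic_imp_surjective_map[OF \<phi>] homeomorphic_imp_injective_map[OF \<phi>] by auto
  have "\<phi> ` (points K - ?C) = topspace S - \<phi> ` ?C"
    using inj_on_image_set_diff[OF inj, of "points K" ?C] C surj by simp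
  moreover have "connectedin S (topspace S - \<phi> ` ?C)" using nonsep by (simp add: separating_def)
  ultimately show "connectedin (realization K) (points K - ?C)"
    using homeomorphic_map_connectedness[OF \<phi>, of "points K - ?C"] by simp
  have "connectedin S (topspace S)" using S by (simp add: closed_surface_def connectedin_topspace)
  then have con: "connectedin (realization K) (points K)"
    using homeomorphic_map_connectedness[OF \<phi>, of "points K"] surj by simp
  have "orientation_preserving (realization K) ?C"
    using orientation_preserving_homeomorphic[OF \<phi> _ op] C by simp
  then obtain P M where PM: "two_sided (realization K) ?C P M"
    using orientation_preserving_two_sided by blast
  obtain e where e: "e \<in> edges K" using z by blast
  have "cut_surface K z P M"
  proof unfold_locales
    fix p V assume "p \<in> points K" "openin (realization K) V" "p \<in> V"
    then show "\<exists>N. openin (realization K) N \<and> p \<in> N \<and> N \<subseteq> V \<and> connectedin (realization K) (N - {p})"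
      using punctured_neighbourhood[OF \<phi> S, of p V] by simp
  qed (use z(1) PM node_has_dart[OF con e] in auto)
  then show "\<exists>P M. cut_surface K z P M" by blast
qed

lemma special_claw_corner:
  assumes "CornerV c \<in> verts (dg (special_claw K d))" shows "c \<in> corners K"
  using assms by (auto simp: special_claw_def induced_graph_def total_graph_def Let_def)

theorem theorem3p17:
  fixes K :: "('v, 'd, 'f) cell_complex" and S :: "'s topology"
    and \<phi> :: "('v, 'd, 'f) point \<Rightarrow> 's"
    and A :: "('a, 'm) monoid_scheme" and \<alpha> :: "'d \<Rightarrow> 'a"
    and z :: "'d set" and W :: "'d list" and v :: 'v and w' y' :: "'f \<times> nat" and a :: 'a
  defines "G \<equiv> skel K"
  defines "D \<equiv> derived_complex A \<alpha> K"
  defines "Sva \<equiv> connected_component_of_set (realization D) (VPt (v, a))"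
  defines "X \<equiv> {lifted_chain A \<alpha> G z (v, b) | b. b \<in> a <#\<^bsub>A\<^esub> local_group A \<alpha> G v}"
  assumes "closed_surface S"
    and "ordinary_voltage_graph_embedding K S \<phi> A \<alpha>"
    and "z \<in> cycle_space G"
    and "is_cycle (induced_graph G z)"
    and "\<not> separating S (\<phi> ` chain_points G z)"
    and "orientation_preserving S (\<phi> ` chain_points G z)"
    and "eulerian_walk (induced_graph G z) v W"
    and "verts (dg (special_claw K (hd W))) =
           {MidV (under_edge G (hd W)), OldV v, CornerV w', CornerV y'}"
    and "a \<in> carrier A"
  shows "(\<forall>R\<in>regions D Sva X.
            (\<exists>u\<in>total_fiber A \<alpha> K (CornerV w'). total_position A \<alpha> K u \<in> R) \<and>
            (\<exists>u\<in>total_fiber A \<alpha> K (CornerV y'). total_position A \<alpha> K u \<in> R)) \<and>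
         ((\<exists>R\<in>regions D Sva X. \<exists>R'\<in>regions D Sva X. R \<noteq> R') \<longrightarrow>
            (\<forall>R\<in>regions D Sva X. \<exists>B\<subseteq>lifted_cycles A \<alpha> G z.
               finite B \<and> even (card B) \<and> bounded_by D R B))"
proof -
  have emb: "cellular_embedding K S \<phi>" and grp: "group A" "finite (carrier A)"
    and vol: "voltage_assignment A (skel K) \<alpha>"
    using assms(6) by (auto simp: ordinary_voltage_graph_embedding_def)
  have z: "z \<subseteq> edges K" using assms(7) by (auto simp: cycle_space_def G_def)
  have "v \<in> verts (dg (induced_graph G z))"
    using assms(11) by (simp add: eulerian_walk_def walk_def pre_digraph.awalk_def)
  then have v: "v \<in> src K ` z \<union> tgt K ` z" by (simp add: induced_graph_def G_def)
  then have "z \<noteq> {}" by blast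
  note cut = embedded_curve_cuts[OF assms(5) emb z this assms(9,10)[unfolded G_def]]
  obtain P M where PM: "cut_surface K z P M" using cut(1) by blast
  interpret cut_surface K z P M by (rule PM)
  interpret derived_embedding K A \<alpha>
    using polygonal_axioms grp vol by (simp add: derived_embedding_def derived_embedding_axioms_def)
  have vC: "VPt v \<in> curve z" using v unfolding chain_points_VPt by blast
  have corner: "w' \<in> corners K" "y' \<in> corners K"
    using special_claw_corner[of _ K "hd W"] assms(12) by auto
  have DD: "D = derived_complex A \<alpha> K" by (simp add: D_def)
  have Xc: "\<exists>b\<in>carrier A. c = lifted_chain A \<alpha> (skel K) z (v, b)" if cX: "c \<in> X" for c
  proof -
    obtain b where b: "b \<in> a <#\<^bsub>A\<^esub> local_group A \<alpha> G v" "c = lifted_chain A \<alpha> (skel K) z (v, b)"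
      using cX unfolding X_def G_def by blast
    obtain h where h: "h \<in> local_group A \<alpha> G v" "b = a \<otimes>\<^bsub>A\<^esub> h"
      using b(1) unfolding l_coset_def by blast
    obtain p where "walk G v p v" "h = net_voltage A \<alpha> p" using h(1) by (auto simp: local_group_def)
    then have "h \<in> carrier A"
      by (auto simp: walk_def pre_digraph.awalk_def G_def intro!: A.net_voltage_closed)
    then show ?thesis using b(2) h(2) assms(13) by blast
  qed
  have Xz: "c \<subseteq> z \<times> carrier A" if "c \<in> X" for c
    using Xc[OF that] by (auto simp: lifted_chain_def Let_def derived_graph_def induced_graph_def)
  have cover: "points D \<subseteq> D.region_of (faces D)"
    unfolding DD by (rule D_covered[OF edge_has_side node_has_corner])
  have main: "(\<exists>u\<in>total_fiber A \<alpha> K (CornerV w'). total_position A \<alpha> K u \<in> R) \<and>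
      (\<exists>u\<in>total_fiber A \<alpha> K (CornerV y'). total_position A \<alpha> K u \<in> R) \<and>
      (\<exists>B\<subseteq>lifted_cycles A \<alpha> G z. finite B \<and> even (card B) \<and> bounded_by D R B)"
    if R: "R \<in> regions D Sva X" for R
  proof -
    let ?X = "\<Union>c\<in>X. chain_points (skel D) c"
    obtain Q where Q: "Q \<in> connected_components_of (subtopology (realization D) (Sva - ?X))"
      and RQ: "R = (\<Union>f\<in>{f \<in> faces D. FPt f ` ball 0 1 \<subseteq> Q}. face_map D f ` cball 0 1)"
      using R unfolding regions_def by blast
    define FQ where "FQ = {f \<in> faces D. FPt f ` ball 0 1 \<subseteq> Q}"
    have RR: "R = D.region_of FQ" unfolding RQ FQ_def D.region_of_def closed_face_def DD ..
    note comp = D.component_faces[OF Q[unfolded DD Sva_def]]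
    have noF: "FPt f w \<notin> (\<Union>c\<in>X. chain_points (skel (derived_complex A \<alpha> K)) c)"
      for f :: "'f \<times> 'a set" and w
      by (simp add: chain_points_FPt)
    interpret derived_region K A \<alpha> z P M X FQ
    proof unfold_locales
      show "connectedin (realization K) (points K - curve z)" by (rule cut(2))
      show "FQ \<subseteq> faces (derived_complex A \<alpha> K)" by (auto simp: FQ_def DD)
      show "FQ \<noteq> {}" using comp(1)[OF noF cover[unfolded DD]] by (simp add: FQ_def DD)
      show "\<And>c. c \<in> X \<Longrightarrow> c \<subseteq> z \<times> carrier A" by (rule Xz)
      fix F F' p
      assume "F \<in> FQ" "F' \<in> faces (derived_complex A \<alpha> K)"
        "p \<in> closed_face (derived_complex A \<alpha> K) F" "p \<in> closed_face (derived_complex A \<alpha> K) F'"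
        "p \<notin> (\<Union>c\<in>X. chain_points (skel (derived_complex A \<alpha> K)) c)"
      then show "F' \<in> FQ"
        using comp(2)[OF noF cover[unfolded DD], of F F' p] by (simp add: FQ_def DD)
    qed
    have "frontier_lifts v \<subseteq> lifted_cycles A \<alpha> G z"
    proof
      fix c assume "c \<in> frontier_lifts v"
      then obtain b where "b \<in> carrier A" "c = lift_at (v, b)" by (auto simp: frontier_lifts_def)
      moreover have "(v, b) \<in> verts lift_graph" if "b \<in> carrier A" for b
        using v that by (simp add: lift_graph_simps)
      ultimately show "c \<in> lifted_cycles A \<alpha> G z" unfolding lifted_cycles_def G_def by blast
    qed
    then show ?thesis
      using corner_in_region[OF corner(1)] corner_in_region[OF corner(2)]
        frontier_lifts_even[OF vC] region_bounded[OF vC Xc] unfolding RR DD by blast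
  qed
  then show ?thesis by blast
qed

end
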